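(* Let $M$ be a closed Riemannian manifold with Ricci curvature bounded from below by $-K$. Let $T>0$, let $A=A(x,t)$ be a non-negative smooth function, let $\lambda=\lambda(t)$ be a function of $t$, and let $u>0$ be a smooth solution on $M\times[0,T)$ of the heat equation $$(\partial_t-\Delta)u=\lambda(t)u+A(x,t).$$ Let $a>1$, $w=\log u$, and $$F=t\big(|\nabla w|^2-a\,w_t+a(\lambda+u^{-1}A)\big).$$ Then there is a constant $C=C(u^{-1},|A|,|\nabla A|,|\Delta A|,K,a,T)$ such that $$\sup_{M\times[0,T)}F\le C(u^{-1},|A|,|\nabla A|,|\Delta A|,K,a,T).$$
   Context: $\nabla$ and $\Delta$ are the gradient and the Laplace–Beltrami operator on $M$. The Ricci lower bound means $\mathrm{Ric}(X,X)\ge -K|X|^2$ for all tangent vectors $X$. The notation $C(u^{-1},|A|,|\nabla A|,|\Delta A|,K,a,T)$ means a constant depending only on (upper bounds over $M\times[0,T)$ for) the functions $u^{-1}$, $|A|$, $|\nabla A|$, $|\Delta A|$ and on $K$, $a$, $T$; the manifold $M$ (hence its dimension) is fixed. *)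

theory Defs
  imports "HOL-Analysis.Analysis"
begin

section \<open>Smooth functions\<close>

text \<open>
  Only used for sets \<open>S\<close> on which derivatives within \<open>S\<close> are unique: open sets, and
  products \<open>V \<times> [0,T)\<close> with \<open>V\<close> open, where the derivatives at the face \<open>t = 0\<close> are
  one-sided.
\<close>

primrec C_on :: "nat \<Rightarrow> 'e::euclidean_space set \<Rightarrow> ('e \<Rightarrow> real) \<Rightarrow> bool" where
  "C_on 0 S f \<longleftrightarrow> continuous_on S f"
| "C_on (Suc k) S f \<longleftrightarrow>
     f differentiable_on S \<and>
     (\<forall>b\<in>Basis. C_on k S (\<lambda>x. frechet_derivative f (at x within S) b))"

definition smooth_on :: "'e::euclidean_space set \<Rightarrow> ('e \<Rightarrow> real) \<Rightarrow> bool" where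
  "smooth_on S f \<longleftrightarrow> (\<forall>k. C_on k S f)"


section \<open>Riemannian geometry in local coordinates\<close>

text \<open>
  Here \<open>G y\<close> is the matrix \<open>(g\<^sub>i\<^sub>j)\<close> of the metric at the point with coordinates \<open>y\<close>;
  vector fields are given by their components with respect to the coordinate frame.
\<close>

definition pderiv_at :: "'n::finite \<Rightarrow> (real^'n \<Rightarrow> real) \<Rightarrow> real^'n \<Rightarrow> real" where
  "pderiv_at i f y = frechet_derivative f (at y) (axis i 1)"

definition metric_inner ::
    "(real^'n \<Rightarrow> real^'n^'n) \<Rightarrow> real^'n \<Rightarrow> real^'n \<Rightarrow> real^'n \<Rightarrow> real" where
  "metric_inner G y \<xi> \<eta> = \<xi> \<bullet> (G y *v \<eta>)"

text \<open>
  \<open>christoffel G k i j\<close> is \<open>\<Gamma>\<close> with upper index \<open>k\<close> and lower indices \<open>i\<close>, \<open>j\<close>: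
  the \<open>k\<close>-th component of the Levi-Civita derivative of \<open>\<partial>\<^sub>j\<close> in the direction \<open>\<partial>\<^sub>i\<close>.
\<close>

definition christoffel ::
    "(real^'n::finite \<Rightarrow> real^'n^'n) \<Rightarrow> 'n \<Rightarrow> 'n \<Rightarrow> 'n \<Rightarrow> real^'n \<Rightarrow> real" where
  "christoffel G k i j y =
     (\<Sum>l\<in>UNIV. matrix_inv (G y) $ k $ l *
        (pderiv_at i (\<lambda>z. G z $ j $ l) y + pderiv_at j (\<lambda>z. G z $ i $ l) y
          - pderiv_at l (\<lambda>z. G z $ i $ j) y)) / 2"

text \<open>
  \<open>riemann G l k i j\<close> is the \<open>l\<close>-th component of \<open>R(\<partial>\<^sub>i, \<partial>\<^sub>j) \<partial>\<^sub>k\<close>, with the convention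
  \<open>R(X,Y)Z = \<nabla>\<^sub>X \<nabla>\<^sub>Y Z - \<nabla>\<^sub>Y \<nabla>\<^sub>X Z - \<nabla>\<^bsub>[X,Y]\<^esub> Z\<close>, and \<open>Ric(Y,Z)\<close> is the trace of
  \<open>X \<mapsto> R(X,Y)Z\<close>, so that round spheres have positive Ricci curvature.
\<close>

definition riemann ::
    "(real^'n::finite \<Rightarrow> real^'n^'n) \<Rightarrow> 'n \<Rightarrow> 'n \<Rightarrow> 'n \<Rightarrow> 'n \<Rightarrow> real^'n \<Rightarrow> real" where
  "riemann G l k i j y =
     pderiv_at i (christoffel G l j k) y - pderiv_at j (christoffel G l i k) y
     + (\<Sum>m\<in>UNIV. christoffel G l i m y * christoffel G m j k y)
     - (\<Sum>m\<in>UNIV. christoffel G l j m y * christoffel G m i k y)"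

definition ricci :: "(real^'n::finite \<Rightarrow> real^'n^'n) \<Rightarrow> real^'n \<Rightarrow> real^'n \<Rightarrow> real^'n \<Rightarrow> real" where
  "ricci G y \<xi> \<eta> =
     (\<Sum>j\<in>UNIV. \<Sum>k\<in>UNIV. (\<Sum>i\<in>UNIV. riemann G i k i j y) * \<xi> $ j * \<eta> $ k)"

definition coord_grad ::
    "(real^'n::finite \<Rightarrow> real^'n^'n) \<Rightarrow> (real^'n \<Rightarrow> real) \<Rightarrow> real^'n \<Rightarrow> real^'n" where
  "coord_grad G f y = matrix_inv (G y) *v (\<chi> i. pderiv_at i f y)"

text \<open>The divergence of \<open>X\<close> is the trace of its covariant derivative.\<close>

definition coord_div ::
    "(real^'n::finite \<Rightarrow> real^'n^'n) \<Rightarrow> (real^'n \<Rightarrow> real^'n) \<Rightarrow> real^'n \<Rightarrow> real" where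
  "coord_div G X y =
     (\<Sum>i\<in>UNIV. pderiv_at i (\<lambda>z. X z $ i) y
        + (\<Sum>k\<in>UNIV. christoffel G i i k y * X y $ k))"

definition coord_laplacian ::
    "(real^'n::finite \<Rightarrow> real^'n^'n) \<Rightarrow> (real^'n \<Rightarrow> real) \<Rightarrow> real^'n \<Rightarrow> real" where
  "coord_laplacian G f = coord_div G (coord_grad G f)"


section \<open>Closed Riemannian manifolds\<close>

text \<open>
  A chart \<open>(U, \<phi>)\<close> consists of a relatively open set of points and a coordinate map, of
  which only the restriction to \<open>U\<close> matters. The metric is given by its coordinate
  matrices: \<open>metric M (U, \<phi>) y\<close> is the matrix at the point of \<open>U\<close> with coordinates \<open>y\<close>.
\<close>

type_synonym ('a, 'n) chart = "'a set \<times> ('a \<Rightarrow> real^'n)"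

record ('a, 'n) riemannian_manifold =
  points :: "'a set"
  atlas :: "('a, 'n) chart set"
  metric :: "('a, 'n) chart \<Rightarrow> real^'n \<Rightarrow> real^'n^'n"

definition smooth_atlas :: "'a::t2_space set \<Rightarrow> ('a, 'n::finite) chart set \<Rightarrow> bool" where
  "smooth_atlas S \<A> \<longleftrightarrow>
     (\<Union>(U, \<phi>)\<in>\<A>. U) = S \<and>
     (\<forall>(U, \<phi>)\<in>\<A>.
        openin (top_of_set S) U \<and> open (\<phi> ` U) \<and> homeomorphism U (\<phi> ` U) \<phi> (inv_into U \<phi>)) \<and>
     (\<forall>(U, \<phi>)\<in>\<A>. \<forall>(V, \<psi>)\<in>\<A>. \<forall>i.
        smooth_on (\<phi> ` (U \<inter> V)) (\<lambda>y. \<psi> (inv_into U \<phi> y) $ i))"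

definition riemannian_metric ::
    "('a, 'n::finite) chart set \<Rightarrow> (('a, 'n) chart \<Rightarrow> real^'n \<Rightarrow> real^'n^'n) \<Rightarrow> bool" where
  "riemannian_metric \<A> g \<longleftrightarrow>
     (\<forall>(U, \<phi>)\<in>\<A>.
        (\<forall>i j. smooth_on (\<phi> ` U) (\<lambda>y. g (U, \<phi>) y $ i $ j)) \<and>
        (\<forall>y\<in>\<phi> ` U.
           transpose (g (U, \<phi>) y) = g (U, \<phi>) y \<and>
           (\<forall>\<xi>. \<xi> \<noteq> 0 \<longrightarrow> metric_inner (g (U, \<phi>)) y \<xi> \<xi> > 0))) \<and>
     (\<forall>(U, \<phi>)\<in>\<A>. \<forall>(V, \<psi>)\<in>\<A>. \<forall>y\<in>\<phi> ` (U \<inter> V). \<forall>\<xi> \<eta>.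
        let \<tau> = (\<lambda>z. \<psi> (inv_into U \<phi> z)); D = frechet_derivative \<tau> (at y)
        in metric_inner (g (U, \<phi>)) y \<xi> \<eta> = metric_inner (g (V, \<psi>)) (\<tau> y) (D \<xi>) (D \<eta>))"

text \<open>
  Closed means compact without boundary. Second countability is automatic for a compact
  locally Euclidean space; connectedness is not required.
\<close>

definition closed_riemannian_manifold ::
    "('a::t2_space, 'n::finite) riemannian_manifold \<Rightarrow> bool" where
  "closed_riemannian_manifold M \<longleftrightarrow>
     compact (points M) \<and> smooth_atlas (points M) (atlas M) \<and>
     riemannian_metric (atlas M) (metric M)"

text \<open>\<open>Ric(X,X) \<ge> k |X|\<^sup>2\<close> for all tangent vectors \<open>X\<close>, given by components in any chart.\<close>

definition ricci_bounded_below ::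
    "('a, 'n::finite) riemannian_manifold \<Rightarrow> real \<Rightarrow> bool" where
  "ricci_bounded_below M k \<longleftrightarrow>
     (\<forall>(U, \<phi>)\<in>atlas M. \<forall>y\<in>\<phi> ` U. \<forall>\<xi>.
        ricci (metric M (U, \<phi>)) y \<xi> \<xi> \<ge> k * metric_inner (metric M (U, \<phi>)) y \<xi> \<xi>)"

text \<open>
  The following quantities do not depend on the chart around the point, so they are
  computed in an arbitrarily chosen one.
\<close>

definition chart_at :: "('a, 'n::finite) riemannian_manifold \<Rightarrow> 'a \<Rightarrow> ('a, 'n) chart" where
  "chart_at M x = (SOME c. c \<in> atlas M \<and> x \<in> fst c)"

definition grad_norm :: "('a, 'n::finite) riemannian_manifold \<Rightarrow> ('a \<Rightarrow> real) \<Rightarrow> 'a \<Rightarrow> real" where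
  "grad_norm M f x =
     (let (U, \<phi>) = chart_at M x; G = metric M (U, \<phi>);
          X = coord_grad G (\<lambda>y. f (inv_into U \<phi> y)) (\<phi> x)
      in sqrt (metric_inner G (\<phi> x) X X))"

definition laplacian :: "('a, 'n::finite) riemannian_manifold \<Rightarrow> ('a \<Rightarrow> real) \<Rightarrow> 'a \<Rightarrow> real" where
  "laplacian M f x =
     (let (U, \<phi>) = chart_at M x
      in coord_laplacian (metric M (U, \<phi>)) (\<lambda>y. f (inv_into U \<phi> y)) (\<phi> x))"


section \<open>Functions on the space-time \<open>M \<times> [0,T)\<close>\<close>

definition smooth_spacetime ::
    "('a, 'n::finite) riemannian_manifold \<Rightarrow> real \<Rightarrow> ('a \<Rightarrow> real \<Rightarrow> real) \<Rightarrow> bool" where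
  "smooth_spacetime M T f \<longleftrightarrow>
     (\<forall>(U, \<phi>)\<in>atlas M.
        smooth_on (\<phi> ` U \<times> {0..<T}) (\<lambda>(y, t). f (inv_into U \<phi> y) t))"

text \<open>The time derivative on \<open>[0,T)\<close>, one-sided at \<open>t = 0\<close>.\<close>

definition time_deriv :: "real \<Rightarrow> ('a \<Rightarrow> real \<Rightarrow> real) \<Rightarrow> 'a \<Rightarrow> real \<Rightarrow> real" where
  "time_deriv T f x t = vector_derivative (f x) (at t within {0..<T})"

end

theory Submission
  imports Defs
begin

text \<open>
  With \<open>w = log u\<close> the heat equation reads \<open>w\<^sub>t = \<Delta>w + |\<nabla>w|\<^sup>2 + \<lambda> + A/u\<close>, so \<open>F = t Q\<close> with
  \<open>Q = - a \<Delta>w - (a - 1) |\<nabla>w|\<^sup>2\<close>, which no longer involves \<open>\<lambda>\<close>. By Bochner's formula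
  \<open>Q\<^sub>t = \<Delta>Q + 2 \<langle>\<nabla>w, \<nabla>Q\<rangle> - 2 |Hess w|\<^sup>2 - 2 Ric(\<nabla>w, \<nabla>w) - a \<Delta>(A/u) - 2 (a - 1) \<langle>\<nabla>w, \<nabla>(A/u)\<rangle>\<close>,
  and after eliminating \<open>\<Delta>w\<close> the terms in which \<open>A\<close> is not differentiated add up to
  \<open>- (A/u) (Q + |\<nabla>w|\<^sup>2)\<close>, which has the good sign where \<open>Q > 0\<close>. Since \<open>|Hess w|\<^sup>2 \<ge> (\<Delta>w)\<^sup>2 / n\<close>, at a positive maximum of \<open>t Q\<close> the
  term quadratic in \<open>Q\<close> wins. The maximum is taken of \<open>(t - \<epsilon>) Q\<close> on \<open>M \<times> [\<epsilon>, t\<^sub>1]\<close>, with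
  \<open>\<epsilon> \<rightarrow> 0\<close> at the end, so that only derivatives at interior times occur.
\<close>

section \<open>Smooth functions on open sets\<close>

text \<open>The operators of the statement are computed in the chart selected by
  \<open>chart_at\<close>, which may jump from point to point, whereas the maximum principle needs
  one chart on a whole neighbourhood. The Hessian is therefore shown to transform as a tensor, so
  that Laplacian and gradient norm may be evaluated in any chart. Indices are kept lowered where
  possible: multiplication by the metric removes the inverse metric from the Christoffel symbols,
  and no derivative of an inverse matrix has to be expanded. The assumption a > 1 enters through (a
  \<Delta>w)^2 = (Q + (a - 1) |\<nabla>w|^2)^2 \<ge> Q^2 + (a - 1)^2 |\<nabla>w|^4 for Q > 0. The
  second square absorbs the terms linear in |\<nabla>w|^2, which stem from the Ricci bound and from
  <\<nabla>A, \<nabla>w> / u. The first leaves \<alpha> (s Q)^2 \<le> s Q + s^2 R with \<alpha> = 2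
  / (n a^2) and s the time elapsed since \<epsilon>, and this bounds s Q.\<close>

abbreviation dd :: "'e::euclidean_space \<Rightarrow> ('e \<Rightarrow> real) \<Rightarrow> 'e \<Rightarrow> real" where
  "dd v f x \<equiv> frechet_derivative f (at x) v"

lemma dd_eqI: "(f has_derivative f') (at x) \<Longrightarrow> dd v f x = f' v"
  by (metis frechet_derivative_at)

text \<open>\<open>frechet_derivative\<close> is a choice among all derivatives. Both functions have
  the same derivatives within \<open>S\<close>, so the chosen ones coincide, also where none
  exists.\<close>

lemma frechet_derivative_within_cong:
  assumes "\<And>y. y \<in> S \<Longrightarrow> f y = g y" "x \<in> S"
  shows "frechet_derivative f (at x within S) = frechet_derivative g (at x within S)"
proof -
  have "(f has_derivative f') (at x within S) \<longleftrightarrow> (g has_derivative f') (at x within S)" for f'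
    using assms by (metis has_derivative_transform)
  then show ?thesis
    unfolding frechet_derivative_def by simp
qed

lemma dd_cong:
  assumes "open S" "x \<in> S" "\<And>z. z \<in> S \<Longrightarrow> f z = g z"
  shows "dd v f x = dd v g x"
  using frechet_derivative_within_cong[of S f g x] assms at_within_open[of x S] by simp

lemma dd_add:
  "f differentiable at x \<Longrightarrow> g differentiable at x \<Longrightarrow> dd v (\<lambda>z. f z + g z) x = dd v f x + dd v g x"
  by (rule dd_eqI) (auto intro!: derivative_eq_intros simp: frechet_derivative_works[symmetric])

lemma dd_mult:
  "f differentiable at x \<Longrightarrow> g differentiable at x \<Longrightarrow>
    dd v (\<lambda>z. f z * g z) x = f x * dd v g x + dd v f x * g x"
  by (rule dd_eqI) (auto intro!: derivative_eq_intros simp: frechet_derivative_works[symmetric])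

lemma dd_sum:
  assumes "\<And>j. j \<in> J \<Longrightarrow> f j differentiable at x"
  shows "dd v (\<lambda>z. \<Sum>j\<in>J. f j z) x = (\<Sum>j\<in>J. dd v (f j) x)"
  by (rule dd_eqI) (use assms in \<open>auto intro!: derivative_eq_intros simp: frechet_derivative_works[symmetric]\<close>)

section \<open>Closure properties of C^k and smooth functions\<close>

lemma C_on_cong:
  assumes "\<And>x. x \<in> S \<Longrightarrow> f x = g x"
  shows "C_on k S f \<longleftrightarrow> C_on k S g"
  using assms
proof (induction k arbitrary: f g)
  case 0
  then show ?case by (auto intro: continuous_on_cong[THEN iffD1])
next
  case (Suc k)
  have "f differentiable_on S \<longleftrightarrow> g differentiable_on S"
    using Suc.prems unfolding differentiable_on_def
    by (metis differentiable_transform_within zero_less_one)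
  moreover have "C_on k S (\<lambda>x. frechet_derivative f (at x within S) b) \<longleftrightarrow>
      C_on k S (\<lambda>x. frechet_derivative g (at x within S) b)" for b
    using frechet_derivative_within_cong[of S f g] Suc.prems
    by (intro Suc.IH) metis
  ultimately show ?case by simp
qed

lemma C_on_transfer: "C_on k S g \<Longrightarrow> (\<And>x. x \<in> S \<Longrightarrow> f x = g x) \<Longrightarrow> C_on k S f"
  using C_on_cong by blast

text \<open>On an open set \<open>at x within S\<close> is \<open>at x\<close>, so the recursion can
  be read with total derivatives. The closure lemmas below are inductions over this form.\<close>

lemma C_on_Suc_open:
  assumes "open S"
  shows "C_on (Suc k) S f \<longleftrightarrow>
    (\<forall>x\<in>S. f differentiable at x) \<and> (\<forall>b\<in>Basis. C_on k S (dd b f))"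
proof -
  have "C_on k S (\<lambda>x. frechet_derivative f (at x within S) b) \<longleftrightarrow> C_on k S (dd b f)" for b
    using at_within_open[OF _ assms] by (intro C_on_cong) metis
  moreover have "f differentiable_on S \<longleftrightarrow> (\<forall>x\<in>S. f differentiable at x)"
    using differentiable_on_eq_differentiable_at[OF assms] .
  ultimately show ?thesis by simp
qed

text \<open>\<open>S\<close> may have faces with one-sided derivatives, but points of
  \<open>U\<close> are interior to it. This leads from the given smoothness up to t = 0 to open sets
  of space-time, and from a chart to an overlap.\<close>

lemma C_on_open_subset:
  assumes "C_on k S f" "U \<subseteq> S" "open U"
  shows "C_on k U f"
  using assms
proof (induction k arbitrary: f)
  case 0
  then show ?case by (auto intro: continuous_on_subset)
next
  case (Suc k)
  have at: "at x within S = at x" if "x \<in> U" for x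
    using that Suc.prems(2,3) by (meson at_within_interior interiorI)
  have "C_on k U (dd b f)" if "b \<in> Basis" for b
  proof -
    have "C_on k U (\<lambda>x. frechet_derivative f (at x within S) b)"
      using Suc that by simp
    then show ?thesis
      by (rule C_on_cong[THEN iffD1, rotated]) (simp add: at)
  qed
  moreover have "f differentiable at x" if "x \<in> U" for x
    using Suc.prems(1,2) that at[OF that] unfolding C_on.simps differentiable_on_def by (metis subsetD)
  ultimately show ?case
    unfolding C_on_Suc_open[OF Suc.prems(3)] by blast
qed

lemma C_on_Suc_imp: "open S \<Longrightarrow> C_on (Suc k) S f \<Longrightarrow> C_on k S f"
proof (induction k arbitrary: f)
  case 0
  then show ?case
    by (auto simp: differentiable_imp_continuous_on)
next
  case (Suc k)
  then have "C_on (Suc (Suc k)) S f" by simp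
  then have "\<forall>b\<in>Basis. C_on (Suc k) S (dd b f)" "\<forall>x\<in>S. f differentiable at x"
    unfolding C_on_Suc_open[OF \<open>open S\<close>, of "Suc k"] by auto
  then show ?case
    using Suc.IH[OF \<open>open S\<close>] C_on_Suc_open[OF \<open>open S\<close>, of k f] by blast
qed

lemma C_on_const: "open S \<Longrightarrow> C_on k S (\<lambda>x. c)"
  by (induction k arbitrary: c) (simp_all add: C_on_Suc_open del: C_on.simps(2))

lemma C_on_add:
  "open S \<Longrightarrow> C_on k S f \<Longrightarrow> C_on k S g \<Longrightarrow> C_on k S (\<lambda>x. f x + g x)"
proof (induction k arbitrary: f g)
  case 0
  then show ?case by (auto intro: continuous_intros)
next
  case (Suc k)
  have f: "\<And>x. x \<in> S \<Longrightarrow> f differentiable at x" "\<And>b. b \<in> Basis \<Longrightarrow> C_on k S (dd b f)"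
    and g: "\<And>x. x \<in> S \<Longrightarrow> g differentiable at x" "\<And>b. b \<in> Basis \<Longrightarrow> C_on k S (dd b g)"
    using Suc.prems C_on_Suc_open by blast+
  have "dd b (\<lambda>x. f x + g x) x = dd b f x + dd b g x" if "x \<in> S" for x b
    using dd_add[OF f(1)[OF that] g(1)[OF that]] .
  then have "C_on k S (dd b (\<lambda>x. f x + g x))" if "b \<in> Basis" for b
    by (rule C_on_transfer[OF Suc.IH[OF \<open>open S\<close> f(2)[OF that] g(2)[OF that]]])
  then show ?case
    unfolding C_on_Suc_open[OF \<open>open S\<close>] using f(1) g(1) by (auto intro: differentiable_add)
qed

lemma C_on_mult:
  "open S \<Longrightarrow> C_on k S f \<Longrightarrow> C_on k S g \<Longrightarrow> C_on k S (\<lambda>x. f x * g x)"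
proof (induction k arbitrary: f g)
  case 0
  then show ?case by (auto intro: continuous_intros)
next
  case (Suc k)
  have f: "\<And>x. x \<in> S \<Longrightarrow> f differentiable at x" "\<And>b. b \<in> Basis \<Longrightarrow> C_on k S (dd b f)"
    and g: "\<And>x. x \<in> S \<Longrightarrow> g differentiable at x" "\<And>b. b \<in> Basis \<Longrightarrow> C_on k S (dd b g)"
    using Suc.prems C_on_Suc_open by blast+
  have fg: "C_on k S f" "C_on k S g"
    using Suc.prems C_on_Suc_imp by blast+
  have "dd b (\<lambda>x. f x * g x) x = f x * dd b g x + dd b f x * g x" if "x \<in> S" for x b
    using dd_mult[OF f(1)[OF that] g(1)[OF that]] .
  then have "C_on k S (dd b (\<lambda>x. f x * g x))" if "b \<in> Basis" for b
    by (rule C_on_transfer[OF C_on_add[OF \<open>open S\<close> Suc.IH[OF \<open>open S\<close> fg(1) g(2)[OF that]]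
      Suc.IH[OF \<open>open S\<close> f(2)[OF that] fg(2)]]])
  then show ?case
    unfolding C_on_Suc_open[OF \<open>open S\<close>] using f(1) g(1) by (auto intro: differentiable_mult)
qed

lemma C_on_inverse:
  "open S \<Longrightarrow> C_on k S f \<Longrightarrow> (\<And>x. x \<in> S \<Longrightarrow> f x \<noteq> 0) \<Longrightarrow> C_on k S (\<lambda>x. inverse (f x))"
proof (induction k)
  case 0
  then show ?case by (auto intro!: continuous_intros)
next
  case (Suc k)
  have f: "\<And>x. x \<in> S \<Longrightarrow> f differentiable at x" "\<And>b. b \<in> Basis \<Longrightarrow> C_on k S (dd b f)"
    using Suc.prems C_on_Suc_open by blast+
  have i: "C_on k S (\<lambda>x. inverse (f x))"
    using Suc C_on_Suc_imp by blast
  \<comment> \<open>Written as an iterated product, so that \<open>C_on_mult\<close> and the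
    induction hypothesis for the inverse itself apply.\<close>
  have "dd b (\<lambda>x. inverse (f x)) x = -1 * (inverse (f x) * (dd b f x * inverse (f x)))" if "x \<in> S" for x b
    by (rule dd_eqI) (use f that Suc.prems(3) in \<open>auto intro!: derivative_eq_intros simp: frechet_derivative_works[symmetric]\<close>)
  then have "C_on k S (dd b (\<lambda>x. inverse (f x)))" if "b \<in> Basis" for b
    by (rule C_on_transfer[OF C_on_mult[OF \<open>open S\<close> C_on_const[OF \<open>open S\<close>]
      C_on_mult[OF \<open>open S\<close> i C_on_mult[OF \<open>open S\<close> f(2)[OF that] i]]]])
  then show ?case
    unfolding C_on_Suc_open[OF \<open>open S\<close>] using f(1) Suc.prems(3) by (auto intro: differentiable_inverse)
qed

text \<open>A case distinction replaces the induction: the derivative of ln f is f' / f, whose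
  regularity is already known from products and inverses.\<close>

lemma C_on_ln:
  assumes "open S" "C_on k S f" "\<And>x. x \<in> S \<Longrightarrow> 0 < f x"
  shows "C_on k S (\<lambda>x. ln (f x))"
proof (cases k)
  case 0
  then show ?thesis using assms by (force intro!: continuous_intros)
next
  case (Suc k)
  have f: "\<And>x. x \<in> S \<Longrightarrow> f differentiable at x" "\<And>b. b \<in> Basis \<Longrightarrow> C_on k S (dd b f)"
    using assms(2) C_on_Suc_open[OF assms(1)] unfolding Suc by blast+
  have i: "C_on k S (\<lambda>x. inverse (f x))"
    using assms C_on_Suc_imp unfolding Suc by (intro C_on_inverse) force+
  have d: "((\<lambda>x. ln (f x)) has_derivative (\<lambda>b. inverse (f x) * dd b f x)) (at x)" if "x \<in> S" for x
    using assms(3)[OF that] f(1)[OF that]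
    by (auto intro!: derivative_eq_intros simp: frechet_derivative_works[symmetric] divide_inverse)
  have "C_on k S (dd b (\<lambda>x. ln (f x)))" if "b \<in> Basis" for b
    by (rule C_on_transfer[OF C_on_mult[OF assms(1) i f(2)[OF that]]]) (rule dd_eqI[OF d])
  then show ?thesis
    unfolding Suc C_on_Suc_open[OF assms(1)] using d by (auto simp: differentiable_def)
qed

lemma smooth_on_open_subset: "smooth_on S f \<Longrightarrow> U \<subseteq> S \<Longrightarrow> open U \<Longrightarrow> smooth_on U f"
  unfolding smooth_on_def using C_on_open_subset by blast

lemma smooth_on_cong: "(\<And>x. x \<in> S \<Longrightarrow> f x = g x) \<Longrightarrow> smooth_on S f \<longleftrightarrow> smooth_on S g"
  unfolding smooth_on_def using C_on_cong by blast

lemma smooth_on_differentiable: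
  "open S \<Longrightarrow> smooth_on S f \<Longrightarrow> x \<in> S \<Longrightarrow> f differentiable at x"
  unfolding smooth_on_def using C_on_Suc_open by blast

lemma smooth_on_has_derivative:
  "open S \<Longrightarrow> smooth_on S f \<Longrightarrow> x \<in> S \<Longrightarrow> (f has_derivative (\<lambda>v. dd v f x)) (at x)"
  using smooth_on_differentiable frechet_derivative_works by metis

lemma smooth_on_continuous: "smooth_on S f \<Longrightarrow> continuous_on S f"
  unfolding smooth_on_def using C_on.simps(1) by blast

lemma smooth_on_dd: "open S \<Longrightarrow> smooth_on S f \<Longrightarrow> b \<in> Basis \<Longrightarrow> smooth_on S (dd b f)"
  unfolding smooth_on_def using C_on_Suc_open by blast

lemma smooth_on_const: "open S \<Longrightarrow> smooth_on S (\<lambda>x. c)"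
  by (simp add: smooth_on_def C_on_const)

lemma smooth_on_add: "open S \<Longrightarrow> smooth_on S f \<Longrightarrow> smooth_on S g \<Longrightarrow> smooth_on S (\<lambda>x. f x + g x)"
  by (simp add: smooth_on_def C_on_add)

lemma smooth_on_mult: "open S \<Longrightarrow> smooth_on S f \<Longrightarrow> smooth_on S g \<Longrightarrow> smooth_on S (\<lambda>x. f x * g x)"
  by (simp add: smooth_on_def C_on_mult)

lemma smooth_on_inverse:
  "open S \<Longrightarrow> smooth_on S f \<Longrightarrow> (\<And>x. x \<in> S \<Longrightarrow> f x \<noteq> 0) \<Longrightarrow> smooth_on S (\<lambda>x. inverse (f x))"
  by (simp add: smooth_on_def C_on_inverse)

lemma smooth_on_ln:
  "open S \<Longrightarrow> smooth_on S f \<Longrightarrow> (\<And>x. x \<in> S \<Longrightarrow> 0 < f x) \<Longrightarrow> smooth_on S (\<lambda>x. ln (f x))"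
  by (simp add: smooth_on_def C_on_ln)

lemma smooth_on_minus: "open S \<Longrightarrow> smooth_on S f \<Longrightarrow> smooth_on S (\<lambda>x. - f x)"
  using smooth_on_mult[OF _ smooth_on_const[of S "-1"], of f] by simp

lemma smooth_on_diff: "open S \<Longrightarrow> smooth_on S f \<Longrightarrow> smooth_on S g \<Longrightarrow> smooth_on S (\<lambda>x. f x - g x)"
  using smooth_on_add[OF _ _ smooth_on_minus, of S f g] by simp

lemma smooth_on_divide:
  "open S \<Longrightarrow> smooth_on S f \<Longrightarrow> smooth_on S g \<Longrightarrow> (\<And>x. x \<in> S \<Longrightarrow> g x \<noteq> 0) \<Longrightarrow> smooth_on S (\<lambda>x. f x / g x)"
  unfolding divide_inverse by (intro smooth_on_mult smooth_on_inverse)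

lemma smooth_on_sum:
  assumes "open S" "\<And>i. i \<in> I \<Longrightarrow> smooth_on S (f i)"
  shows "smooth_on S (\<lambda>x. \<Sum>i\<in>I. f i x)"
  using assms(2)
  by (induction I rule: infinite_finite_induct)
    (simp_all add: assms(1) smooth_on_const smooth_on_add)

lemma smooth_on_prod:
  assumes "open S" "\<And>i. i \<in> I \<Longrightarrow> smooth_on S (f i)"
  shows "smooth_on S (\<lambda>x. \<Prod>i\<in>I. f i x)"
  using assms(2)
  by (induction I rule: infinite_finite_induct)
    (simp_all add: assms(1) smooth_on_const smooth_on_mult)

lemmas smooth_on_intros = smooth_on_const smooth_on_add smooth_on_mult smooth_on_minus
  smooth_on_diff smooth_on_sum smooth_on_prod

section \<open>Functions on products: pull-back from a factor and slices\<close>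

lemma C_on_fst:
  fixes f :: "'a::euclidean_space \<Rightarrow> real" and I :: "'b::euclidean_space set"
  shows "open V \<Longrightarrow> open I \<Longrightarrow> C_on k V f \<Longrightarrow> C_on k (V \<times> I) (\<lambda>p. f (fst p))"
proof (induction k arbitrary: f)
  case 0
  then show ?case
    by (auto intro!: continuous_on_compose2[of V f] continuous_intros)
next
  case (Suc k)
  have op: "open (V \<times> I)"
    using Suc.prems by (simp add: open_Times)
  have f: "\<And>x. x \<in> V \<Longrightarrow> f differentiable at x" "\<And>b. b \<in> Basis \<Longrightarrow> C_on k V (dd b f)"
    using Suc.prems C_on_Suc_open by blast+
  have d: "((\<lambda>p. f (fst p)) has_derivative (\<lambda>b. dd (fst b) f (fst p))) (at p)" if "p \<in> V \<times> I" for p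
    by (rule has_derivative_compose[OF has_derivative_fst[OF has_derivative_ident]])
      (use that f(1) in \<open>auto simp: frechet_derivative_works[symmetric]\<close>)
  have "C_on k (V \<times> I) (dd b (\<lambda>p. f (fst p)))" if "b \<in> Basis" for b
  proof -
    have "C_on k (V \<times> I) (\<lambda>p. dd (fst b) f (fst p))"
    \<comment> \<open>A basis vector of the product lies in one factor. If it lies in the second,
      \<open>f\<close> is differentiated in direction 0.\<close>
    proof (cases "fst b = 0")
      case True
      have "C_on k (V \<times> I) (\<lambda>p. 0)" by (rule C_on_const[OF op])
      then show ?thesis
        by (rule C_on_cong[THEN iffD2, rotated])
          (use True f(1) in \<open>auto simp: linear_0 linear_frechet_derivative\<close>)
    next
      case False
      then show ?thesis
        using that f(2)[THEN Suc.IH[OF Suc.prems(1,2)]] by (auto simp: Basis_prod_def)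
    qed
    then show ?thesis
      by (rule C_on_cong[THEN iffD2, rotated]) (rule dd_eqI[OF d])
  qed
  then show ?case
    unfolding C_on_Suc_open[OF op] using differentiableI[OF d] by blast
qed

lemma smooth_on_fst:
  fixes f :: "'a::euclidean_space \<Rightarrow> real" and I :: "'b::euclidean_space set"
  shows "open V \<Longrightarrow> open I \<Longrightarrow> smooth_on V f \<Longrightarrow> smooth_on (V \<times> I) (\<lambda>p. f (fst p))"
  by (simp add: smooth_on_def C_on_fst)

lemma has_derivative_slice:
  assumes "(h has_derivative h') (at (y, t))"
  shows "((\<lambda>z. h (z, t)) has_derivative (\<lambda>v. h' (v, 0))) (at y)"
    and "((\<lambda>s. h (y, s)) has_derivative (\<lambda>v. h' (0, v))) (at t)"
proof -
  have "((\<lambda>z. (z, t)) has_derivative (\<lambda>v. (v, 0))) (at y)" "((\<lambda>s. (y, s)) has_derivative (\<lambda>v. (0, v))) (at t)"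
    by (auto intro!: derivative_eq_intros)
  from this[THEN has_derivative_compose, OF assms]
  show "((\<lambda>z. h (z, t)) has_derivative (\<lambda>v. h' (v, 0))) (at y)"
    and "((\<lambda>s. h (y, s)) has_derivative (\<lambda>v. h' (0, v))) (at t)"
    by simp_all
qed

lemma C_on_slice:
  fixes h :: "'a::euclidean_space \<times> 'b::euclidean_space \<Rightarrow> real"
  shows "open V \<Longrightarrow> open I \<Longrightarrow> t \<in> I \<Longrightarrow> C_on k (V \<times> I) h \<Longrightarrow> C_on k V (\<lambda>y. h (y, t))"
proof (induction k arbitrary: h)
  case 0
  then show ?case
    by (auto intro!: continuous_on_compose2[of "V \<times> I" h] continuous_intros)
next
  case (Suc k)
  have op: "open (V \<times> I)"
    using Suc.prems by (simp add: open_Times)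
  have h: "\<And>p. p \<in> V \<times> I \<Longrightarrow> h differentiable at p" "\<And>b. b \<in> Basis \<Longrightarrow> C_on k (V \<times> I) (dd b h)"
    using Suc.prems C_on_Suc_open[OF op] by blast+
  have d: "((\<lambda>z. h (z, t)) has_derivative (\<lambda>v. dd (v, 0) h (y, t))) (at y)" if "y \<in> V" for y
    using that h(1) \<open>t \<in> I\<close>
    by (intro has_derivative_slice) (auto simp: frechet_derivative_works[symmetric])
  have "C_on k V (dd b (\<lambda>y. h (y, t)))" if "b \<in> Basis" for b
  proof -
    have "(b, 0) \<in> (Basis :: ('a \<times> 'b) set)" 
      using that by (simp add: Basis_prod_def)
    then have "C_on k V (\<lambda>y. dd (b, 0) h (y, t))"
      using Suc h(2) by blast
    then show ?thesis
      by (rule C_on_cong[THEN iffD2, rotated]) (rule dd_eqI[OF d])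
  qed
  then show ?case
    unfolding C_on_Suc_open[OF \<open>open V\<close>] using d by (auto simp: differentiable_def)
qed

lemma smooth_on_slice:
  fixes h :: "'a::euclidean_space \<times> 'b::euclidean_space \<Rightarrow> real"
  shows "open V \<Longrightarrow> open I \<Longrightarrow> t \<in> I \<Longrightarrow> smooth_on (V \<times> I) h \<Longrightarrow> smooth_on V (\<lambda>y. h (y, t))"
  by (simp add: smooth_on_def C_on_slice)

section \<open>Derivatives along lines and symmetry of second derivatives\<close>

lemma dd_line:
  assumes "open S" "smooth_on S f" "x + s *\<^sub>R v \<in> S"
  shows "((\<lambda>s. f (x + s *\<^sub>R v)) has_real_derivative dd v f (x + s *\<^sub>R v)) (at s)"
proof -
  have "((\<lambda>s. f (x + s *\<^sub>R v)) has_derivative (\<lambda>r. dd (r *\<^sub>R v) f (x + s *\<^sub>R v))) (at s)"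
    by (rule has_derivative_compose[where g=f and f="\<lambda>s. x + s *\<^sub>R v", OF _ smooth_on_has_derivative[OF assms]])
      (auto intro!: derivative_eq_intros)
  moreover have "dd (r *\<^sub>R v) f (x + s *\<^sub>R v) = r * dd v f (x + s *\<^sub>R v)" for r
    using linear_frechet_derivative[OF smooth_on_differentiable[OF assms]] by (simp add: linear_scale)
  ultimately show ?thesis
    by (simp add: has_field_derivative_def mult_commute_abs)
qed

text \<open>Both orders of differentiation are limits of the same second difference quotient.\<close>

lemma second_difference:
  assumes "open S" "smooth_on S f" "u \<in> Basis" "0 < h"
    and sub: "\<And>s t. 0 \<le> s \<Longrightarrow> s \<le> h \<Longrightarrow> 0 \<le> t \<Longrightarrow> t \<le> h \<Longrightarrow> x + s *\<^sub>R u + t *\<^sub>R v \<in> S"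
  obtains s t where "0 < s" "s < h" "0 < t" "t < h"
    "f (x + h *\<^sub>R u + h *\<^sub>R v) - f (x + h *\<^sub>R u) - f (x + h *\<^sub>R v) + f x
      = h * h * dd v (dd u f) (x + s *\<^sub>R u + t *\<^sub>R v)"
proof -
  have "\<exists>s>0. s < h \<and> (f (x + h *\<^sub>R v + h *\<^sub>R u) - f (x + h *\<^sub>R u)) - (f (x + h *\<^sub>R v + 0 *\<^sub>R u) - f (x + 0 *\<^sub>R u))
      = (h - 0) * (dd u f (x + h *\<^sub>R v + s *\<^sub>R u) - dd u f (x + s *\<^sub>R u))"
    using sub[of _ h] sub[of _ 0] \<open>0 < h\<close>
    by (intro MVT2 DERIV_diff dd_line[OF assms(1,2)]) (auto simp: add_ac)
  then obtain s where s: "0 < s" "s < h"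
    "(f (x + h *\<^sub>R v + h *\<^sub>R u) - f (x + h *\<^sub>R u)) - (f (x + h *\<^sub>R v) - f x)
      = h * (dd u f (x + h *\<^sub>R v + s *\<^sub>R u) - dd u f (x + s *\<^sub>R u))" by auto
  have "\<exists>t>0. t < h \<and> dd u f (x + s *\<^sub>R u + h *\<^sub>R v) - dd u f (x + s *\<^sub>R u + 0 *\<^sub>R v)
      = (h - 0) * dd v (dd u f) (x + s *\<^sub>R u + t *\<^sub>R v)"
    using sub[of s] \<open>0 < h\<close> s
    by (intro MVT2) (auto intro!: dd_line[OF assms(1) smooth_on_dd[OF assms(1-3)]])
  then obtain t where t: "0 < t" "t < h" "dd u f (x + s *\<^sub>R u + h *\<^sub>R v) - dd u f (x + s *\<^sub>R u)
      = h * dd v (dd u f) (x + s *\<^sub>R u + t *\<^sub>R v)" by auto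
  have "f (x + h *\<^sub>R u + h *\<^sub>R v) - f (x + h *\<^sub>R u) - f (x + h *\<^sub>R v) + f x
      = h * (dd u f (x + h *\<^sub>R v + s *\<^sub>R u) - dd u f (x + s *\<^sub>R u))"
    using s(3) by (simp add: add_ac)
  also have "\<dots> = h * (h * dd v (dd u f) (x + s *\<^sub>R u + t *\<^sub>R v))"
    using t(3) by (simp add: add.assoc add.commute[of "h *\<^sub>R v"])
  finally show ?thesis using that s t by (simp add: mult.assoc)
qed

lemma dd_commute:
  assumes "open S" "smooth_on S f" "x \<in> S" "u \<in> Basis" "v \<in> Basis"
  shows "dd u (dd v f) x = dd v (dd u f) x"
proof -
  have "dist (dd u (dd v f) x) (dd v (dd u f) x) \<le> e" if "0 < e" for e
  proof -
    have cont: "isCont (dd u (dd v f)) x" "isCont (dd v (dd u f)) x"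
      using smooth_on_continuous[OF smooth_on_dd[OF assms(1) smooth_on_dd[OF assms(1,2,5)] assms(4)]]
        smooth_on_continuous[OF smooth_on_dd[OF assms(1) smooth_on_dd[OF assms(1,2,4)] assms(5)]]
        assms(1,3) by (simp_all add: continuous_on_eq_continuous_at)
    obtain d1 where d1: "0 < d1" "\<And>y. dist y x < d1 \<Longrightarrow> dist (dd u (dd v f) y) (dd u (dd v f) x) < e / 2"
      using cont(1)[unfolded continuous_at_eps_delta, rule_format, of "e / 2"] \<open>0 < e\<close> by auto
    obtain d2 where d2: "0 < d2" "\<And>y. dist y x < d2 \<Longrightarrow> dist (dd v (dd u f) y) (dd v (dd u f) x) < e / 2"
      using cont(2)[unfolded continuous_at_eps_delta, rule_format, of "e / 2"] \<open>0 < e\<close> by auto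
    obtain r where r: "0 < r" "ball x r \<subseteq> S"
      using assms openE by metis
    \<comment> \<open>The points supplied by \<open>second_difference\<close> are at distance at
      most 2 h from \<open>x\<close>; a third of the minimum keeps them strictly inside all three
      balls.\<close>
    define h where "h = min r (min d1 d2) / 3"
    have h: "0 < h" "3 * h \<le> r" "3 * h \<le> d1" "3 * h \<le> d2"
      using r d1 d2 by (auto simp: h_def)
    have near: "dist (x + s *\<^sub>R a + t *\<^sub>R b) x < 3 * h"
      if "0 \<le> s" "s \<le> h" "0 \<le> t" "t \<le> h" "a \<in> Basis" "b \<in> Basis" for s t a b
    proof -
      have "dist (x + s *\<^sub>R a + t *\<^sub>R b) x = norm (s *\<^sub>R a + t *\<^sub>R b)"
        by (simp add: dist_norm add.assoc)
      also have "\<dots> \<le> norm (s *\<^sub>R a) + norm (t *\<^sub>R b)" by (rule norm_triangle_ineq)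
      finally show ?thesis using that h(1) by simp
    qed
    then have sub: "x + s *\<^sub>R a + t *\<^sub>R b \<in> S"
      if "0 \<le> s" "s \<le> h" "0 \<le> t" "t \<le> h" "a \<in> Basis" "b \<in> Basis" for s t a b
      using that r(2) h(2) by (force simp: dist_commute)
    obtain s t where st: "0 < s" "s < h" "0 < t" "t < h"
      "f (x + h *\<^sub>R u + h *\<^sub>R v) - f (x + h *\<^sub>R u) - f (x + h *\<^sub>R v) + f x
        = h * h * dd v (dd u f) (x + s *\<^sub>R u + t *\<^sub>R v)"
      using second_difference[OF assms(1,2,4) h(1), of x v] sub assms(4,5) by blast
    obtain s' t' where st': "0 < s'" "s' < h" "0 < t'" "t' < h"
      "f (x + h *\<^sub>R v + h *\<^sub>R u) - f (x + h *\<^sub>R v) - f (x + h *\<^sub>R u) + f x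
        = h * h * dd u (dd v f) (x + s' *\<^sub>R v + t' *\<^sub>R u)"
      using second_difference[OF assms(1,2,5) h(1), of x u] sub assms(4,5) by blast
    have "h * h * dd v (dd u f) (x + s *\<^sub>R u + t *\<^sub>R v) = h * h * dd u (dd v f) (x + s' *\<^sub>R v + t' *\<^sub>R u)"
      using st(5) st'(5) by (simp add: algebra_simps)
    then have eq: "dd v (dd u f) (x + s *\<^sub>R u + t *\<^sub>R v) = dd u (dd v f) (x + s' *\<^sub>R v + t' *\<^sub>R u)"
      using h(1) by simp
    have "dist (dd v (dd u f) (x + s *\<^sub>R u + t *\<^sub>R v)) (dd v (dd u f) x) < e / 2"
      using near[of s t u v] st h assms(4,5) by (intro d2) auto
    moreover have "dist (dd u (dd v f) (x + s' *\<^sub>R v + t' *\<^sub>R u)) (dd u (dd v f) x) < e / 2"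
      using near[of s' t' v u] st' h assms(4,5) by (intro d1) auto
    ultimately show ?thesis
      unfolding eq by (metis dist_commute dist_triangle_half_l less_imp_le)
  qed
  then show ?thesis
    by (metis dist_le_zero_iff field_le_epsilon add_0)
qed

section \<open>Positive semidefinite forms\<close>

definition psd :: "('n::finite \<Rightarrow> 'n \<Rightarrow> real) \<Rightarrow> bool" where
  "psd A \<longleftrightarrow> (\<forall>i j. A i j = A j i) \<and> (\<forall>x. 0 \<le> (\<Sum>i\<in>UNIV. \<Sum>j\<in>UNIV. A i j * x i * x j))"

text \<open>The form at x + s e_p as a polynomial in \<open>s\<close>. Nonnegativity for all
  \<open>s\<close> is what both pivot cases of the next proof exploit.\<close>

lemma quadratic_form_shift:
  fixes A :: "'n::finite \<Rightarrow> 'n \<Rightarrow> real"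
  assumes "\<And>i j. A i j = A j i"
  shows "(\<Sum>i\<in>UNIV. \<Sum>j\<in>UNIV. A i j * (x i + (if i = p then s else 0)) * (x j + (if j = p then s else 0)))
    = (\<Sum>i\<in>UNIV. \<Sum>j\<in>UNIV. A i j * x i * x j) + 2 * s * (\<Sum>i\<in>UNIV. A i p * x i) + s\<^sup>2 * A p p"
proof -
  have pull: "(\<Sum>j\<in>UNIV. if i = p then g j else 0) = (if i = p then \<Sum>j\<in>UNIV. g j else 0)"
    for i and g :: "'n \<Rightarrow> real"
    by simp
  have "(\<Sum>i\<in>UNIV. \<Sum>j\<in>UNIV. A i j * (x i + (if i = p then s else 0)) * (x j + (if j = p then s else 0)))
     = (\<Sum>i\<in>UNIV. \<Sum>j\<in>UNIV. A i j * x i * x j + (if j = p then A i j * x i * s else 0)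
        + (if i = p then A i j * x j * s + (if j = p then A i j * s * s else 0) else 0))"
    by (intro sum.cong refl) (auto simp: algebra_simps)
  also have "\<dots> = (\<Sum>i\<in>UNIV. \<Sum>j\<in>UNIV. A i j * x i * x j) + (\<Sum>i\<in>UNIV. A i p * x i * s)
      + (\<Sum>j\<in>UNIV. A p j * x j * s) + A p p * s * s"
    by (simp add: sum.distrib pull sum.delta)
  also have "(\<Sum>j\<in>UNIV. A p j * x j * s) = (\<Sum>i\<in>UNIV. A i p * x i * s)"
    using assms by (intro sum.cong) auto
  finally show ?thesis
    by (simp add: sum_distrib_left power2_eq_square algebra_simps)
qed

text \<open>Gaussian elimination in place of a spectral decomposition: induction over the set of
  indices supporting \<open>A\<close>. With a positive pivot, a rank one form is split off, whose
  contraction with \<open>B\<close> is a value of the form \<open>B\<close> up to a positive factor;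
  what remains is semidefinite with smaller support.\<close>

lemma psd_contraction_nonneg:
  assumes "psd A" "psd B"
  shows "0 \<le> (\<Sum>i\<in>UNIV. \<Sum>j\<in>UNIV. A i j * B i j)"
proof -
  have "0 \<le> (\<Sum>i\<in>UNIV. \<Sum>j\<in>UNIV. A i j * B i j)"
    if "finite I" "psd A" "\<And>i j. i \<notin> I \<Longrightarrow> A i j = 0" for I A
    using that
  proof (induction I arbitrary: A rule: finite_induct)
    case empty
    then show ?case by simp
  next
    case (insert p I)
    have sym: "A i j = A j i" for i j
      using insert.prems(1) by (simp add: psd_def)
    have pos: "0 \<le> (\<Sum>i\<in>UNIV. \<Sum>j\<in>UNIV. A i j * x i * x j) + 2 * s * (\<Sum>i\<in>UNIV. A i p * x i) + s\<^sup>2 * A p p" for x s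
      using insert.prems(1)[unfolded psd_def, THEN conjunct2, rule_format, of "\<lambda>i. x i + (if i = p then s else 0)"]
      by (simp only: quadratic_form_shift[OF sym])
    have App: "0 \<le> A p p"
      using pos[of "\<lambda>_. 0" 1] by simp
    show ?case
    proof (cases "A p p = 0")
      case True
      \<comment> \<open>Without pivot, the form at e_j + s e_p is affine in \<open>s\<close>, so its
        slope must vanish.\<close>
      have "A p j = 0" for j
      proof (rule ccontr)
        assume "A p j \<noteq> 0"
        define x :: "'a \<Rightarrow> real" where "x i = (if i = j then 1 else 0)" for i
        have "(\<Sum>i\<in>UNIV. A i p * x i) = (\<Sum>i\<in>UNIV. if i = j then A i p else 0)"
          unfolding x_def by (intro sum.cong) auto
        then have "(\<Sum>i\<in>UNIV. A i p * x i) = A p j"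
          by (simp add: sym)
        moreover have "(\<Sum>i\<in>UNIV. \<Sum>k\<in>UNIV. A i k * x i * x k) = (\<Sum>i\<in>UNIV. if i = j then A i j else 0)"
        proof (intro sum.cong refl)
          fix i
          have "(\<Sum>k\<in>UNIV. A i k * x i * x k) = (\<Sum>k\<in>UNIV. if k = j then A i k * x i else 0)"
            unfolding x_def by (intro sum.cong) auto
          then show "(\<Sum>k\<in>UNIV. A i k * x i * x k) = (if i = j then A i j else 0)"
            by (simp add: x_def)
        qed
        ultimately have "0 \<le> A j j + 2 * s * A p j" for s
          using pos[of x s] True by simp
        \<comment> \<open>For this \<open>s\<close> the right-hand side is -1.\<close>
        from this[of "- (A j j + 1) / (2 * A p j)"] \<open>A p j \<noteq> 0\<close> show False
          by (simp add: field_simps)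
      qed
      then show ?thesis
        using insert by (metis insert_iff)
    next
      case False
      \<comment> \<open>The Schur complement of the entry \<open>A p p\<close>; its row and column
        \<open>p\<close> vanish.\<close>
      define A' where "A' i j = A i j - A i p * A j p / A p p" for i j
      have "0 \<le> (\<Sum>i\<in>UNIV. \<Sum>j\<in>UNIV. A' i j * x i * x j)" for x
      proof -
        define c where "c = (\<Sum>i\<in>UNIV. A i p * x i)"
        have "(\<Sum>i\<in>UNIV. \<Sum>j\<in>UNIV. A' i j * x i * x j) =
            (\<Sum>i\<in>UNIV. \<Sum>j\<in>UNIV. A i j * x i * x j - (A i p * x i) * (A j p * x j) / A p p)"
          by (intro sum.cong refl) (simp add: A'_def algebra_simps)
        also have "\<dots> = (\<Sum>i\<in>UNIV. \<Sum>j\<in>UNIV. A i j * x i * x j) - c * c / A p p"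
          by (simp add: c_def sum_subtractf sum_product sum_divide_distrib)
        \<comment> \<open>The reduced form at \<open>x\<close> is the minimum over \<open>s\<close>
          of the original one at x + s e_p, attained at s = - c / A p p.\<close>
        also have "\<dots> = (\<Sum>i\<in>UNIV. \<Sum>j\<in>UNIV. A i j * x i * x j) + 2 * (- c / A p p) * c + (- c / A p p)\<^sup>2 * A p p"
          using False by (simp add: field_simps power2_eq_square)
        also have "\<dots> \<ge> 0" unfolding c_def by (rule pos)
        finally show ?thesis .
      qed
      then have "psd A'"
        unfolding psd_def by (auto simp: A'_def sym mult.commute)
      moreover have "A' i j = 0" if "i \<notin> I" for i j
      proof (cases "i = p")
        case True
        then show ?thesis using False sym[of p j] by (simp add: A'_def)
      next
        case False
        then show ?thesis using that insert.prems(2) by (simp add: A'_def)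
      qed
      ultimately have "0 \<le> (\<Sum>i\<in>UNIV. \<Sum>j\<in>UNIV. A' i j * B i j)"
        by (rule insert.IH)
      also have "\<dots> = (\<Sum>i\<in>UNIV. \<Sum>j\<in>UNIV. A i j * B i j - B i j * A i p * A j p / A p p)"
        by (intro sum.cong refl) (simp add: A'_def algebra_simps)
      also have "\<dots> = (\<Sum>i\<in>UNIV. \<Sum>j\<in>UNIV. A i j * B i j)
          - (\<Sum>i\<in>UNIV. \<Sum>j\<in>UNIV. B i j * A i p * A j p) / A p p"
        by (simp add: sum_subtractf sum_divide_distrib)
      \<comment> \<open>The subtracted double sum is the form \<open>B\<close> at the pivot column
        of \<open>A\<close>.\<close>
      also have "\<dots> \<le> (\<Sum>i\<in>UNIV. \<Sum>j\<in>UNIV. A i j * B i j)"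
        using assms(2) App unfolding psd_def by simp
      finally show ?thesis .
    qed
  qed
  from this[of UNIV A] assms(1) show ?thesis by simp
qed

section \<open>Calculus in coordinates\<close>

lemma axis_Basis [simp]: "axis i (1::real) \<in> Basis"
  by (simp add: axis_in_Basis_iff)

lemma pderiv_at_cong:
  "open V \<Longrightarrow> y \<in> V \<Longrightarrow> (\<And>z. z \<in> V \<Longrightarrow> f z = g z) \<Longrightarrow> pderiv_at i f y = pderiv_at i g y"
  unfolding pderiv_at_def by (rule dd_cong)

lemma pderiv_at_const [simp]: "pderiv_at i (\<lambda>z. c) y = 0"
  by (simp add: pderiv_at_def)

lemma pderiv_at_add:
  "f differentiable at y \<Longrightarrow> g differentiable at y \<Longrightarrow>
    pderiv_at i (\<lambda>z. f z + g z) y = pderiv_at i f y + pderiv_at i g y"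
  unfolding pderiv_at_def by (rule dd_add)

lemma pderiv_at_mult:
  "f differentiable at y \<Longrightarrow> g differentiable at y \<Longrightarrow>
    pderiv_at i (\<lambda>z. f z * g z) y = f y * pderiv_at i g y + pderiv_at i f y * g y"
  unfolding pderiv_at_def by (rule dd_mult)

lemma pderiv_at_sum:
  "(\<And>j. j \<in> J \<Longrightarrow> f j differentiable at y) \<Longrightarrow>
    pderiv_at i (\<lambda>z. \<Sum>j\<in>J. f j z) y = (\<Sum>j\<in>J. pderiv_at i (f j) y)"
  unfolding pderiv_at_def by (rule dd_sum)

lemma pderiv_at_chain:
  assumes "f differentiable at y" "(\<phi> has_real_derivative d) (at (f y))"
  shows "pderiv_at i (\<lambda>z. \<phi> (f z)) y = d * pderiv_at i f y"
  unfolding pderiv_at_def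
proof (rule dd_eqI)
  show "((\<lambda>z. \<phi> (f z)) has_derivative (\<lambda>v. d * dd v f y)) (at y)"
    by (rule has_derivative_compose[OF assms(1)[unfolded frechet_derivative_works] assms(2)[unfolded has_field_derivative_def]])
qed

lemma smooth_on_pderiv_at: "open V \<Longrightarrow> smooth_on V f \<Longrightarrow> smooth_on V (pderiv_at i f)"
  using smooth_on_dd[of V f "axis i 1"] by (simp add: pderiv_at_def[abs_def])

lemma pderiv_at_commute:
  "open V \<Longrightarrow> smooth_on V f \<Longrightarrow> y \<in> V \<Longrightarrow>
    pderiv_at i (pderiv_at j f) y = pderiv_at j (pderiv_at i f) y"
  using dd_commute[of V f y "axis i 1" "axis j 1"] by (simp add: pderiv_at_def[abs_def])

lemmas expand_sums = distrib_left distrib_right left_diff_distrib right_diff_distrib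
  sum.distrib sum_subtractf sum_distrib_left sum_distrib_right mult_ac

lemma sum_rotate3:
  fixes f :: "'n::finite \<Rightarrow> 'n \<Rightarrow> 'n \<Rightarrow> 'b::comm_monoid_add"
  shows "(\<Sum>i\<in>UNIV. \<Sum>j\<in>UNIV. \<Sum>k\<in>UNIV. f i j k) = (\<Sum>i\<in>UNIV. \<Sum>j\<in>UNIV. \<Sum>k\<in>UNIV. f k i j)"
proof -
  have "(\<Sum>i\<in>UNIV. \<Sum>j\<in>UNIV. \<Sum>k\<in>UNIV. f k i j) = (\<Sum>i\<in>UNIV. \<Sum>k\<in>UNIV. \<Sum>j\<in>UNIV. f k i j)"
    by (intro sum.cong refl sum.swap)
  also have "\<dots> = (\<Sum>k\<in>UNIV. \<Sum>i\<in>UNIV. \<Sum>j\<in>UNIV. f k i j)"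
    by (rule sum.swap)
  finally show ?thesis by simp
qed

lemma sum_rotate4:
  fixes f :: "'n::finite \<Rightarrow> 'n \<Rightarrow> 'n \<Rightarrow> 'n \<Rightarrow> 'b::comm_monoid_add"
  shows "(\<Sum>i\<in>UNIV. \<Sum>j\<in>UNIV. \<Sum>k\<in>UNIV. \<Sum>m\<in>UNIV. f i j k m)
    = (\<Sum>i\<in>UNIV. \<Sum>j\<in>UNIV. \<Sum>k\<in>UNIV. \<Sum>m\<in>UNIV. f m i j k)"
proof -
  have "(\<Sum>i\<in>UNIV. \<Sum>j\<in>UNIV. \<Sum>k\<in>UNIV. \<Sum>m\<in>UNIV. f m i j k)
      = (\<Sum>i\<in>UNIV. \<Sum>m\<in>UNIV. \<Sum>j\<in>UNIV. \<Sum>k\<in>UNIV. f m i j k)"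
    by (intro sum.cong refl sum_rotate3[symmetric, of "\<lambda>m j k. f m _ j k"])
  also have "\<dots> = (\<Sum>m\<in>UNIV. \<Sum>i\<in>UNIV. \<Sum>j\<in>UNIV. \<Sum>k\<in>UNIV. f m i j k)"
    by (rule sum.swap)
  finally show ?thesis by simp
qed

text \<open>
  The Ricci identity at a point: \<open>x\<close>, \<open>p\<close>, \<open>s\<close> stand for the components of a vector field and
  their first and second derivatives, \<open>c\<close> and \<open>e\<close> for the Christoffel symbols and their derivatives.
\<close>

lemma ricci_identity_pointwise:
  fixes x :: "'n::finite \<Rightarrow> real" and p :: "'n \<Rightarrow> 'n \<Rightarrow> real" and s c :: "'n \<Rightarrow> 'n \<Rightarrow> 'n \<Rightarrow> real"
    and e :: "'n \<Rightarrow> 'n \<Rightarrow> 'n \<Rightarrow> 'n \<Rightarrow> real"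
  assumes c: "\<And>i j k. c i j k = c i k j" and s: "\<And>i j k. s i j k = s j i k"
  shows "(\<Sum>i\<in>UNIV. (\<Sum>j\<in>UNIV. p i j * (p j i + (\<Sum>k\<in>UNIV. c i j k * x k))
        + x j * (s i j i + (\<Sum>k\<in>UNIV. e i i j k * x k + c i j k * p i k)))
      + (\<Sum>k\<in>UNIV. c i i k * (\<Sum>j\<in>UNIV. x j * (p j k + (\<Sum>m\<in>UNIV. c k j m * x m)))))
    = (\<Sum>j\<in>UNIV. x j * (\<Sum>i\<in>UNIV. s j i i + (\<Sum>k\<in>UNIV. e j i i k * x k + c i i k * p j k)))
      + (\<Sum>i\<in>UNIV. \<Sum>j\<in>UNIV. (p j i + (\<Sum>k\<in>UNIV. c i j k * x k)) * (p i j + (\<Sum>k\<in>UNIV. c j i k * x k)))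
      + (\<Sum>j\<in>UNIV. \<Sum>k\<in>UNIV. (\<Sum>i\<in>UNIV. e i i j k - e j i i k
          + (\<Sum>m\<in>UNIV. c i i m * c m j k) - (\<Sum>m\<in>UNIV. c i j m * c m i k)) * x j * x k)"
    (is "?L = ?R1 + ?R2 + ?R3")
proof -
  \<comment> \<open>Both sides expand into nine types of monomials. \<open>T8\<close> and
    \<open>T9\<close> occur only on the right: \<open>T8\<close> cancels between \<open>R1\<close>
    and \<open>R3\<close>, \<open>T9\<close> between \<open>R2\<close> and \<open>R3\<close>.
    Symmetry of \<open>s\<close> identifies the two second order terms with
    \<open>T3\<close>.\<close>
  define T1 where "T1 = (\<Sum>i\<in>UNIV. \<Sum>j\<in>UNIV. p i j * p j i)"
  define T2 where "T2 = (\<Sum>i\<in>UNIV. \<Sum>j\<in>UNIV. \<Sum>k\<in>UNIV. p i j * c i j k * x k)"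
  define T3 where "T3 = (\<Sum>i\<in>UNIV. \<Sum>j\<in>UNIV. x j * s i j i)"
  define T4 where "T4 = (\<Sum>i\<in>UNIV. \<Sum>j\<in>UNIV. \<Sum>k\<in>UNIV. x j * e i i j k * x k)"
  define T5 where "T5 = (\<Sum>i\<in>UNIV. \<Sum>j\<in>UNIV. \<Sum>k\<in>UNIV. x j * c i j k * p i k)"
  define T6 where "T6 = (\<Sum>i\<in>UNIV. \<Sum>k\<in>UNIV. \<Sum>j\<in>UNIV. x j * c i i k * p j k)"
  define T7 where "T7 = (\<Sum>i\<in>UNIV. \<Sum>k\<in>UNIV. \<Sum>j\<in>UNIV. \<Sum>m\<in>UNIV. c i i k * c k j m * x j * x m)"
  define T8 where "T8 = (\<Sum>i\<in>UNIV. \<Sum>j\<in>UNIV. \<Sum>k\<in>UNIV. x j * e j i i k * x k)"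
  define T9 where "T9 = (\<Sum>i\<in>UNIV. \<Sum>j\<in>UNIV. \<Sum>k\<in>UNIV. \<Sum>m\<in>UNIV. c i j k * c j i m * x k * x m)"
  have L: "?L = T1 + T2 + T3 + T4 + T5 + T6 + T7"
    unfolding T1_def T2_def T3_def T4_def T5_def T6_def T7_def
    by (simp only: expand_sums)
  have R1: "?R1 = T3 + T8 + T6"
  proof -
    have "?R1 = (\<Sum>j\<in>UNIV. \<Sum>i\<in>UNIV. x j * s j i i) + (\<Sum>j\<in>UNIV. \<Sum>i\<in>UNIV. \<Sum>k\<in>UNIV. x j * e j i i k * x k)
        + (\<Sum>j\<in>UNIV. \<Sum>i\<in>UNIV. \<Sum>k\<in>UNIV. x j * c i i k * p j k)"
      by (simp only: expand_sums) (simp only: add_ac)?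
    also have "(\<Sum>j\<in>UNIV. \<Sum>i\<in>UNIV. x j * s j i i) = T3"
      unfolding T3_def by (subst sum.swap) (simp only: s)
    also have "(\<Sum>j\<in>UNIV. \<Sum>i\<in>UNIV. \<Sum>k\<in>UNIV. x j * e j i i k * x k) = T8"
      unfolding T8_def by (rule sum.swap)
    also have "(\<Sum>j\<in>UNIV. \<Sum>i\<in>UNIV. \<Sum>k\<in>UNIV. x j * c i i k * p j k) = T6"
      unfolding T6_def by (rule sum_rotate3)
    finally show ?thesis .
  qed
  have R2: "?R2 = T1 + T2 + T5 + T9"
  proof -
    have "?R2 = (\<Sum>i\<in>UNIV. \<Sum>j\<in>UNIV. p i j * p j i) + (\<Sum>i\<in>UNIV. \<Sum>j\<in>UNIV. \<Sum>k\<in>UNIV. p j i * c j i k * x k)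
        + (\<Sum>i\<in>UNIV. \<Sum>j\<in>UNIV. \<Sum>k\<in>UNIV. c i j k * x k * p i j)
        + (\<Sum>i\<in>UNIV. \<Sum>j\<in>UNIV. \<Sum>k\<in>UNIV. \<Sum>m\<in>UNIV. c i j k * c j i m * x k * x m)"
      by (simp only: distrib_left distrib_right sum.distrib sum_product)
        (simp only: expand_sums, (simp only: add_ac)?)
    also have "(\<Sum>i\<in>UNIV. \<Sum>j\<in>UNIV. p i j * p j i) = T1"
      unfolding T1_def ..
    also have "(\<Sum>i\<in>UNIV. \<Sum>j\<in>UNIV. \<Sum>k\<in>UNIV. p j i * c j i k * x k) = T2"
      unfolding T2_def by (rule sum.swap)
    also have "(\<Sum>i\<in>UNIV. \<Sum>j\<in>UNIV. \<Sum>k\<in>UNIV. c i j k * x k * p i j) = T5"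
      unfolding T5_def 
      by (rule sum.cong[OF refl], subst sum.swap, intro sum.cong refl) (simp only: c mult_ac)
    finally show ?thesis unfolding T9_def .
  qed
  have R3: "?R3 = T4 - T8 + T7 - T9"
  proof -
    have "?R3 = (\<Sum>j\<in>UNIV. \<Sum>k\<in>UNIV. \<Sum>i\<in>UNIV. x j * e i i j k * x k)
        - (\<Sum>j\<in>UNIV. \<Sum>k\<in>UNIV. \<Sum>i\<in>UNIV. x j * e j i i k * x k)
        + (\<Sum>j\<in>UNIV. \<Sum>k\<in>UNIV. \<Sum>i\<in>UNIV. \<Sum>m\<in>UNIV. c i i m * c m j k * x j * x k)
        - (\<Sum>j\<in>UNIV. \<Sum>k\<in>UNIV. \<Sum>i\<in>UNIV. \<Sum>m\<in>UNIV. c i j m * c m i k * x j * x k)"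
      by (simp only: expand_sums)
    also have "(\<Sum>j\<in>UNIV. \<Sum>k\<in>UNIV. \<Sum>i\<in>UNIV. x j * e i i j k * x k) = T4"
      unfolding T4_def by (rule sum_rotate3[symmetric])
    also have "(\<Sum>j\<in>UNIV. \<Sum>k\<in>UNIV. \<Sum>i\<in>UNIV. x j * e j i i k * x k) = T8"
      unfolding T8_def by (rule sum_rotate3[symmetric])
    also have "(\<Sum>j\<in>UNIV. \<Sum>k\<in>UNIV. \<Sum>i\<in>UNIV. \<Sum>m\<in>UNIV. c i i m * c m j k * x j * x k) = T7"
      unfolding T7_def by (subst (2) sum_rotate4, subst (2) sum_rotate4) (rule refl)
    also have "(\<Sum>j\<in>UNIV. \<Sum>k\<in>UNIV. \<Sum>i\<in>UNIV. \<Sum>m\<in>UNIV. c i j m * c m i k * x j * x k) = T9"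
    proof -
      have "(\<Sum>j\<in>UNIV. \<Sum>k\<in>UNIV. \<Sum>i\<in>UNIV. \<Sum>m\<in>UNIV. c i j m * c m i k * x j * x k)
          = (\<Sum>i\<in>UNIV. \<Sum>m\<in>UNIV. \<Sum>j\<in>UNIV. \<Sum>k\<in>UNIV. c i j m * c m i k * x j * x k)"
        by (subst sum_rotate4, subst sum_rotate4) (rule refl)
      then show ?thesis unfolding T9_def by (simp add: c[of _ _ _])
    qed
    finally show ?thesis .
  qed
  show ?thesis unfolding L R1 R2 R3 by simp
qed


section \<open>Positive definite matrices and traces\<close>

lemma inner_matrix_vector_mult:
  fixes B :: "real^'n::finite^'m::finite"
  shows "x \<bullet> (B *v z) = (\<Sum>i\<in>UNIV. \<Sum>j\<in>UNIV. B $ i $ j * x $ i * z $ j)"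
  by (simp add: inner_vec_def matrix_vector_mult_def sum_distrib_left mult_ac)

lemma psd_matrixI:
  fixes B :: "real^'n::finite^'n"
  assumes "transpose B = B" "\<And>x. 0 \<le> x \<bullet> (B *v x)"
  shows "psd (\<lambda>i j. B $ i $ j)"
  unfolding psd_def
proof (intro conjI allI)
  show "B $ i $ j = B $ j $ i" for i j
    by (subst assms(1)[symmetric]) (simp add: transpose_def)
  show "0 \<le> (\<Sum>i\<in>UNIV. \<Sum>j\<in>UNIV. B $ i $ j * x i * x j)" for x
    using assms(2)[of "\<chi> i. x i"] by (simp add: inner_matrix_vector_mult)
qed

lemma trace_mult_psd_nonneg:
  fixes A B :: "real^'n::finite^'n"
  assumes "psd (\<lambda>i j. A $ i $ j)" "psd (\<lambda>i j. B $ i $ j)"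
  shows "0 \<le> trace (A ** B)"
proof -
  have "trace (A ** B) = (\<Sum>i\<in>UNIV. \<Sum>j\<in>UNIV. A $ i $ j * B $ j $ i)"
    by (simp add: trace_def matrix_matrix_mult_def)
  also have "\<dots> = (\<Sum>i\<in>UNIV. \<Sum>j\<in>UNIV. A $ i $ j * B $ i $ j)"
    using assms(2) by (simp add: psd_def)
  finally show ?thesis
    using psd_contraction_nonneg[OF assms] by simp
qed

text \<open>\<open>matrix_inv\<close> is defined by choice, so its equations rest on the existence
  of a two-sided inverse; a definite form has trivial kernel.\<close>

lemma posdef_matrix_inv:
  fixes G :: "real^'n::finite^'n"
  assumes "\<And>\<xi>. \<xi> \<noteq> 0 \<Longrightarrow> 0 < \<xi> \<bullet> (G *v \<xi>)"
  shows "G ** matrix_inv G = mat 1" "matrix_inv G ** G = mat 1"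
proof -
  have "\<exists>B. B ** G = mat 1"
    unfolding matrix_left_invertible_ker using assms by force
  then have "\<exists>B. G ** B = mat 1 \<and> B ** G = mat 1"
    using matrix_left_right_inverse by blast
  from someI_ex[OF this] show "G ** matrix_inv G = mat 1" "matrix_inv G ** G = mat 1"
    unfolding matrix_inv_def by auto
qed

lemma posdef_matrix_inv_sym:
  fixes G :: "real^'n::finite^'n"
  assumes "transpose G = G" "\<And>\<xi>. \<xi> \<noteq> 0 \<Longrightarrow> 0 < \<xi> \<bullet> (G *v \<xi>)"
  shows "transpose (matrix_inv G) = matrix_inv G"
proof -
  have "transpose (matrix_inv G) ** G = mat 1"
    using posdef_matrix_inv(1)[OF assms(2)] assms(1)
    by (metis matrix_transpose_mul transpose_mat)
  then show ?thesis
    using posdef_matrix_inv(1)[OF assms(2)] by (metis matrix_mul_assoc matrix_mul_lid matrix_mul_rid)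
qed

text \<open>With z the image of \<open>x\<close> under the inverse, the value is that of the form
  \<open>G\<close> at z.\<close>

lemma posdef_matrix_inv_nonneg:
  fixes G :: "real^'n::finite^'n"
  assumes "\<And>\<xi>. \<xi> \<noteq> 0 \<Longrightarrow> 0 < \<xi> \<bullet> (G *v \<xi>)"
  shows "0 \<le> x \<bullet> (matrix_inv G *v x)"
proof -
  have "x = G *v (matrix_inv G *v x)"
    using posdef_matrix_inv(1)[OF assms] by (simp add: matrix_vector_mul_assoc)
  then have "x \<bullet> (matrix_inv G *v x) = (matrix_inv G *v x) \<bullet> (G *v (matrix_inv G *v x))"
    by (metis inner_commute)
  then show ?thesis
    using assms[of "matrix_inv G *v x"] by (cases "matrix_inv G *v x = 0") auto
qed

lemma psd_posdef_matrix_inv: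
  fixes G :: "real^'n::finite^'n"
  assumes "transpose G = G" "\<And>\<xi>. \<xi> \<noteq> 0 \<Longrightarrow> 0 < \<xi> \<bullet> (G *v \<xi>)"
  shows "psd (\<lambda>i j. matrix_inv G $ i $ j)"
  using psd_matrixI posdef_matrix_inv_sym posdef_matrix_inv_nonneg assms by blast

text \<open>Cauchy--Schwarz for the \<open>G\<close>-self-adjoint endomorphism \<open>P\<close> and the identity.\<close>

lemma trace_square_ge:
  fixes G P :: "real^'n::finite^'n"
  assumes sym: "transpose G = G" and pos: "\<And>\<xi>. \<xi> \<noteq> 0 \<Longrightarrow> 0 < \<xi> \<bullet> (G *v \<xi>)"
    and GP: "transpose (G ** P) = G ** P"
  shows "(trace P)\<^sup>2 / real CARD('n) \<le> trace (P ** P)"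
proof -
  \<comment> \<open>\<open>Q\<close> is the trace-free part of \<open>P\<close>; the claim is the
    expansion of trace (Q ** Q) \<ge> 0.\<close>
  define c where "c = trace P / real CARD('n)"
  define Q where "Q = P - mat c"
  define H where "H = G ** Q"
  let ?I = "matrix_inv G"
  have diff: "G ** (P - mat c) = G ** P - G ** mat c"
    by (simp add: vec_eq_iff matrix_matrix_mult_def right_diff_distrib sum_subtractf)
  have mc: "G ** mat c = (\<chi> i j. c * G $ i $ j)"
    by (simp add: vec_eq_iff matrix_matrix_mult_def mat_def if_distrib mult.commute cong: if_cong)
  have "transpose H = transpose (G ** P) - transpose (G ** mat c)"
    by (simp add: H_def Q_def diff vec_eq_iff transpose_def)
  also have "transpose (G ** mat c) = G ** mat c"
    unfolding mc by (subst (2) sym[symmetric]) (simp add: transpose_def)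
  finally have Hs: "transpose H = H"
    using GP by (simp add: H_def Q_def diff)
  \<comment> \<open>Since \<open>H\<close> is symmetric, the trace of \<open>Q ** Q\<close> is the
    contraction of the semidefinite matrices \<open>?I\<close> and
    \<open>H ** (?I ** H)\<close>.\<close>
  have QH: "Q = ?I ** H"
    using posdef_matrix_inv(2)[OF pos] by (simp add: H_def matrix_mul_assoc)
  have "psd (\<lambda>i j. (H ** (?I ** H)) $ i $ j)"
  proof (rule psd_matrixI)
    show "transpose (H ** (?I ** H)) = H ** (?I ** H)"
      using Hs posdef_matrix_inv_sym[OF sym pos] by (simp add: matrix_transpose_mul matrix_mul_assoc)
    fix x
    have "x \<bullet> ((H ** (?I ** H)) *v x) = (x v* H) \<bullet> (?I *v (H *v x))"
      by (simp add: dot_lmul_matrix matrix_vector_mul_assoc matrix_mul_assoc)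
    also have "x v* H = H *v x"
      by (metis Hs vector_transpose_matrix)
    also have "(H *v x) \<bullet> (?I *v (H *v x)) \<ge> 0"
      by (rule posdef_matrix_inv_nonneg[OF pos])
    finally show "0 \<le> x \<bullet> ((H ** (?I ** H)) *v x)" .
  qed
  then have "0 \<le> trace (?I ** (H ** (?I ** H)))"
    by (intro trace_mult_psd_nonneg psd_posdef_matrix_inv[OF sym pos])
  also have "?I ** (H ** (?I ** H)) = Q ** Q"
    by (simp add: QH matrix_mul_assoc)
  also have "trace (Q ** Q) = (\<Sum>i\<in>UNIV. \<Sum>k\<in>UNIV. P $ i $ k * P $ k $ i + (if k = i then c * c - 2 * c * P $ i $ i else 0))"
    unfolding trace_def matrix_matrix_mult_def Q_def mat_def
    by (simp, intro sum.cong refl) (auto simp: algebra_simps)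
  also have "\<dots> = trace (P ** P) + real CARD('n) * (c * c) - 2 * c * trace P"
    by (simp add: trace_def matrix_matrix_mult_def sum.distrib sum_subtractf sum_distrib_left)
  also have "\<dots> = trace (P ** P) - (trace P)\<^sup>2 / real CARD('n)"
    by (simp add: c_def power2_eq_square field_simps)
  finally show ?thesis by simp
qed

section \<open>Gradient, covariant derivative and Hessian in coordinates\<close>

text \<open>The covariant derivative of \<open>X\<close> as an endomorphism: column \<open>i\<close>
  is the derivative of \<open>X\<close> along the i-th coordinate field. For a gradient it is the
  Hessian with one index raised.\<close>

definition cov :: "(real^'n::finite \<Rightarrow> real^'n^'n) \<Rightarrow> (real^'n \<Rightarrow> real^'n) \<Rightarrow> real^'n \<Rightarrow> real^'n^'n" where
  "cov G X y = (\<chi> m i. pderiv_at i (\<lambda>z. X z $ m) y + (\<Sum>k\<in>UNIV. christoffel G m i k y * X y $ k))"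

lemma coord_div_eq_trace: "coord_div G X y = trace (cov G X y)"
  by (simp add: coord_div_def cov_def trace_def)

text \<open>The scalar product <\<nabla>f, \<nabla>h> in the form df(\<nabla>h). Linearity in
  \<open>f\<close> is immediate in this form, and symmetry is
  \<open>grad_inner_swap\<close>.\<close>

definition grad_inner :: "(real^'n::finite \<Rightarrow> real^'n^'n) \<Rightarrow> (real^'n \<Rightarrow> real) \<Rightarrow> (real^'n \<Rightarrow> real) \<Rightarrow> real^'n \<Rightarrow> real" where
  "grad_inner G f h y = (\<Sum>i\<in>UNIV. pderiv_at i f y * coord_grad G h y $ i)"

lemma coord_grad_component:
  "coord_grad G f y $ i = (\<Sum>j\<in>UNIV. matrix_inv (G y) $ i $ j * pderiv_at j f y)"
  by (simp add: coord_grad_def matrix_vector_mult_def)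

text \<open>\<open>V\<close> is a parameter separate from any chart, so that full chart images and
  overlaps of charts are both instances.\<close>

locale metric_coords =
  fixes V :: "(real^'n::finite) set" and G :: "real^'n \<Rightarrow> real^'n^'n"
  assumes open_V: "open V"
    and smooth_G: "smooth_on V (\<lambda>y. G y $ i $ j)"
    and sym_G: "y \<in> V \<Longrightarrow> transpose (G y) = G y"
    and pos_G: "y \<in> V \<Longrightarrow> \<xi> \<noteq> 0 \<Longrightarrow> 0 < \<xi> \<bullet> (G y *v \<xi>)"
begin

lemma G_swap: "y \<in> V \<Longrightarrow> G y $ i $ j = G y $ j $ i"
  by (subst sym_G[symmetric]) (simp_all add: transpose_def)

lemma pderiv_G_swap: "y \<in> V \<Longrightarrow> pderiv_at k (\<lambda>z. G z $ i $ j) y = pderiv_at k (\<lambda>z. G z $ j $ i) y"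
  by (rule pderiv_at_cong[OF open_V _ G_swap])

lemma diff_smooth: "smooth_on V f \<Longrightarrow> y \<in> V \<Longrightarrow> f differentiable at y"
  using smooth_on_differentiable open_V by blast

lemmas V_smooth_intros = smooth_on_intros[OF open_V]

lemma smooth_det:
  assumes "\<And>i j. smooth_on V (\<lambda>y. M y $ i $ j)"
  shows "smooth_on V (\<lambda>y. det (M y :: real^'n^'n))"
  unfolding det_def by (intro V_smooth_intros assms)

text \<open>By Cramer's rule an entry of the inverse is a quotient of determinants, and these are
  polynomials in the entries of \<open>G\<close>.\<close>

lemma smooth_matrix_inv: "smooth_on V (\<lambda>y. matrix_inv (G y) $ i $ j)"
proof -
  have det0: "det (G y) \<noteq> 0" if "y \<in> V" for y
    using posdef_matrix_inv[OF pos_G[OF that]] invertible_det_nz invertible_def by blast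
  have "matrix_inv (G y) $ i $ j = det (\<chi> a b. if b = i then axis j 1 $ a else G y $ a $ b) / det (G y)" if "y \<in> V" for y
  proof -
    have "G y *v (matrix_inv (G y) *v axis j 1) = axis j 1"
      using posdef_matrix_inv[OF pos_G[OF that]] by (simp add: matrix_vector_mul_assoc)
    then have "matrix_inv (G y) *v axis j 1 = (\<chi> k. det (\<chi> a b. if b = k then axis j 1 $ a else G y $ a $ b) / det (G y))"
      unfolding cramer[OF det0[OF that]] .
    moreover have "(matrix_inv (G y) *v axis j 1) $ i = matrix_inv (G y) $ i $ j"
      by (simp add: matrix_vector_mult_basis column_def)
    ultimately show ?thesis by simp
  qed
  moreover have "smooth_on V (\<lambda>y. if b = i then axis j 1 $ a else G y $ a $ b)" for a b
    by (cases "b = i") (auto intro: smooth_G smooth_on_const open_V)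
  then have "smooth_on V (\<lambda>y. det (\<chi> a b. if b = i then axis j 1 $ a else G y $ a $ b) / det (G y))"
    using det0 by (intro smooth_on_divide smooth_det open_V) (auto intro: smooth_G)
  ultimately show ?thesis
    by (rule smooth_on_cong[THEN iffD2])
qed

lemma smooth_christoffel: "smooth_on V (christoffel G k i j)"
proof -
  have "smooth_on V (\<lambda>y. (\<Sum>l\<in>UNIV. matrix_inv (G y) $ k $ l *
        (pderiv_at i (\<lambda>z. G z $ j $ l) y + pderiv_at j (\<lambda>z. G z $ i $ l) y
          - pderiv_at l (\<lambda>z. G z $ i $ j) y)) * (1 / 2))"
    by (intro V_smooth_intros smooth_matrix_inv smooth_on_pderiv_at open_V smooth_G)
  then show ?thesis
    by (simp add: christoffel_def[abs_def])
qed

lemma christoffel_swap: "y \<in> V \<Longrightarrow> christoffel G k i j y = christoffel G k j i y"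
  unfolding christoffel_def by (simp add: pderiv_G_swap[of y _ i j] add.commute)

lemma smooth_coord_grad: "smooth_on V f \<Longrightarrow> smooth_on V (\<lambda>y. coord_grad G f y $ i)"
  unfolding coord_grad_component
  by (intro V_smooth_intros smooth_matrix_inv smooth_on_pderiv_at open_V)

lemma smooth_grad_inner: "smooth_on V f \<Longrightarrow> smooth_on V h \<Longrightarrow> smooth_on V (grad_inner G f h)"
  unfolding grad_inner_def[abs_def]
  by (intro V_smooth_intros smooth_coord_grad smooth_on_pderiv_at open_V)

lemma smooth_coord_div: "(\<And>i. smooth_on V (\<lambda>y. X y $ i)) \<Longrightarrow> smooth_on V (coord_div G X)"
  unfolding coord_div_def[abs_def]
  by (intro V_smooth_intros smooth_christoffel smooth_on_pderiv_at open_V)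

lemma smooth_coord_laplacian: "smooth_on V f \<Longrightarrow> smooth_on V (coord_laplacian G f)"
  unfolding coord_laplacian_def by (intro smooth_coord_div smooth_coord_grad)

lemma lower_raise:
  assumes "y \<in> V"
  shows "(\<Sum>m\<in>UNIV. G y $ l $ m * (\<Sum>a\<in>UNIV. matrix_inv (G y) $ m $ a * d a)) = d l"
proof -
  have "G y *v (matrix_inv (G y) *v (\<chi> a. d a)) = (\<chi> a. d a)"
    using posdef_matrix_inv(1)[OF pos_G[OF assms]] by (simp add: matrix_vector_mul_assoc)
  then show ?thesis
    by (simp add: vec_eq_iff matrix_vector_mult_def)
qed

lemma lower_coord_grad: "y \<in> V \<Longrightarrow> (\<Sum>m\<in>UNIV. G y $ l $ m * coord_grad G f y $ m) = pderiv_at l f y"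
  unfolding coord_grad_component by (rule lower_raise)

text \<open>Lowering the upper index cancels the inverse metric and leaves the Christoffel symbols
  of the first kind.\<close>

lemma lower_christoffel:
  assumes "y \<in> V"
  shows "(\<Sum>m\<in>UNIV. G y $ l $ m * christoffel G m i k y) =
    (pderiv_at i (\<lambda>z. G z $ k $ l) y + pderiv_at k (\<lambda>z. G z $ i $ l) y - pderiv_at l (\<lambda>z. G z $ i $ k) y) / 2"
proof -
  have "(\<Sum>m\<in>UNIV. G y $ l $ m * christoffel G m i k y) = (\<Sum>m\<in>UNIV. G y $ l $ m * (\<Sum>a\<in>UNIV. matrix_inv (G y) $ m $ a *
      (pderiv_at i (\<lambda>z. G z $ k $ a) y + pderiv_at k (\<lambda>z. G z $ i $ a) y - pderiv_at a (\<lambda>z. G z $ i $ k) y))) / 2"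
    by (simp only: christoffel_def times_divide_eq_right sum_divide_distrib[symmetric])
  then show ?thesis
    unfolding lower_raise[OF assms] .
qed

text \<open>The equation that defines the gradient is differentiated with the metric on the left, G
  \<nabla>f = df, so that the inverse metric stays undifferentiated.\<close>

lemma pderiv_lower_coord_grad:
  assumes "y \<in> V" "smooth_on V f"
  shows "(\<Sum>m\<in>UNIV. G y $ l $ m * pderiv_at i (\<lambda>z. coord_grad G f z $ m) y) =
    pderiv_at i (pderiv_at l f) y - (\<Sum>m\<in>UNIV. pderiv_at i (\<lambda>z. G z $ l $ m) y * coord_grad G f y $ m)"
proof -
  have "pderiv_at i (pderiv_at l f) y = pderiv_at i (\<lambda>z. \<Sum>m\<in>UNIV. G z $ l $ m * coord_grad G f z $ m) y"
    by (rule pderiv_at_cong[OF open_V assms(1)]) (simp add: lower_coord_grad)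
  also have "\<dots> = (\<Sum>m\<in>UNIV. pderiv_at i (\<lambda>z. G z $ l $ m * coord_grad G f z $ m) y)"
    by (rule pderiv_at_sum) (intro diff_smooth[OF _ assms(1)] V_smooth_intros smooth_G smooth_coord_grad assms(2))
  also have "\<dots> = (\<Sum>m\<in>UNIV. G y $ l $ m * pderiv_at i (\<lambda>z. coord_grad G f z $ m) y
      + pderiv_at i (\<lambda>z. G z $ l $ m) y * coord_grad G f y $ m)"
    by (intro sum.cong refl pderiv_at_mult diff_smooth[OF _ assms(1)] smooth_G smooth_coord_grad assms(2))
  finally show ?thesis by (simp add: sum.distrib)
qed

text \<open>The coordinate expression of the Hessian: second partial derivatives minus the
  Christoffel symbols of the first kind contracted with \<nabla>f. One metric derivative from the
  product rule and those from the Christoffel symbols combine into the bracket.\<close>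

lemma lower_cov_grad:
  assumes "y \<in> V" "smooth_on V f"
  shows "(G y ** cov G (coord_grad G f) y) $ l $ i = pderiv_at i (pderiv_at l f) y
    + (\<Sum>k\<in>UNIV. (pderiv_at k (\<lambda>z. G z $ i $ l) y - pderiv_at i (\<lambda>z. G z $ l $ k) y - pderiv_at l (\<lambda>z. G z $ i $ k) y)
        * coord_grad G f y $ k) / 2"
proof -
  let ?X = "coord_grad G f y"
  have "(G y ** cov G (coord_grad G f) y) $ l $ i
      = (\<Sum>m\<in>UNIV. G y $ l $ m * pderiv_at i (\<lambda>z. coord_grad G f z $ m) y)
        + (\<Sum>m\<in>UNIV. \<Sum>k\<in>UNIV. G y $ l $ m * christoffel G m i k y * ?X $ k)"
    by (simp add: matrix_matrix_mult_def cov_def distrib_left sum.distrib sum_distrib_left mult.assoc)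
  also have "(\<Sum>m\<in>UNIV. \<Sum>k\<in>UNIV. G y $ l $ m * christoffel G m i k y * ?X $ k)
      = (\<Sum>k\<in>UNIV. (\<Sum>m\<in>UNIV. G y $ l $ m * christoffel G m i k y) * ?X $ k)"
    by (subst sum.swap) (simp add: sum_distrib_right)
  also have "\<dots> = (\<Sum>k\<in>UNIV. (pderiv_at i (\<lambda>z. G z $ l $ k) y + pderiv_at k (\<lambda>z. G z $ i $ l) y
      - pderiv_at l (\<lambda>z. G z $ i $ k) y) / 2 * ?X $ k)"
    unfolding lower_christoffel[OF assms(1)] by (simp add: pderiv_G_swap[OF assms(1), of _ _ l])
  also have "\<dots> = (\<Sum>k\<in>UNIV. pderiv_at i (\<lambda>z. G z $ l $ k) y * ?X $ k)
    + (\<Sum>k\<in>UNIV. (pderiv_at k (\<lambda>z. G z $ i $ l) y - pderiv_at i (\<lambda>z. G z $ l $ k) y - pderiv_at l (\<lambda>z. G z $ i $ k) y)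
        * ?X $ k) / 2"
    unfolding sum_divide_distrib sum.distrib[symmetric]
    by (intro sum.cong refl) (simp add: field_simps)
  finally show ?thesis
    unfolding pderiv_lower_coord_grad[OF assms] by simp
qed

text \<open>Symmetry of the Hessian, that is, self-adjointness of the covariant derivative of
  \<nabla>f; \<open>trace_square_ge\<close> and the test at a maximum depend on it.\<close>

lemma lower_cov_grad_sym:
  assumes "y \<in> V" "smooth_on V f"
  shows "transpose (G y ** cov G (coord_grad G f) y) = G y ** cov G (coord_grad G f) y"
proof -
  have "(G y ** cov G (coord_grad G f) y) $ l $ i = (G y ** cov G (coord_grad G f) y) $ i $ l" for i l
    unfolding lower_cov_grad[OF assms] pderiv_at_commute[OF open_V assms(2,1), of i l]
      pderiv_G_swap[OF assms(1), of _ i l]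
    by (simp add: algebra_simps)
  then show ?thesis
    by (simp add: vec_eq_iff transpose_def)
qed

lemma grad_inner_eq_lower:
  assumes "y \<in> V"
  shows "grad_inner G f h y = (\<Sum>i\<in>UNIV. \<Sum>j\<in>UNIV. G y $ i $ j * coord_grad G f y $ j * coord_grad G h y $ i)"
  unfolding grad_inner_def lower_coord_grad[OF assms, symmetric] by (simp add: sum_distrib_right)

lemma grad_inner_eq_metric_inner:
  assumes "y \<in> V"
  shows "grad_inner G f h y = metric_inner G y (coord_grad G f y) (coord_grad G h y)"
  unfolding grad_inner_eq_lower[OF assms] metric_inner_def inner_vec_def matrix_vector_mult_def
  by (subst sum.swap) (simp add: sum_distrib_left G_swap[OF assms] mult_ac)

lemma grad_inner_swap: "y \<in> V \<Longrightarrow> grad_inner G f h y = grad_inner G h f y"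
  unfolding grad_inner_eq_lower by (subst sum.swap) (simp add: G_swap mult_ac)

lemma grad_inner_nonneg: "y \<in> V \<Longrightarrow> 0 \<le> grad_inner G f f y"
  using pos_G[of y "coord_grad G f y"]
  by (cases "coord_grad G f y = 0") (auto simp: grad_inner_eq_metric_inner metric_inner_def)


section \<open>Bochner's formula\<close>

lemma pderiv_cov:
  assumes "y \<in> V" "\<And>i. smooth_on V (\<lambda>z. X z $ i)"
  shows "pderiv_at i (\<lambda>z. cov G X z $ m $ j) y = pderiv_at i (pderiv_at j (\<lambda>z. X z $ m)) y
    + (\<Sum>k\<in>UNIV. pderiv_at i (christoffel G m j k) y * X y $ k + christoffel G m j k y * pderiv_at i (\<lambda>z. X z $ k) y)"
proof -
  note diff = diff_smooth[OF _ assms(1)] V_smooth_intros smooth_christoffel smooth_on_pderiv_at[OF open_V] assms(2)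
  have "pderiv_at i (\<lambda>z. cov G X z $ m $ j) y = pderiv_at i (pderiv_at j (\<lambda>z. X z $ m)) y
      + pderiv_at i (\<lambda>z. \<Sum>k\<in>UNIV. christoffel G m j k z * X z $ k) y"
    unfolding cov_def vec_lambda_beta by (rule pderiv_at_add) (intro diff)+
  also have "pderiv_at i (\<lambda>z. \<Sum>k\<in>UNIV. christoffel G m j k z * X z $ k) y
      = (\<Sum>k\<in>UNIV. pderiv_at i (\<lambda>z. christoffel G m j k z * X z $ k) y)"
    by (rule pderiv_at_sum) (intro diff)
  also have "\<dots> = (\<Sum>k\<in>UNIV. christoffel G m j k y * pderiv_at i (\<lambda>z. X z $ k) y + pderiv_at i (christoffel G m j k) y * X y $ k)"
    by (intro sum.cong refl pderiv_at_mult diff)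
  finally show ?thesis by (simp add: add.commute)
qed

lemma smooth_cov: "(\<And>i. smooth_on V (\<lambda>z. X z $ i)) \<Longrightarrow> smooth_on V (\<lambda>z. cov G X z $ m $ j)"
  unfolding cov_def vec_lambda_beta
  by (intro V_smooth_intros smooth_christoffel smooth_on_pderiv_at open_V)

text \<open>Bochner's identity before specialising to gradients: div (\<nabla>_X X) is the
  derivative of div X along X, plus the trace of the squared covariant derivative, plus Ric(X, X).
  The curvature appears when the two covariant derivatives of \<open>X\<close> are
  exchanged.\<close>

lemma coord_div_covariant_derivative:
  assumes "y \<in> V" "\<And>i. smooth_on V (\<lambda>z. X z $ i)"
  shows "coord_div G (\<lambda>z. \<chi> m. \<Sum>j\<in>UNIV. X z $ j * cov G X z $ m $ j) y =
    (\<Sum>j\<in>UNIV. X y $ j * pderiv_at j (coord_div G X) y) + trace (cov G X y ** cov G X y) + ricci G y (X y) (X y)"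
proof -
  \<comment> \<open>Freezing all values and derivatives at \<open>y\<close> turns the claim into an
    identity of finite sums.\<close>
  define x where "x j = X y $ j" for j
  define p where "p i j = pderiv_at i (\<lambda>z. X z $ j) y" for i j
  define s where "s i j k = pderiv_at i (pderiv_at j (\<lambda>z. X z $ k)) y" for i j k
  define c where "c i j k = christoffel G i j k y" for i j k
  define e where "e l i j k = pderiv_at l (christoffel G i j k) y" for l i j k
  have cov: "cov G X y $ i $ j = p j i + (\<Sum>k\<in>UNIV. c i j k * x k)" for i j
    by (simp add: cov_def p_def c_def x_def)
  have pcov: "pderiv_at i (\<lambda>z. cov G X z $ m $ j) y = s i j m + (\<Sum>k\<in>UNIV. e i m j k * x k + c m j k * p i k)" for i m j
    unfolding pderiv_cov[OF assms] by (simp add: p_def c_def x_def s_def e_def)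
  have 1: "pderiv_at i (\<lambda>z. \<Sum>j\<in>UNIV. X z $ j * cov G X z $ i $ j) y
      = (\<Sum>j\<in>UNIV. p i j * (p j i + (\<Sum>k\<in>UNIV. c i j k * x k))
        + x j * (s i j i + (\<Sum>k\<in>UNIV. e i i j k * x k + c i j k * p i k)))" for i
  proof -
    have "pderiv_at i (\<lambda>z. \<Sum>j\<in>UNIV. X z $ j * cov G X z $ i $ j) y
      = (\<Sum>j\<in>UNIV. pderiv_at i (\<lambda>z. X z $ j * cov G X z $ i $ j) y)"
      by (rule pderiv_at_sum) (intro diff_smooth[OF _ assms(1)] V_smooth_intros smooth_cov assms(2))
    also have "\<dots> = (\<Sum>j\<in>UNIV. X y $ j * pderiv_at i (\<lambda>z. cov G X z $ i $ j) y + p i j * cov G X y $ i $ j)"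
      unfolding p_def
      by (intro sum.cong refl pderiv_at_mult) (intro diff_smooth[OF _ assms(1)] smooth_cov assms(2))+
    finally show ?thesis
      unfolding cov pcov x_def[symmetric] by (simp only: add.commute)
  qed
  have 2: "pderiv_at j (coord_div G X) y = (\<Sum>i\<in>UNIV. s j i i + (\<Sum>k\<in>UNIV. e j i i k * x k + c i i k * p j k))" for j
  proof -
    have "pderiv_at j (\<lambda>z. \<Sum>i\<in>UNIV. cov G X z $ i $ i) y = (\<Sum>i\<in>UNIV. pderiv_at j (\<lambda>z. cov G X z $ i $ i) y)"
      by (rule pderiv_at_sum) (intro diff_smooth[OF _ assms(1)] smooth_cov assms(2))
    then show ?thesis
      unfolding pcov coord_div_eq_trace[abs_def] trace_def .
  qed
  have "coord_div G (\<lambda>z. \<chi> m. \<Sum>j\<in>UNIV. X z $ j * cov G X z $ m $ j) y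
    = (\<Sum>i\<in>UNIV. (\<Sum>j\<in>UNIV. p i j * (p j i + (\<Sum>k\<in>UNIV. c i j k * x k))
        + x j * (s i j i + (\<Sum>k\<in>UNIV. e i i j k * x k + c i j k * p i k)))
      + (\<Sum>k\<in>UNIV. c i i k * (\<Sum>j\<in>UNIV. x j * (p j k + (\<Sum>m\<in>UNIV. c k j m * x m)))))"
    unfolding coord_div_def vec_lambda_beta 1 cov by (simp only: x_def c_def)
  also have "\<dots> = (\<Sum>j\<in>UNIV. x j * (\<Sum>i\<in>UNIV. s j i i + (\<Sum>k\<in>UNIV. e j i i k * x k + c i i k * p j k)))
      + (\<Sum>i\<in>UNIV. \<Sum>j\<in>UNIV. (p j i + (\<Sum>k\<in>UNIV. c i j k * x k)) * (p i j + (\<Sum>k\<in>UNIV. c j i k * x k)))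
      + (\<Sum>j\<in>UNIV. \<Sum>k\<in>UNIV. (\<Sum>i\<in>UNIV. e i i j k - e j i i k
          + (\<Sum>m\<in>UNIV. c i i m * c m j k) - (\<Sum>m\<in>UNIV. c i j m * c m i k)) * x j * x k)"
  proof (rule ricci_identity_pointwise)
    show "c i j k = c i k j" for i j k
      unfolding c_def by (rule christoffel_swap[OF assms(1)])
    show "s i j k = s j i k" for i j k
      unfolding s_def by (rule pderiv_at_commute[OF open_V assms(2,1)])
  qed
  also have "\<dots> = (\<Sum>j\<in>UNIV. X y $ j * pderiv_at j (coord_div G X) y) + trace (cov G X y ** cov G X y) + ricci G y (X y) (X y)"
    by (simp add: 2 cov trace_def matrix_matrix_mult_def ricci_def riemann_def x_def c_def e_def)
  finally show ?thesis .
qed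

lemma pderiv_grad_inner_self:
  assumes "y \<in> V" "smooth_on V f"
  shows "pderiv_at l (grad_inner G f f) y = 2 * (\<Sum>j\<in>UNIV. coord_grad G f y $ j * pderiv_at l (pderiv_at j f) y)
    - (\<Sum>j\<in>UNIV. \<Sum>k\<in>UNIV. pderiv_at l (\<lambda>z. G z $ j $ k) y * coord_grad G f y $ k * coord_grad G f y $ j)"
proof -
  let ?X = "coord_grad G f"
  have "pderiv_at l (grad_inner G f f) y = (\<Sum>i\<in>UNIV. pderiv_at l (\<lambda>z. pderiv_at i f z * ?X z $ i) y)"
    unfolding grad_inner_def
    by (rule pderiv_at_sum) (intro diff_smooth[OF _ assms(1)] V_smooth_intros smooth_coord_grad smooth_on_pderiv_at open_V assms(2))
  also have "\<dots> = (\<Sum>i\<in>UNIV. pderiv_at i f y * pderiv_at l (\<lambda>z. ?X z $ i) y + pderiv_at l (pderiv_at i f) y * ?X y $ i)"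
    by (intro sum.cong refl pderiv_at_mult diff_smooth[OF _ assms(1)] smooth_coord_grad smooth_on_pderiv_at open_V assms(2))
  also have "\<dots> = (\<Sum>i\<in>UNIV. pderiv_at i f y * pderiv_at l (\<lambda>z. ?X z $ i) y) + (\<Sum>j\<in>UNIV. ?X y $ j * pderiv_at l (pderiv_at j f) y)"
    by (simp add: sum.distrib mult.commute)
  also have "(\<Sum>i\<in>UNIV. pderiv_at i f y * pderiv_at l (\<lambda>z. ?X z $ i) y)
      = (\<Sum>i\<in>UNIV. \<Sum>j\<in>UNIV. G y $ i $ j * ?X y $ j * pderiv_at l (\<lambda>z. ?X z $ i) y)"
    unfolding lower_coord_grad[OF assms(1), symmetric] by (simp add: sum_distrib_right)
  also have "\<dots> = (\<Sum>j\<in>UNIV. \<Sum>i\<in>UNIV. G y $ i $ j * ?X y $ j * pderiv_at l (\<lambda>z. ?X z $ i) y)"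
    by (rule sum.swap)
  also have "\<dots> = (\<Sum>j\<in>UNIV. ?X y $ j * (\<Sum>m\<in>UNIV. G y $ j $ m * pderiv_at l (\<lambda>z. ?X z $ m) y))"
    by (simp add: sum_distrib_left G_swap[OF assms(1), of _ j for j] mult_ac)
  also have "\<dots> = (\<Sum>j\<in>UNIV. ?X y $ j * pderiv_at l (pderiv_at j f) y)
    - (\<Sum>j\<in>UNIV. \<Sum>k\<in>UNIV. pderiv_at l (\<lambda>z. G z $ j $ k) y * ?X y $ k * ?X y $ j)"
    unfolding pderiv_lower_coord_grad[OF assms]
    by (simp add: right_diff_distrib sum_subtractf sum_distrib_left mult_ac)
  finally show ?thesis by simp
qed

text \<open>For X = \<nabla>f the left-hand side is the l-th covariant component of \<nabla>_X X, by
  symmetry of the Hessian half the derivative of |X|^2. Together with the divergence identity this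
  gives Bochner's formula.\<close>

lemma lower_cov_grad_grad:
  assumes "y \<in> V" "smooth_on V f"
  shows "(\<Sum>j\<in>UNIV. coord_grad G f y $ j * (G y ** cov G (coord_grad G f) y) $ l $ j) = pderiv_at l (grad_inner G f f) y / 2"
proof -
  let ?X = "coord_grad G f y"
  define S where "S a = (\<Sum>j\<in>UNIV. \<Sum>k\<in>UNIV. a j k * ?X $ k * ?X $ j)" for a
  have "(\<Sum>j\<in>UNIV. ?X $ j * (G y ** cov G (coord_grad G f) y) $ l $ j)
    = (\<Sum>j\<in>UNIV. ?X $ j * pderiv_at j (pderiv_at l f) y)
      + S (\<lambda>j k. pderiv_at k (\<lambda>z. G z $ j $ l) y - pderiv_at j (\<lambda>z. G z $ l $ k) y - pderiv_at l (\<lambda>z. G z $ j $ k) y) / 2"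
    unfolding lower_cov_grad[OF assms] S_def
    by (simp add: distrib_left sum.distrib sum_distrib_left sum_divide_distrib mult_ac)
  also have "S (\<lambda>j k. pderiv_at k (\<lambda>z. G z $ j $ l) y - pderiv_at j (\<lambda>z. G z $ l $ k) y - pderiv_at l (\<lambda>z. G z $ j $ k) y)
      = S (\<lambda>j k. pderiv_at k (\<lambda>z. G z $ j $ l) y) - S (\<lambda>j k. pderiv_at j (\<lambda>z. G z $ l $ k) y) - S (\<lambda>j k. pderiv_at l (\<lambda>z. G z $ j $ k) y)"
    unfolding S_def by (simp add: left_diff_distrib sum_subtractf)
  \<comment> \<open>Exchanging \<open>j\<close> and \<open>k\<close> makes the first two sums
    cancel, which leaves the metric derivative in direction \<open>l\<close>.\<close>
  also have "S (\<lambda>j k. pderiv_at k (\<lambda>z. G z $ j $ l) y) = S (\<lambda>j k. pderiv_at j (\<lambda>z. G z $ l $ k) y)"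
    unfolding S_def by (subst sum.swap, intro sum.cong refl) (simp add: pderiv_G_swap[OF assms(1), of _ _ l] mult_ac)
  finally show ?thesis
    unfolding pderiv_grad_inner_self[OF assms] S_def
    by (simp add: pderiv_at_commute[OF open_V assms(2,1), of _ l])
qed

lemma cov_grad_grad:
  assumes "y \<in> V" "smooth_on V f"
  shows "(\<chi> m. \<Sum>j\<in>UNIV. coord_grad G f y $ j * cov G (coord_grad G f) y $ m $ j) = (1 / 2) *\<^sub>R coord_grad G (grad_inner G f f) y"
proof -
  let ?P = "cov G (coord_grad G f) y" and ?X = "coord_grad G f y"
  have v: "(\<chi> m. \<Sum>j\<in>UNIV. ?X $ j * ?P $ m $ j) = ?P *v ?X"
    by (simp add: matrix_vector_mult_def vec_eq_iff mult.commute)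
  have "G y *v (?P *v ?X) = (\<chi> l. pderiv_at l (grad_inner G f f) y / 2)"
    using lower_cov_grad_grad[OF assms]
    unfolding matrix_vector_mul_assoc by (simp add: vec_eq_iff matrix_vector_mult_def mult.commute)
  also have "\<dots> = (1 / 2) *\<^sub>R (\<chi> l. pderiv_at l (grad_inner G f f) y)"
    by (simp add: vec_eq_iff)
  finally have "matrix_inv (G y) *v (G y *v (?P *v ?X)) = (1 / 2) *\<^sub>R coord_grad G (grad_inner G f f) y"
    unfolding coord_grad_def by (simp add: matrix_vector_mult_scaleR)
  then show ?thesis
    unfolding v matrix_vector_mul_assoc using posdef_matrix_inv(2)[OF pos_G[OF assms(1)]]
    by (simp add: matrix_mul_assoc)
qed

section \<open>Sum, product and chain rules for gradient, divergence and Laplacian\<close>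

lemma coord_div_cong:
  assumes "\<And>z. z \<in> V \<Longrightarrow> X z = Y z" "y \<in> V"
  shows "coord_div G X y = coord_div G Y y"
proof -
  have "pderiv_at i (\<lambda>z. X z $ i) y = pderiv_at i (\<lambda>z. Y z $ i) y" for i
    by (rule pderiv_at_cong[OF open_V assms(2)]) (simp add: assms)
  then show ?thesis
    by (simp add: coord_div_def assms)
qed

lemma coord_grad_cong:
  assumes "\<And>z. z \<in> V \<Longrightarrow> f z = h z" "y \<in> V"
  shows "coord_grad G f y = coord_grad G h y"
  using pderiv_at_cong[OF open_V assms(2,1)] by (simp add: coord_grad_def)

lemma coord_laplacian_cong:
  assumes "\<And>z. z \<in> V \<Longrightarrow> f z = h z" "y \<in> V"
  shows "coord_laplacian G f y = coord_laplacian G h y"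
  unfolding coord_laplacian_def using assms by (intro coord_div_cong coord_grad_cong)

lemma grad_inner_cong:
  assumes "\<And>z. z \<in> V \<Longrightarrow> f z = f' z" "\<And>z. z \<in> V \<Longrightarrow> h z = h' z" "y \<in> V"
  shows "grad_inner G f h y = grad_inner G f' h' y"
  unfolding grad_inner_def using coord_grad_cong[OF assms(2,3)] pderiv_at_cong[OF open_V assms(3,1)] by simp

lemma coord_div_add:
  assumes "\<And>i. smooth_on V (\<lambda>z. X z $ i)" "\<And>i. smooth_on V (\<lambda>z. Y z $ i)" "y \<in> V"
  shows "coord_div G (\<lambda>z. X z + Y z) y = coord_div G X y + coord_div G Y y"
proof -
  have "pderiv_at i (\<lambda>z. (X z + Y z) $ i) y = pderiv_at i (\<lambda>z. X z $ i) y + pderiv_at i (\<lambda>z. Y z $ i) y" for i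
    unfolding vector_add_component by (intro pderiv_at_add diff_smooth assms)
  then show ?thesis
    by (simp add: coord_div_def distrib_left sum.distrib)
qed

lemma coord_div_scaleR:
  assumes "smooth_on V h" "\<And>i. smooth_on V (\<lambda>z. X z $ i)" "y \<in> V"
  shows "coord_div G (\<lambda>z. h z *\<^sub>R X z) y = h y * coord_div G X y + (\<Sum>i\<in>UNIV. pderiv_at i h y * X y $ i)"
proof -
  have "pderiv_at i (\<lambda>z. (h z *\<^sub>R X z) $ i) y = h y * pderiv_at i (\<lambda>z. X z $ i) y + pderiv_at i h y * X y $ i" for i
    unfolding vector_scaleR_component real_scaleR_def by (intro pderiv_at_mult diff_smooth assms)
  then show ?thesis
    by (simp add: coord_div_def distrib_left sum.distrib sum_distrib_left mult_ac)
qed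

lemma coord_grad_add:
  assumes "smooth_on V f" "smooth_on V h" "y \<in> V"
  shows "coord_grad G (\<lambda>z. f z + h z) y = coord_grad G f y + coord_grad G h y"
  using pderiv_at_add[OF assms(1,2)[THEN diff_smooth, OF assms(3)]]
  by (simp add: vec_eq_iff coord_grad_component distrib_left sum.distrib)

lemma coord_grad_mult:
  assumes "smooth_on V f" "smooth_on V h" "y \<in> V"
  shows "coord_grad G (\<lambda>z. f z * h z) y = f y *\<^sub>R coord_grad G h y + h y *\<^sub>R coord_grad G f y"
  using pderiv_at_mult[OF assms(1,2)[THEN diff_smooth, OF assms(3)]]
  by (simp add: vec_eq_iff coord_grad_component distrib_left sum.distrib sum_distrib_left mult_ac)

lemma coord_grad_chain:
  assumes "smooth_on V f" "(\<phi> has_real_derivative d) (at (f y))" "y \<in> V"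
  shows "coord_grad G (\<lambda>z. \<phi> (f z)) y = d *\<^sub>R coord_grad G f y"
  using pderiv_at_chain[OF diff_smooth[OF assms(1,3)] assms(2)]
  by (simp add: vec_eq_iff coord_grad_component sum_distrib_left mult_ac)

lemma coord_laplacian_const: "coord_laplacian G (\<lambda>z. c) y = 0"
proof -
  have "coord_grad G (\<lambda>z. c) = (\<lambda>y. 0)"
    by (simp add: fun_eq_iff vec_eq_iff coord_grad_component)
  then show ?thesis
    by (simp add: coord_laplacian_def coord_div_def)
qed

lemma coord_laplacian_add:
  assumes "smooth_on V f" "smooth_on V h" "y \<in> V"
  shows "coord_laplacian G (\<lambda>z. f z + h z) y = coord_laplacian G f y + coord_laplacian G h y"
proof -
  have "coord_laplacian G (\<lambda>z. f z + h z) y = coord_div G (\<lambda>z. coord_grad G f z + coord_grad G h z) y"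
    unfolding coord_laplacian_def by (rule coord_div_cong[OF coord_grad_add]) (use assms in auto)
  then show ?thesis
    using assms coord_div_add smooth_coord_grad by (simp add: coord_laplacian_def)
qed

lemma coord_laplacian_mult:
  assumes "smooth_on V f" "smooth_on V h" "y \<in> V"
  shows "coord_laplacian G (\<lambda>z. f z * h z) y = f y * coord_laplacian G h y + h y * coord_laplacian G f y + 2 * grad_inner G f h y"
proof -
  have "coord_laplacian G (\<lambda>z. f z * h z) y = coord_div G (\<lambda>z. f z *\<^sub>R coord_grad G h z + h z *\<^sub>R coord_grad G f z) y"
    unfolding coord_laplacian_def by (rule coord_div_cong[OF coord_grad_mult]) (use assms in auto)
  also have "\<dots> = coord_div G (\<lambda>z. f z *\<^sub>R coord_grad G h z) y + coord_div G (\<lambda>z. h z *\<^sub>R coord_grad G f z) y"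
    by (rule coord_div_add)
      (simp_all add: assms smooth_coord_grad smooth_on_mult open_V)
  also have "\<dots> = f y * coord_laplacian G h y + grad_inner G f h y + (h y * coord_laplacian G f y + grad_inner G h f y)"
    unfolding coord_laplacian_def grad_inner_def
    by (intro arg_cong2[where f="(+)"] coord_div_scaleR smooth_coord_grad assms)
  finally show ?thesis
    by (simp add: grad_inner_swap[OF assms(3), of h f])
qed

text \<open>\<open>d\<close> is the second derivative of \<open>\<phi>\<close> at
  \<open>f y\<close>. The first derivative is prescribed only at values of \<open>f\<close>, which
  admits ln for positive functions.\<close>

lemma coord_laplacian_chain:
  assumes "smooth_on V f" "smooth_on V (\<lambda>z. \<phi>' (f z))" "y \<in> V"
    and "\<And>z. z \<in> V \<Longrightarrow> (\<phi> has_real_derivative \<phi>' (f z)) (at (f z))"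
    and "(\<phi>' has_real_derivative d) (at (f y))"
  shows "coord_laplacian G (\<lambda>z. \<phi> (f z)) y = \<phi>' (f y) * coord_laplacian G f y + d * grad_inner G f f y"
proof -
  have "coord_laplacian G (\<lambda>z. \<phi> (f z)) y = coord_div G (\<lambda>z. \<phi>' (f z) *\<^sub>R coord_grad G f z) y"
    unfolding coord_laplacian_def by (rule coord_div_cong[OF coord_grad_chain]) (use assms in auto)
  also have "\<dots> = \<phi>' (f y) * coord_laplacian G f y + (\<Sum>i\<in>UNIV. pderiv_at i (\<lambda>z. \<phi>' (f z)) y * coord_grad G f y $ i)"
    unfolding coord_laplacian_def by (intro coord_div_scaleR smooth_coord_grad assms)
  finally show ?thesis
    by (simp add: grad_inner_def pderiv_at_chain[OF diff_smooth[OF assms(1,3)] assms(5)] sum_distrib_left mult_ac)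
qed

lemma grad_inner_add_left:
  "smooth_on V f \<Longrightarrow> smooth_on V h \<Longrightarrow> y \<in> V \<Longrightarrow>
    grad_inner G (\<lambda>z. f z + h z) k y = grad_inner G f k y + grad_inner G h k y"
  by (simp add: grad_inner_def pderiv_at_add diff_smooth distrib_right sum.distrib)

lemma grad_inner_mult_left:
  "smooth_on V f \<Longrightarrow> smooth_on V h \<Longrightarrow> y \<in> V \<Longrightarrow>
    grad_inner G (\<lambda>z. f z * h z) k y = f y * grad_inner G h k y + h y * grad_inner G f k y"
  by (simp add: grad_inner_def pderiv_at_mult diff_smooth sum.distrib sum_distrib_left algebra_simps)

lemma grad_inner_chain_left:
  "smooth_on V f \<Longrightarrow> (\<phi> has_real_derivative d) (at (f y)) \<Longrightarrow> y \<in> V \<Longrightarrow>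
    grad_inner G (\<lambda>z. \<phi> (f z)) k y = d * grad_inner G f k y"
  by (simp add: grad_inner_def pderiv_at_chain diff_smooth sum_distrib_left mult_ac)

lemma grad_inner_const_left [simp]: "grad_inner G (\<lambda>z. c) k y = 0"
  by (simp add: grad_inner_def)

text \<open>Bochner's formula for \<nabla>f with |Hess f|^2 estimated from below by its trace part.
  The curvature enters only at \<open>y\<close> and only in the direction of \<nabla>f.\<close>

theorem bochner_inequality:
  assumes "y \<in> V" "smooth_on V f"
    and ric: "- K * metric_inner G y (coord_grad G f y) (coord_grad G f y) \<le> ricci G y (coord_grad G f y) (coord_grad G f y)"
  shows "2 * grad_inner G (coord_laplacian G f) f y + 2 / real CARD('n) * (coord_laplacian G f y)\<^sup>2
    - 2 * K * grad_inner G f f y \<le> coord_laplacian G (grad_inner G f f) y"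
proof -
  let ?X = "coord_grad G f" and ?h = "grad_inner G f f"
  have sX: "smooth_on V (\<lambda>z. ?X z $ i)" for i
    by (rule smooth_coord_grad[OF assms(2)])
  have "coord_div G (\<lambda>z. \<chi> m. \<Sum>j\<in>UNIV. ?X z $ j * cov G ?X z $ m $ j) y = coord_div G (\<lambda>z. (1 / 2) *\<^sub>R coord_grad G ?h z) y"
    by (rule coord_div_cong[OF cov_grad_grad]) (use assms in auto)
  also have "\<dots> = coord_laplacian G ?h y / 2"
    unfolding coord_laplacian_def using assms
    by (subst coord_div_scaleR) (simp_all add: smooth_coord_grad smooth_grad_inner smooth_on_const open_V)
  finally have "coord_laplacian G ?h y / 2 = (\<Sum>j\<in>UNIV. ?X y $ j * pderiv_at j (coord_div G ?X) y)
      + trace (cov G ?X y ** cov G ?X y) + ricci G y (?X y) (?X y)"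
    using coord_div_covariant_derivative[OF assms(1) sX] by simp
  moreover have "(\<Sum>j\<in>UNIV. ?X y $ j * pderiv_at j (coord_div G ?X) y) = grad_inner G (coord_laplacian G f) f y"
    by (simp add: grad_inner_def coord_laplacian_def mult.commute)
  moreover have "(coord_laplacian G f y)\<^sup>2 / real CARD('n) \<le> trace (cov G ?X y ** cov G ?X y)"
    unfolding coord_laplacian_def coord_div_eq_trace
    by (rule trace_square_ge[OF sym_G[OF assms(1)] pos_G[OF assms(1)] lower_cov_grad_sym[OF assms(1,2)]])
  moreover have "- K * ?h y \<le> ricci G y (?X y) (?X y)"
    using ric by (simp add: grad_inner_eq_metric_inner[OF assms(1)])
  ultimately show ?thesis by simp
qed

end

lemma dd_eq_sum_pderiv:
  fixes f :: "real^'n::finite \<Rightarrow> real"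
  assumes "f differentiable at y"
  shows "dd v f y = (\<Sum>i\<in>UNIV. v $ i * pderiv_at i f y)"
proof -
  have l: "linear (\<lambda>v. dd v f y)"
    by (rule linear_frechet_derivative[OF assms])
  have "dd v f y = dd (\<Sum>i\<in>UNIV. v $ i *\<^sub>R axis i 1) f y"
    using basis_expansion[of v] by (simp add: scalar_mult_eq_scaleR)
  also have "\<dots> = (\<Sum>i\<in>UNIV. v $ i * dd (axis i 1) f y)"
    using l by (simp add: linear_sum linear_scale)
  finally show ?thesis
    by (simp add: pderiv_at_def)
qed

lemma congruence_component:
  fixes A B M :: "real^'n::finite^'n"
  shows "(transpose A ** (M ** B)) $ l $ i = (\<Sum>a\<in>UNIV. \<Sum>b\<in>UNIV. A $ a $ l * B $ b $ i * M $ a $ b)"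
  by (simp add: matrix_matrix_mult_def transpose_def sum_distrib_left mult_ac)

section \<open>Change of coordinates\<close>

text \<open>
  The transformation law of the Hessian at a point: \<open>D\<close> and \<open>Q\<close> are the first and second
  derivatives of the coordinate change, \<open>g\<close> and \<open>dg\<close> the metric and its derivatives in the
  target chart, \<open>x\<close> the gradient in the source chart. The terms with \<open>Q\<close> cancel.
\<close>

lemma hessian_transform_pointwise:
  fixes D g f2 :: "'n::finite \<Rightarrow> 'n \<Rightarrow> real" and Q dg :: "'n \<Rightarrow> 'n \<Rightarrow> 'n \<Rightarrow> real" and x x' f1 :: "'n \<Rightarrow> real"
  assumes Q: "\<And>a i j. Q a i j = Q a j i" and g: "\<And>a b. g a b = g b a"
    and x': "\<And>a. x' a = (\<Sum>k\<in>UNIV. D a k * x k)"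
    and f1: "\<And>a. f1 a = (\<Sum>b\<in>UNIV. g a b * x' b)"
    and E: "\<And>k i l. E k i l = (\<Sum>a\<in>UNIV. \<Sum>b\<in>UNIV. Q a i k * D b l * g a b + D a i * Q b l k * g a b
      + D a i * D b l * (\<Sum>c\<in>UNIV. dg c a b * D c k))"
  shows "(\<Sum>a\<in>UNIV. f1 a * Q a l i + (\<Sum>b\<in>UNIV. f2 b a * D b i) * D a l)
      + (\<Sum>k\<in>UNIV. (E k i l - E i l k - E l i k) * x k) / 2
    = (\<Sum>a\<in>UNIV. \<Sum>b\<in>UNIV. D a l * D b i * (f2 b a + (\<Sum>c\<in>UNIV. (dg c b a - dg b a c - dg a b c) * x' c) / 2))"
proof -
  \<comment> \<open>\<open>S\<close> collects the second derivatives of the coordinate change that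
    come from the metric, \<open>N\<close> those contracted with df, \<open>W\<close> the tensorial
    terms. In the combination of the three metric derivatives the \<open>S\<close> cancel in pairs
    and -2 N remains; half of it cancels the \<open>N\<close> from the second derivatives of the
    function.\<close>
  define S where "S i l = (\<Sum>k\<in>UNIV. \<Sum>a\<in>UNIV. \<Sum>b\<in>UNIV. Q a i k * D b l * g a b * x k)" for i l
  define N where "N = (\<Sum>a\<in>UNIV. f1 a * Q a l i)"
  define W where "W h i l = (\<Sum>a\<in>UNIV. \<Sum>b\<in>UNIV. D a i * D b l * (\<Sum>c\<in>UNIV. h a b c * x' c))" for h :: "'n \<Rightarrow> 'n \<Rightarrow> 'n \<Rightarrow> real" and i l
  have S2: "(\<Sum>k\<in>UNIV. \<Sum>a\<in>UNIV. \<Sum>b\<in>UNIV. D a i * Q b l k * g a b * x k) = S l i" for i l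
    unfolding S_def by (rule sum.cong[OF refl], subst sum.swap, intro sum.cong refl) (simp only: g mult_ac)
  have N: "(\<Sum>k\<in>UNIV. \<Sum>a\<in>UNIV. \<Sum>b\<in>UNIV. Q a l i * D b k * g a b * x k) = N"
  proof -
    have "(\<Sum>k\<in>UNIV. \<Sum>a\<in>UNIV. \<Sum>b\<in>UNIV. Q a l i * D b k * g a b * x k)
        = (\<Sum>a\<in>UNIV. \<Sum>b\<in>UNIV. \<Sum>k\<in>UNIV. Q a l i * D b k * g a b * x k)"
      by (rule sum_rotate3[of "\<lambda>k a b. Q a l i * D b k * g a b * x k"])
    then show ?thesis
      unfolding N_def f1 x' by (simp only: sum_distrib_left sum_distrib_right mult_ac)
  qed
  have W1: "(\<Sum>k\<in>UNIV. \<Sum>a\<in>UNIV. \<Sum>b\<in>UNIV. D a i * D b l * (\<Sum>c\<in>UNIV. dg c a b * D c k) * x k) = W (\<lambda>a b c. dg c a b) i l" for i l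
  proof -
    have "(\<Sum>k\<in>UNIV. \<Sum>a\<in>UNIV. \<Sum>b\<in>UNIV. D a i * D b l * (\<Sum>c\<in>UNIV. dg c a b * D c k) * x k)
        = (\<Sum>k\<in>UNIV. \<Sum>a\<in>UNIV. \<Sum>b\<in>UNIV. \<Sum>c\<in>UNIV. D a i * D b l * dg c a b * D c k * x k)"
      by (simp only: sum_distrib_left sum_distrib_right mult_ac)
    also have "\<dots> = (\<Sum>a\<in>UNIV. \<Sum>b\<in>UNIV. \<Sum>c\<in>UNIV. \<Sum>k\<in>UNIV. D a i * D b l * dg c a b * D c k * x k)"
      by (rule sum_rotate4[of "\<lambda>k a b c. D a i * D b l * dg c a b * D c k * x k"])
    finally show ?thesis
      unfolding W_def x' by (simp only: sum_distrib_left sum_distrib_right mult_ac)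
  qed
  have W2: "(\<Sum>k\<in>UNIV. \<Sum>a\<in>UNIV. \<Sum>b\<in>UNIV. D a l * D b k * (\<Sum>c\<in>UNIV. dg c a b * D c i) * x k) = W (\<lambda>a b c. dg b a c) l i" for i l
  proof -
    have "(\<Sum>k\<in>UNIV. \<Sum>a\<in>UNIV. \<Sum>b\<in>UNIV. D a l * D b k * (\<Sum>c\<in>UNIV. dg c a b * D c i) * x k)
        = (\<Sum>k\<in>UNIV. \<Sum>a\<in>UNIV. \<Sum>b\<in>UNIV. \<Sum>c\<in>UNIV. D a l * D b k * dg c a b * D c i * x k)"
      by (simp only: sum_distrib_left sum_distrib_right mult_ac)
    also have "\<dots> = (\<Sum>a\<in>UNIV. \<Sum>b\<in>UNIV. \<Sum>c\<in>UNIV. \<Sum>k\<in>UNIV. D a l * D b k * dg c a b * D c i * x k)"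
      by (rule sum_rotate4[of "\<lambda>k a b c. D a l * D b k * dg c a b * D c i * x k"])
    also have "\<dots> = (\<Sum>a\<in>UNIV. \<Sum>c\<in>UNIV. \<Sum>b\<in>UNIV. \<Sum>k\<in>UNIV. D a l * D b k * dg c a b * D c i * x k)"
      by (intro sum.cong refl sum.swap)
    finally show ?thesis
      unfolding W_def x' by (simp only: sum_distrib_left sum_distrib_right mult_ac)
  qed
  have swapW: "W h i l = W (\<lambda>a b c. h b a c) l i" for h i l
    unfolding W_def by (subst sum.swap, intro sum.cong refl) (simp only: mult_ac)
  have E1: "(\<Sum>k\<in>UNIV. E k i l * x k) = S i l + S l i + W (\<lambda>a b c. dg c a b) i l"
    unfolding E W1[symmetric] S2[of i l, symmetric] unfolding S_def
    by (simp only: sum_distrib_right distrib_right sum.distrib)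
  have E2: "(\<Sum>k\<in>UNIV. E i l k * x k) = N + S i l + W (\<lambda>a b c. dg b a c) l i"
  proof -
    have "S i l = (\<Sum>k\<in>UNIV. \<Sum>a\<in>UNIV. \<Sum>b\<in>UNIV. D a l * Q b k i * g a b * x k)"
      unfolding S2[of l i, symmetric] by (simp only: Q)
    then show ?thesis
      unfolding E W2[symmetric] N[symmetric]
      by (simp only: sum_distrib_right distrib_right sum.distrib)
  qed
  have E3: "(\<Sum>k\<in>UNIV. E l i k * x k) = N + S l i + W (\<lambda>a b c. dg b a c) i l"
  proof -
    have "S l i = (\<Sum>k\<in>UNIV. \<Sum>a\<in>UNIV. \<Sum>b\<in>UNIV. D a i * Q b k l * g a b * x k)"
      unfolding S2[of i l, symmetric] by (simp only: Q)
    moreover have "N = (\<Sum>k\<in>UNIV. \<Sum>a\<in>UNIV. \<Sum>b\<in>UNIV. Q a i l * D b k * g a b * x k)"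
      unfolding N[symmetric] by (simp only: Q)
    ultimately show ?thesis
      unfolding E W2[symmetric]
      by (simp only: sum_distrib_right distrib_right sum.distrib)
  qed
  have "(\<Sum>k\<in>UNIV. (E k i l - E i l k - E l i k) * x k)
      = (\<Sum>k\<in>UNIV. E k i l * x k) - (\<Sum>k\<in>UNIV. E i l k * x k) - (\<Sum>k\<in>UNIV. E l i k * x k)"
    by (simp only: left_diff_distrib sum_subtractf)
  also have "\<dots> = W (\<lambda>a b c. dg c a b) i l - W (\<lambda>a b c. dg b a c) l i - W (\<lambda>a b c. dg b a c) i l - 2 * N"
    unfolding E1 E2 E3 by simp
  also have "\<dots> = W (\<lambda>a b c. dg c b a - dg b a c - dg a b c) l i - 2 * N"
    unfolding swapW[of _ i l] unfolding W_def
    by (simp only: left_diff_distrib right_diff_distrib sum_subtractf)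
  finally have "(\<Sum>k\<in>UNIV. (E k i l - E i l k - E l i k) * x k) / 2 = W (\<lambda>a b c. dg c b a - dg b a c - dg a b c) l i / 2 - N"
    by simp
  moreover have "(\<Sum>a\<in>UNIV. f1 a * Q a l i + (\<Sum>b\<in>UNIV. f2 b a * D b i) * D a l)
      = N + (\<Sum>a\<in>UNIV. \<Sum>b\<in>UNIV. D a l * D b i * f2 b a)"
    unfolding N_def by (simp only: sum.distrib sum_distrib_left sum_distrib_right mult_ac)
  moreover have "(\<Sum>a\<in>UNIV. \<Sum>b\<in>UNIV. D a l * D b i * (f2 b a + (\<Sum>c\<in>UNIV. (dg c b a - dg b a c - dg a b c) * x' c) / 2))
      = (\<Sum>a\<in>UNIV. \<Sum>b\<in>UNIV. D a l * D b i * f2 b a) + W (\<lambda>a b c. dg c b a - dg b a c - dg a b c) l i / 2"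
    unfolding W_def by (simp only: distrib_left sum.distrib sum_divide_distrib[symmetric] times_divide_eq_right)
  ultimately show ?thesis by linarith
qed

text \<open>The coordinate change \<open>\<tau>\<close> as an isometric map of patches.
  Invertibility of its Jacobian is derived from the isometry in \<open>J_inverse\<close>.\<close>

locale chart_change = A: metric_coords V G + B: metric_coords V' G'
  for V V' :: "(real^'n::finite) set" and G G' +
  fixes \<tau> :: "real^'n \<Rightarrow> real^'n"
  assumes \<tau>_in: "y \<in> V \<Longrightarrow> \<tau> y \<in> V'"
    and smooth_\<tau>: "smooth_on V (\<lambda>y. \<tau> y $ i)"
    and isometry: "y \<in> V \<Longrightarrow> metric_inner G y \<xi> \<eta> =
      metric_inner G' (\<tau> y) (frechet_derivative \<tau> (at y) \<xi>) (frechet_derivative \<tau> (at y) \<eta>)"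
begin

definition J :: "real^'n \<Rightarrow> real^'n^'n" where
  "J y = (\<chi> a i. pderiv_at i (\<lambda>z. \<tau> z $ a) y)"

text \<open>Smoothness of \<open>\<tau>\<close> is given by components, while
  \<open>isometry\<close> speaks of its total derivative; the Jacobian matrix connects the
  two.\<close>

lemma \<tau>_deriv:
  assumes "y \<in> V"
  shows "(\<tau> has_derivative (\<lambda>\<xi>. J y *v \<xi>)) (at y)"
proof (subst has_derivative_componentwise_within, intro ballI)
  fix b :: "real^'n" assume "b \<in> Basis"
  then obtain a where b: "b = axis a 1"
    by (auto simp: Basis_vec_def)
  have "((\<lambda>z. \<tau> z $ a) has_derivative (\<lambda>\<xi>. dd \<xi> (\<lambda>z. \<tau> z $ a) y)) (at y)"
    by (rule smooth_on_has_derivative[OF A.open_V smooth_\<tau> assms])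
  then show "((\<lambda>z. \<tau> z \<bullet> b) has_derivative (\<lambda>\<xi>. (J y *v \<xi>) \<bullet> b)) (at y)"
    by (simp add: b inner_axis J_def matrix_vector_mult_def mult.commute
        dd_eq_sum_pderiv[OF A.diff_smooth[OF smooth_\<tau> assms]])
qed

lemma G_pullback:
  assumes "y \<in> V"
  shows "\<xi> \<bullet> (G y *v \<eta>) = (J y *v \<xi>) \<bullet> (G' (\<tau> y) *v (J y *v \<eta>))"
  using isometry[OF assms] frechet_derivative_at[OF \<tau>_deriv[OF assms]]
  by (metis metric_inner_def)

lemma G_pullback_component:
  assumes "y \<in> V"
  shows "G y $ i $ j = (\<Sum>a\<in>UNIV. \<Sum>b\<in>UNIV. J y $ a $ i * J y $ b $ j * G' (\<tau> y) $ a $ b)"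
proof -
  have "G y $ i $ j = axis i 1 \<bullet> (G y *v axis j 1)"
    by (simp add: inner_axis' matrix_vector_mult_basis column_def)
  also have "\<dots> = (\<Sum>a\<in>UNIV. \<Sum>b\<in>UNIV. J y $ a $ i * J y $ b $ j * G' (\<tau> y) $ a $ b)"
    unfolding G_pullback[OF assms] unfolding inner_matrix_vector_mult[of "J y *v _"]
    by (simp add: matrix_vector_mult_basis column_def mult_ac)
  finally show ?thesis .
qed

lemma G_pullback_matrix:
  assumes "y \<in> V"
  shows "G y = transpose (J y) ** (G' (\<tau> y) ** J y)"
  using G_pullback_component[OF assms]
  unfolding vec_eq_iff congruence_component by blast

text \<open>A vector annihilated by the Jacobian has length 0 by the pull-back formula, hence
  vanishes as \<open>G\<close> is definite.\<close>

lemma J_inverse: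
  assumes "y \<in> V"
  obtains E where "E ** J y = mat 1" "J y ** E = mat 1"
proof -
  have "\<xi> = 0" if "J y *v \<xi> = 0" for \<xi>
    using A.pos_G[OF assms, of \<xi>] G_pullback[OF assms, of \<xi> \<xi>] that by force
  then have "\<exists>E. E ** J y = mat 1"
    unfolding matrix_left_invertible_ker by blast
  then show ?thesis
    using that matrix_left_right_inverse by blast
qed

lemma cancel_left:
  assumes "y \<in> V" "transpose (J y) ** (G' (\<tau> y) ** M) = transpose (J y) ** (G' (\<tau> y) ** N)"
  shows "M = (N :: real^'k^'n)"
proof -
  obtain E where E: "E ** J y = mat 1" "J y ** E = mat 1"
    using J_inverse[OF assms(1)] by blast
  then have "transpose E ** transpose (J y) = mat 1"
    by (metis matrix_transpose_mul transpose_mat)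
  then have "G' (\<tau> y) ** M = G' (\<tau> y) ** N"
    using assms(2) by (metis matrix_mul_assoc matrix_mul_lid)
  then show ?thesis
    using posdef_matrix_inv(2)[OF B.pos_G[OF \<tau>_in[OF assms(1)]]] by (metis matrix_mul_assoc matrix_mul_lid)
qed

lemma pderiv_pullback:
  assumes "y \<in> V" "h differentiable at (\<tau> y)"
  shows "pderiv_at i (\<lambda>z. h (\<tau> z)) y = (\<Sum>a\<in>UNIV. pderiv_at a h (\<tau> y) * J y $ a $ i)"
proof -
  have "((\<lambda>z. h (\<tau> z)) has_derivative (\<lambda>\<xi>. dd (J y *v \<xi>) h (\<tau> y))) (at y)"
    by (rule has_derivative_compose[OF \<tau>_deriv[OF assms(1)] assms(2)[unfolded frechet_derivative_works]])
  then have "pderiv_at i (\<lambda>z. h (\<tau> z)) y = dd (J y *v axis i 1) h (\<tau> y)"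
    unfolding pderiv_at_def by (rule dd_eqI)
  then show ?thesis
    by (simp add: dd_eq_sum_pderiv[OF assms(2)] matrix_vector_mult_basis column_def mult.commute)
qed

section \<open>One function expressed in two charts\<close>

context
  fixes f f'
  assumes f: "smooth_on V f" and f': "smooth_on V' f'" and ff': "\<And>z. z \<in> V \<Longrightarrow> f z = f' (\<tau> z)"
begin

lemma pderiv_f:
  assumes "y \<in> V"
  shows "pderiv_at i f y = (\<Sum>a\<in>UNIV. pderiv_at a f' (\<tau> y) * J y $ a $ i)"
proof -
  have "pderiv_at i f y = pderiv_at i (\<lambda>z. f' (\<tau> z)) y"
    by (rule pderiv_at_cong[OF A.open_V assms ff'])
  then show ?thesis
    unfolding pderiv_pullback[OF assms B.diff_smooth[OF f' \<tau>_in[OF assms]]] .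
qed

text \<open>Both vectors lower to the same differential: after applying \<open>G'\<close> and the
  transposed Jacobian, which are injective, they become the chain rule for df.\<close>

lemma coord_grad_pushforward:
  assumes "y \<in> V"
  shows "coord_grad G' f' (\<tau> y) = J y *v coord_grad G f y"
proof -
  let ?X = "coord_grad G f y" and ?X' = "coord_grad G' f' (\<tau> y)"
  have lG: "G y *v ?X = (\<chi> i. pderiv_at i f y)"
    using A.lower_coord_grad[OF assms] by (simp add: vec_eq_iff matrix_vector_mult_def)
  have lG': "G' (\<tau> y) *v ?X' = (\<chi> i. pderiv_at i f' (\<tau> y))"
    using B.lower_coord_grad[OF \<tau>_in[OF assms]] by (simp add: vec_eq_iff matrix_vector_mult_def)
  have "transpose (J y) *v (G' (\<tau> y) *v ?X') = G y *v ?X"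
    unfolding lG lG' by (simp add: vec_eq_iff matrix_vector_mult_def transpose_def pderiv_f[OF assms] mult.commute)
  also have "\<dots> = transpose (J y) *v (G' (\<tau> y) *v (J y *v ?X))"
    unfolding G_pullback_matrix[OF assms] by (simp add: matrix_vector_mul_assoc matrix_mul_assoc)
  finally have eq: "transpose (J y) *v (G' (\<tau> y) *v ?X') = transpose (J y) *v (G' (\<tau> y) *v (J y *v ?X))" .
  obtain E where E: "E ** J y = mat 1" "J y ** E = mat 1"
    using J_inverse[OF assms] by blast
  then have "transpose E ** transpose (J y) = mat 1"
    by (metis matrix_transpose_mul transpose_mat)
  then have "G' (\<tau> y) *v ?X' = G' (\<tau> y) *v (J y *v ?X)"
    using eq by (metis matrix_vector_mul_assoc matrix_vector_mul_lid)
  then show ?thesis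
    using posdef_matrix_inv(2)[OF B.pos_G[OF \<tau>_in[OF assms]]] by (metis matrix_vector_mul_assoc matrix_vector_mul_lid)
qed

lemma grad_inner_pullback:
  assumes "y \<in> V"
  shows "grad_inner G f f y = grad_inner G' f' f' (\<tau> y)"
  unfolding A.grad_inner_eq_metric_inner[OF assms] B.grad_inner_eq_metric_inner[OF \<tau>_in[OF assms]]
    coord_grad_pushforward[OF assms] metric_inner_def by (rule G_pullback[OF assms])

text \<open>The Hessian is a tensor with two lower indices. In the lowered form only G = J^T G' J
  and the chain rule for df are to be differentiated, in \<open>E\<close> and \<open>F\<close>;
  \<open>hessian_transform_pointwise\<close> combines the results.\<close>

lemma lower_cov_grad_pullback:
  assumes "y \<in> V"
  shows "(G y ** cov G (coord_grad G f) y) $ l $ i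
    = (\<Sum>a\<in>UNIV. \<Sum>b\<in>UNIV. J y $ a $ l * J y $ b $ i * (G' (\<tau> y) ** cov G' (coord_grad G' f') (\<tau> y)) $ a $ b)"
proof -
  define Q where "Q a i j = pderiv_at j (pderiv_at i (\<lambda>z. \<tau> z $ a)) y" for a i j
  define g where "g a b = G' (\<tau> y) $ a $ b" for a b
  define dg where "dg c a b = pderiv_at c (\<lambda>z. G' z $ a $ b) (\<tau> y)" for c a b
  define D where "D a k = J y $ a $ k" for a k
  define f2 where "f2 b a = pderiv_at b (pderiv_at a f') (\<tau> y)" for b a
  note ty = \<tau>_in[OF assms]
  have sJ: "smooth_on V (\<lambda>z. J z $ a $ i)" for a i
    using smooth_on_pderiv_at[OF A.open_V smooth_\<tau>] by (simp add: J_def)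
  have pJ: "pderiv_at k (\<lambda>z. J z $ a $ i) y = Q a i k" for k a i
    by (simp add: J_def Q_def)
  have dcomp: "(\<lambda>z. h (\<tau> z)) differentiable at y" if "smooth_on V' h" for h
    using has_derivative_compose[OF \<tau>_deriv[OF assms] B.diff_smooth[OF that ty, unfolded frechet_derivative_works]]
    by (rule differentiableI)
  have dJ: "(\<lambda>z. J z $ a $ i) differentiable at y" for a i
    by (rule A.diff_smooth[OF sJ assms])
  have F: "pderiv_at i (pderiv_at l f) y = (\<Sum>a\<in>UNIV. pderiv_at a f' (\<tau> y) * Q a l i + (\<Sum>b\<in>UNIV. f2 b a * D b i) * D a l)"
  proof -
    have "pderiv_at i (pderiv_at l f) y = pderiv_at i (\<lambda>z. \<Sum>a\<in>UNIV. pderiv_at a f' (\<tau> z) * J z $ a $ l) y"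
      by (rule pderiv_at_cong[OF A.open_V assms pderiv_f])
    also have "\<dots> = (\<Sum>a\<in>UNIV. pderiv_at i (\<lambda>z. pderiv_at a f' (\<tau> z) * J z $ a $ l) y)"
      by (rule pderiv_at_sum) (intro differentiable_mult dcomp dJ smooth_on_pderiv_at B.open_V f')
    also have "\<dots> = (\<Sum>a\<in>UNIV. pderiv_at a f' (\<tau> y) * Q a l i + pderiv_at i (\<lambda>z. pderiv_at a f' (\<tau> z)) y * J y $ a $ l)"
      unfolding pJ[symmetric]
      by (intro sum.cong refl pderiv_at_mult dcomp dJ smooth_on_pderiv_at B.open_V f')
    finally show ?thesis
      unfolding D_def f2_def
      by (simp add: pderiv_pullback[OF assms B.diff_smooth[OF smooth_on_pderiv_at[OF B.open_V f'] ty]])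
  qed
  have E: "pderiv_at k (\<lambda>z. G z $ i $ l) y = (\<Sum>a\<in>UNIV. \<Sum>b\<in>UNIV. Q a i k * D b l * g a b + D a i * Q b l k * g a b
      + D a i * D b l * (\<Sum>c\<in>UNIV. dg c a b * D c k))" for k i l
  proof -
    note d = differentiable_mult differentiable_sum dcomp dJ B.smooth_G
    have "pderiv_at k (\<lambda>z. G z $ i $ l) y
        = pderiv_at k (\<lambda>z. \<Sum>a\<in>UNIV. \<Sum>b\<in>UNIV. J z $ a $ i * J z $ b $ l * G' (\<tau> z) $ a $ b) y"
      by (rule pderiv_at_cong[OF A.open_V assms G_pullback_component])
    also have "\<dots> = (\<Sum>a\<in>UNIV. pderiv_at k (\<lambda>z. \<Sum>b\<in>UNIV. J z $ a $ i * J z $ b $ l * G' (\<tau> z) $ a $ b) y)"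
      by (rule pderiv_at_sum) (intro d finite ballI)
    also have "\<dots> = (\<Sum>a\<in>UNIV. \<Sum>b\<in>UNIV. pderiv_at k (\<lambda>z. J z $ a $ i * J z $ b $ l * G' (\<tau> z) $ a $ b) y)"
      by (intro sum.cong refl pderiv_at_sum) (intro d)
    also have "\<dots> = (\<Sum>a\<in>UNIV. \<Sum>b\<in>UNIV. Q a i k * D b l * g a b + D a i * Q b l k * g a b
      + D a i * D b l * (\<Sum>c\<in>UNIV. dg c a b * D c k))"
    proof (intro sum.cong refl)
      fix a b
      have "pderiv_at k (\<lambda>z. J z $ a $ i * J z $ b $ l * G' (\<tau> z) $ a $ b) y
          = J y $ a $ i * J y $ b $ l * pderiv_at k (\<lambda>z. G' (\<tau> z) $ a $ b) y
            + pderiv_at k (\<lambda>z. J z $ a $ i * J z $ b $ l) y * G' (\<tau> y) $ a $ b"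
        by (rule pderiv_at_mult) (intro d)+
      also have "pderiv_at k (\<lambda>z. J z $ a $ i * J z $ b $ l) y = J y $ a $ i * Q b l k + Q a i k * J y $ b $ l"
        unfolding pJ[symmetric] by (rule pderiv_at_mult) (intro d)+
      also have "pderiv_at k (\<lambda>z. G' (\<tau> z) $ a $ b) y = (\<Sum>c\<in>UNIV. dg c a b * D c k)"
        unfolding dg_def D_def by (rule pderiv_pullback[OF assms B.diff_smooth[OF B.smooth_G ty]])
      finally show "pderiv_at k (\<lambda>z. J z $ a $ i * J z $ b $ l * G' (\<tau> z) $ a $ b) y
        = Q a i k * D b l * g a b + D a i * Q b l k * g a b + D a i * D b l * (\<Sum>c\<in>UNIV. dg c a b * D c k)"
        by (simp add: D_def g_def algebra_simps)
    qed
    finally show ?thesis .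
  qed
  have "(G y ** cov G (coord_grad G f) y) $ l $ i =
      (\<Sum>a\<in>UNIV. pderiv_at a f' (\<tau> y) * Q a l i + (\<Sum>b\<in>UNIV. f2 b a * D b i) * D a l)
      + (\<Sum>k\<in>UNIV. (pderiv_at k (\<lambda>z. G z $ i $ l) y - pderiv_at i (\<lambda>z. G z $ l $ k) y - pderiv_at l (\<lambda>z. G z $ i $ k) y)
        * coord_grad G f y $ k) / 2"
    unfolding A.lower_cov_grad[OF assms f] F ..
  also have "\<dots> = (\<Sum>a\<in>UNIV. \<Sum>b\<in>UNIV. D a l * D b i * (f2 b a
      + (\<Sum>c\<in>UNIV. (dg c b a - dg b a c - dg a b c) * coord_grad G' f' (\<tau> y) $ c) / 2))"
  proof (rule hessian_transform_pointwise[OF _ _ _ _ E])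
    show "Q a i j = Q a j i" for a i j
      unfolding Q_def by (rule pderiv_at_commute[OF A.open_V smooth_\<tau> assms])
    show "g a b = g b a" for a b
      unfolding g_def by (rule B.G_swap[OF ty])
    show "coord_grad G' f' (\<tau> y) $ a = (\<Sum>k\<in>UNIV. D a k * coord_grad G f y $ k)" for a
      unfolding coord_grad_pushforward[OF assms] by (simp add: matrix_vector_mult_def D_def)
    show "pderiv_at a f' (\<tau> y) = (\<Sum>b\<in>UNIV. g a b * coord_grad G' f' (\<tau> y) $ b)" for a
      unfolding g_def by (rule B.lower_coord_grad[OF ty, symmetric])
  qed
  finally show ?thesis
    unfolding B.lower_cov_grad[OF ty f'] D_def f2_def dg_def .
qed

text \<open>The law for the Hessian reduces to J P = P' J, so the two endomorphisms are conjugate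
  and have the same trace.\<close>

lemma coord_laplacian_pullback:
  assumes "y \<in> V"
  shows "coord_laplacian G f y = coord_laplacian G' f' (\<tau> y)"
proof -
  let ?P = "cov G (coord_grad G f) y" and ?P' = "cov G' (coord_grad G' f') (\<tau> y)"
  have "G y ** ?P = transpose (J y) ** ((G' (\<tau> y) ** ?P') ** J y)"
    unfolding vec_eq_iff lower_cov_grad_pullback[OF assms] congruence_component by blast
  then have "transpose (J y) ** (G' (\<tau> y) ** (J y ** ?P)) = transpose (J y) ** (G' (\<tau> y) ** (?P' ** J y))"
    unfolding G_pullback_matrix[OF assms] by (simp add: matrix_mul_assoc)
  then have eq: "J y ** ?P = ?P' ** J y"
    by (rule cancel_left[OF assms])
  obtain E where E: "E ** J y = mat 1" "J y ** E = mat 1"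
    using J_inverse[OF assms] by blast
  have "trace ?P = trace (E ** (J y ** ?P))"
    using E by (simp add: matrix_mul_assoc)
  also have "\<dots> = trace ((?P' ** J y) ** E)"
    unfolding eq by (rule trace_mul_sym)
  also have "\<dots> = trace ?P'"
    using E by (simp add: matrix_mul_assoc[symmetric])
  finally show ?thesis
    by (simp add: coord_laplacian_def coord_div_eq_trace)
qed

end

end

section \<open>Maximum principle and evolution in a chart\<close>

context metric_coords
begin

lemma pderiv_local_max:
  assumes "y \<in> V" "smooth_on V q" "\<And>z. z \<in> V \<Longrightarrow> q z \<le> q y"
  shows "pderiv_at i q y = 0"
  using differential_zero_maxmin[OF assms(1) open_V smooth_on_has_derivative[OF open_V assms(2,1)]] assms(3)
  by (metis pderiv_at_def)

text \<open>If the second derivative along \<open>v\<close> were positive, the first derivative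
  \<open>g\<close> along the line, zero at the maximum, would be positive just after it, and the
  mean value theorem would yield a larger value of \<open>q\<close>.\<close>

lemma hessian_local_max:
  assumes "y \<in> V" "smooth_on V q" and max: "\<And>z. z \<in> V \<Longrightarrow> q z \<le> q y"
  shows "(\<Sum>a\<in>UNIV. \<Sum>b\<in>UNIV. pderiv_at b (pderiv_at a q) y * v $ a * v $ b) \<le> 0"
proof (rule ccontr)
  assume pos: "\<not> ?thesis"
  define g where "g s = (\<Sum>a\<in>UNIV. v $ a * pderiv_at a q (y + s *\<^sub>R v))" for s
  obtain e where e: "0 < e" "ball y e \<subseteq> V"
    using open_V assms(1) openE by blast
  \<comment> \<open>The segment of parameters below \<open>r\<close> stays in the ball; the summand
    1 avoids division by 0 for v = 0.\<close>
  define r where "r = e / (norm v + 1)"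
  have r: "0 < r" using e by (simp add: r_def add_nonneg_pos)
  have line: "y + s *\<^sub>R v \<in> V" if "0 \<le> s" "s < r" for s
  proof -
    have "norm (s *\<^sub>R v) \<le> s * (norm v + 1)" using that by (simp add: distrib_left)
    also have "\<dots> < r * (norm v + 1)" using that by (intro mult_strict_right_mono) (auto simp: add_nonneg_pos)
    also have "\<dots> = e" by (simp add: r_def add_nonneg_eq_0_iff)
    finally show ?thesis using e(2) by (auto simp: dist_norm)
  qed
  have "(g has_real_derivative (\<Sum>a\<in>UNIV. v $ a * dd v (pderiv_at a q) (y + 0 *\<^sub>R v))) (at 0)"
    unfolding g_def
    by (intro DERIV_sum DERIV_cmult dd_line[OF open_V]) (auto intro: smooth_on_pderiv_at open_V assms)
  moreover have "(\<Sum>a\<in>UNIV. v $ a * dd v (pderiv_at a q) (y + 0 *\<^sub>R v)) = (\<Sum>a\<in>UNIV. \<Sum>b\<in>UNIV. pderiv_at b (pderiv_at a q) y * v $ a * v $ b)"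
    using dd_eq_sum_pderiv[OF diff_smooth[OF smooth_on_pderiv_at[OF open_V assms(2)] assms(1)]]
    by (simp add: sum_distrib_left mult_ac)
  ultimately have "\<exists>d>0. \<forall>h>0. h < d \<longrightarrow> g 0 < g (0 + h)"
    using pos by (intro DERIV_pos_inc_right) auto
  moreover have "g 0 = 0"
    using pderiv_local_max[OF assms] by (simp add: g_def)
  ultimately obtain d where d: "0 < d" "\<And>h. 0 < h \<Longrightarrow> h < d \<Longrightarrow> 0 < g h" by auto
  define h where "h = min d r / 2"
  have h: "0 < h" "h < d" "h < r" using d r by (auto simp: h_def)
  have "\<exists>s>0. s < h \<and> q (y + h *\<^sub>R v) - q (y + 0 *\<^sub>R v) = (h - 0) * g s"
  proof (rule MVT2[OF h(1)])
    fix s assume s: "0 \<le> s" "s \<le> h"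
    have "y + s *\<^sub>R v \<in> V" using s h line by simp
    then show "((\<lambda>s. q (y + s *\<^sub>R v)) has_real_derivative g s) (at s)"
      using dd_line[OF open_V assms(2)] dd_eq_sum_pderiv[OF diff_smooth[OF assms(2)]] by (simp add: g_def)
  qed
  then obtain s where s: "0 < s" "s < h" "q (y + h *\<^sub>R v) - q y = h * g s" by auto
  then have "0 < h * g s" using d(2)[of s] h by simp
  then have "q y < q (y + h *\<^sub>R v)" using s(3) by linarith
  then show False using max[of "y + h *\<^sub>R v"] line[of h] h by simp
qed

text \<open>At a critical point the Christoffel terms vanish and the Hessian is the matrix of second
  partial derivatives. The Laplacian contracts it with the inverse metric, a semidefinite form of
  opposite sign.\<close>

lemma coord_laplacian_local_max:
  assumes "y \<in> V" "smooth_on V q" "\<And>z. z \<in> V \<Longrightarrow> q z \<le> q y"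
  shows "coord_laplacian G q y \<le> 0"
proof -
  let ?P = "cov G (coord_grad G q) y" and ?I = "matrix_inv (G y)"
  define H where "H = G y ** ?P"
  have "coord_grad G q y = 0"
    using pderiv_local_max[OF assms] by (simp add: vec_eq_iff coord_grad_component)
  then have H: "H $ l $ i = pderiv_at i (pderiv_at l q) y" for l i
    unfolding H_def lower_cov_grad[OF assms(1,2)] by simp
  have "psd (\<lambda>i j. (- H) $ i $ j)"
  proof (rule psd_matrixI)
    show "transpose (- H) = - H"
      using lower_cov_grad_sym[OF assms(1,2)] by (simp add: H_def vec_eq_iff transpose_def)
    show "0 \<le> x \<bullet> (- H *v x)" for x
      using hessian_local_max[OF assms, of x] unfolding inner_matrix_vector_mult by (simp add: H sum_negf)
  qed
  then have "0 \<le> trace (?I ** (- H))"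
    by (intro trace_mult_psd_nonneg psd_posdef_matrix_inv sym_G pos_G assms(1))
  also have "\<dots> = - trace (?I ** H)"
    by (simp add: trace_def matrix_matrix_mult_def sum_negf)
  also have "?I ** H = ?P"
    unfolding H_def using posdef_matrix_inv(2)[OF pos_G[OF assms(1)]] by (simp add: matrix_mul_assoc)
  finally show ?thesis
    by (simp add: coord_laplacian_def coord_div_eq_trace)
qed

end

text \<open>\<open>h\<close> stands for log u as a function on space-time. Both summands have the
  shape constant times function, to which \<open>dt_static_mult\<close> applies.\<close>

definition li_yau_Q ::
    "(real^'n::finite \<Rightarrow> real^'n^'n) \<Rightarrow> real \<Rightarrow> ((real^'n) \<times> real \<Rightarrow> real) \<Rightarrow> (real^'n) \<times> real \<Rightarrow> real" where
  "li_yau_Q G a h p = - a * coord_laplacian G (\<lambda>z. h (z, snd p)) (fst p)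
    + - (a - 1) * grad_inner G (\<lambda>z. h (z, snd p)) (\<lambda>z. h (z, snd p)) (fst p)"

section \<open>Time derivatives of the spatial operators\<close>

locale spacetime_coords = metric_coords V G for V :: "(real^'n::finite) set" and G +
  fixes I :: "real set"
  assumes open_I: "open I"
begin

abbreviation dt :: "((real^'n) \<times> real \<Rightarrow> real) \<Rightarrow> (real^'n) \<times> real \<Rightarrow> real" where
  "dt \<equiv> dd (0, 1)"

lemma open_VI: "open (V \<times> I)"
  by (intro open_Times open_V open_I)

lemma Basis_time: "((0, 1) :: (real^'n) \<times> real) \<in> Basis" and Basis_space: "((axis i 1, 0) :: (real^'n) \<times> real) \<in> Basis"
  by (simp_all add: Basis_prod_def)

lemmas VI_intros = smooth_on_intros[OF open_VI]

lemma diff_VI: "smooth_on (V \<times> I) h \<Longrightarrow> y \<in> V \<Longrightarrow> t \<in> I \<Longrightarrow> h differentiable at (y, t)"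
  using smooth_on_differentiable[OF open_VI] by blast

lemma smooth_slice: "smooth_on (V \<times> I) h \<Longrightarrow> t \<in> I \<Longrightarrow> smooth_on V (\<lambda>z. h (z, t))"
  by (rule smooth_on_slice[OF open_V open_I])

lemma smooth_dt: "smooth_on (V \<times> I) h \<Longrightarrow> smooth_on (V \<times> I) (dt h)"
  by (rule smooth_on_dd[OF open_VI _ Basis_time])

lemma smooth_static: "smooth_on V c \<Longrightarrow> smooth_on (V \<times> I) (\<lambda>p. c (fst p))"
  by (rule smooth_on_fst[OF open_V open_I])

lemma pderiv_slice:
  assumes "smooth_on (V \<times> I) h" "y \<in> V" "t \<in> I"
  shows "pderiv_at i (\<lambda>z. h (z, t)) y = dd (axis i 1, 0) h (y, t)"
  unfolding pderiv_at_def
  by (rule dd_eqI[OF has_derivative_slice(1)[OF smooth_on_has_derivative[OF open_VI assms(1)]]]) (use assms in auto)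

lemma smooth_pderiv_slice:
  assumes "smooth_on (V \<times> I) h"
  shows "smooth_on (V \<times> I) (\<lambda>p. pderiv_at i (\<lambda>z. h (z, snd p)) (fst p))"
  by (rule smooth_on_cong[THEN iffD2, OF _ smooth_on_dd[OF open_VI assms Basis_space]])
    (auto simp: pderiv_slice[OF assms])

text \<open>Symmetry of second derivatives on space-time. As the metric does not depend on time, the
  time derivative then passes through gradient, divergence and Laplacian.\<close>

lemma dt_pderiv_slice:
  assumes "smooth_on (V \<times> I) h" "y \<in> V" "t \<in> I"
  shows "dt (\<lambda>p. pderiv_at i (\<lambda>z. h (z, snd p)) (fst p)) (y, t) = pderiv_at i (\<lambda>z. dt h (z, t)) y"
proof -
  have "dt (\<lambda>p. pderiv_at i (\<lambda>z. h (z, snd p)) (fst p)) (y, t) = dt (dd (axis i 1, 0) h) (y, t)"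
    by (rule dd_cong[OF open_VI]) (use assms in \<open>auto simp: pderiv_slice\<close>)
  also have "\<dots> = dd (axis i 1, 0) (dt h) (y, t)"
    by (rule dd_commute[OF open_VI assms(1) _ Basis_time Basis_space]) (use assms in auto)
  finally show ?thesis
    by (simp add: pderiv_slice[OF smooth_dt[OF assms(1)] assms(2,3)])
qed

lemma dt_static_mult:
  assumes "smooth_on V c" "smooth_on (V \<times> I) h" "y \<in> V" "t \<in> I"
  shows "dt (\<lambda>p. c (fst p) * h p) (y, t) = c y * dt h (y, t)"
proof -
  have "((\<lambda>p. c (fst p)) has_derivative (\<lambda>v. dd (fst v) c (fst (y, t)))) (at (y, t))"
    by (rule has_derivative_compose[OF has_derivative_fst[OF has_derivative_ident]])
      (use smooth_on_has_derivative[OF open_V assms(1,3)] in simp)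
  \<comment> \<open>The time direction projects to 0 in space.\<close>
  then have "dt (\<lambda>p. c (fst p)) (y, t) = dd 0 c y"
    using dd_eqI by fastforce
  also have "\<dots> = 0"
    using linear_frechet_derivative[OF diff_smooth[OF assms(1,3)]] by (rule linear_0)
  finally show ?thesis
    using dd_mult[OF diff_VI[OF smooth_static[OF assms(1)] assms(3,4)] diff_VI[OF assms(2-4)], of "(0, 1)"] by simp
qed

lemma smooth_coord_grad_slice:
  "smooth_on (V \<times> I) h \<Longrightarrow> smooth_on (V \<times> I) (\<lambda>p. coord_grad G (\<lambda>z. h (z, snd p)) (fst p) $ i)"
  unfolding coord_grad_component
  by (intro VI_intros smooth_static smooth_matrix_inv smooth_pderiv_slice)

lemma dt_coord_grad_slice:
  assumes "smooth_on (V \<times> I) h" "y \<in> V" "t \<in> I"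
  shows "dt (\<lambda>p. coord_grad G (\<lambda>z. h (z, snd p)) (fst p) $ i) (y, t) = coord_grad G (\<lambda>z. dt h (z, t)) y $ i"
proof -
  have "dt (\<lambda>p. coord_grad G (\<lambda>z. h (z, snd p)) (fst p) $ i) (y, t)
      = (\<Sum>j\<in>UNIV. dt (\<lambda>p. matrix_inv (G (fst p)) $ i $ j * pderiv_at j (\<lambda>z. h (z, snd p)) (fst p)) (y, t))"
    unfolding coord_grad_component
    by (rule dd_sum) (intro diff_VI VI_intros smooth_static smooth_matrix_inv smooth_pderiv_slice assms)
  also have "\<dots> = (\<Sum>j\<in>UNIV. matrix_inv (G y) $ i $ j * pderiv_at j (\<lambda>z. dt h (z, t)) y)"
    by (intro sum.cong refl)
      (subst dt_static_mult[where c="\<lambda>y. matrix_inv (G y) $ i $ j" for j],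
        simp_all add: smooth_matrix_inv smooth_pderiv_slice dt_pderiv_slice assms)
  finally show ?thesis
    unfolding coord_grad_component .
qed

lemma smooth_coord_div_slice:
  assumes "\<And>i. smooth_on (V \<times> I) (\<lambda>p. X p $ i)"
  shows "smooth_on (V \<times> I) (\<lambda>p. coord_div G (\<lambda>z. X (z, snd p)) (fst p))"
  unfolding coord_div_def
  by (simp, intro VI_intros smooth_static smooth_christoffel smooth_pderiv_slice[where h="\<lambda>p. X p $ i" for i] assms)

lemma dt_coord_div_slice:
  assumes "\<And>i. smooth_on (V \<times> I) (\<lambda>p. X p $ i)" "y \<in> V" "t \<in> I"
  shows "dt (\<lambda>p. coord_div G (\<lambda>z. X (z, snd p)) (fst p)) (y, t) = coord_div G (\<lambda>z. \<chi> i. dt (\<lambda>p. X p $ i) (z, t)) y"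
proof -
  note d = diff_VI[OF _ assms(2,3)] VI_intros smooth_static smooth_christoffel assms(1)
    smooth_pderiv_slice[where h="\<lambda>p. X p $ i" for i]
  have "dt (\<lambda>p. coord_div G (\<lambda>z. X (z, snd p)) (fst p)) (y, t)
    = (\<Sum>i\<in>UNIV. dt (\<lambda>p. pderiv_at i (\<lambda>z. X (z, snd p) $ i) (fst p) + (\<Sum>k\<in>UNIV. christoffel G i i k (fst p) * X p $ k)) (y, t))"
    unfolding coord_div_def prod.collapse by (rule dd_sum) (intro d)
  also have "\<dots> = (\<Sum>i\<in>UNIV. dt (\<lambda>p. pderiv_at i (\<lambda>z. X (z, snd p) $ i) (fst p)) (y, t)
      + dt (\<lambda>p. \<Sum>k\<in>UNIV. christoffel G i i k (fst p) * X p $ k) (y, t))"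
    by (intro sum.cong refl dd_add) (intro d)+
  also have "\<dots> = (\<Sum>i\<in>UNIV. dt (\<lambda>p. pderiv_at i (\<lambda>z. X (z, snd p) $ i) (fst p)) (y, t)
      + (\<Sum>k\<in>UNIV. dt (\<lambda>p. christoffel G i i k (fst p) * X p $ k) (y, t)))"
    by (intro sum.cong refl arg_cong2[where f="(+)"] dd_sum) (intro d)+
  also have "\<dots> = (\<Sum>i\<in>UNIV. pderiv_at i (\<lambda>z. dt (\<lambda>p. X p $ i) (z, t)) y
      + (\<Sum>k\<in>UNIV. christoffel G i i k y * dt (\<lambda>p. X p $ k) (y, t)))"
    using dt_static_mult[OF smooth_christoffel assms] dt_pderiv_slice[OF assms] by simp
  finally show ?thesis
    by (simp add: coord_div_def)
qed

lemma smooth_coord_laplacian_slice: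
  "smooth_on (V \<times> I) h \<Longrightarrow> smooth_on (V \<times> I) (\<lambda>p. coord_laplacian G (\<lambda>z. h (z, snd p)) (fst p))"
  unfolding coord_laplacian_def
  using smooth_coord_div_slice[of "\<lambda>p. coord_grad G (\<lambda>z. h (z, snd p)) (fst p)"] smooth_coord_grad_slice
  by simp

lemma dt_coord_laplacian_slice:
  assumes "smooth_on (V \<times> I) h" "y \<in> V" "t \<in> I"
  shows "dt (\<lambda>p. coord_laplacian G (\<lambda>z. h (z, snd p)) (fst p)) (y, t) = coord_laplacian G (\<lambda>z. dt h (z, t)) y"
proof -
  have "dt (\<lambda>p. coord_laplacian G (\<lambda>z. h (z, snd p)) (fst p)) (y, t)
      = coord_div G (\<lambda>z. \<chi> i. dt (\<lambda>p. coord_grad G (\<lambda>z. h (z, snd p)) (fst p) $ i) (z, t)) y"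
    using dt_coord_div_slice[of "\<lambda>p. coord_grad G (\<lambda>z. h (z, snd p)) (fst p)", OF smooth_coord_grad_slice[OF assms(1)] assms(2,3)]
    by (simp add: coord_laplacian_def)
  also have "\<dots> = coord_laplacian G (\<lambda>z. dt h (z, t)) y"
    unfolding coord_laplacian_def
    by (rule coord_div_cong) (use assms in \<open>simp_all add: dt_coord_grad_slice vec_eq_iff\<close>)
  finally show ?thesis .
qed

lemma smooth_grad_inner_slice:
  "smooth_on (V \<times> I) h \<Longrightarrow> smooth_on (V \<times> I) (\<lambda>p. grad_inner G (\<lambda>z. h (z, snd p)) (\<lambda>z. h (z, snd p)) (fst p))"
  unfolding grad_inner_def by (intro VI_intros smooth_coord_grad_slice smooth_pderiv_slice)

lemma dt_grad_inner_slice: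
  assumes "smooth_on (V \<times> I) h" "y \<in> V" "t \<in> I"
  shows "dt (\<lambda>p. grad_inner G (\<lambda>z. h (z, snd p)) (\<lambda>z. h (z, snd p)) (fst p)) (y, t)
    = 2 * grad_inner G (\<lambda>z. dt h (z, t)) (\<lambda>z. h (z, t)) y"
proof -
  let ?d = "\<lambda>p. \<lambda>i. pderiv_at i (\<lambda>z. h (z, snd p)) (fst p)"
  let ?X = "\<lambda>p. \<lambda>i. coord_grad G (\<lambda>z. h (z, snd p)) (fst p) $ i"
  note d = diff_VI[OF _ assms(2,3)] VI_intros smooth_coord_grad_slice smooth_pderiv_slice assms(1)
  have "dt (\<lambda>p. grad_inner G (\<lambda>z. h (z, snd p)) (\<lambda>z. h (z, snd p)) (fst p)) (y, t)
      = (\<Sum>i\<in>UNIV. dt (\<lambda>p. ?d p i * ?X p i) (y, t))"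
    unfolding grad_inner_def by (rule dd_sum) (intro d)
  also have "\<dots> = (\<Sum>i\<in>UNIV. ?d (y, t) i * dt (\<lambda>p. ?X p i) (y, t) + dt (\<lambda>p. ?d p i) (y, t) * ?X (y, t) i)"
    by (intro sum.cong refl dd_mult) (intro d)+
  also have "\<dots> = grad_inner G (\<lambda>z. h (z, t)) (\<lambda>z. dt h (z, t)) y + grad_inner G (\<lambda>z. dt h (z, t)) (\<lambda>z. h (z, t)) y"
    by (simp add: dt_coord_grad_slice dt_pderiv_slice assms grad_inner_def sum.distrib)
  finally show ?thesis
    by (simp add: grad_inner_swap[OF assms(2), of "\<lambda>z. h (z, t)"])
qed


section \<open>The logarithm of the solution and the inequality at a maximum\<close>

lemma laplacian_ln_slice:
  assumes "smooth_on V f" "\<And>z. z \<in> V \<Longrightarrow> 0 < f z" "y \<in> V"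
  shows "coord_laplacian G (\<lambda>z. ln (f z)) y + grad_inner G (\<lambda>z. ln (f z)) (\<lambda>z. ln (f z)) y = coord_laplacian G f y / f y"
proof -
  have fy: "0 < f y" using assms by blast
  have inv: "smooth_on V (\<lambda>z. inverse (f z))"
    by (rule smooth_on_inverse[OF open_V assms(1)]) (use assms(2) in force)
  have ln: "(ln has_real_derivative inverse (f z)) (at (f z))" if "z \<in> V" for z
    using DERIV_ln[OF assms(2)[OF that]] .
  have "coord_laplacian G (\<lambda>z. ln (f z)) y = inverse (f y) * coord_laplacian G f y - inverse (f y) * inverse (f y) * grad_inner G f f y"
    using coord_laplacian_chain[where \<phi>=ln and \<phi>'=inverse, OF assms(1) inv assms(3) ln DERIV_inverse] fy
    by (simp add: power2_eq_square)
  moreover have "grad_inner G (\<lambda>z. ln (f z)) (\<lambda>z. ln (f z)) y = inverse (f y) * (inverse (f y) * grad_inner G f f y)"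
    using grad_inner_chain_left[where \<phi>=ln, OF assms(1) ln[OF assms(3)] assms(3)]
      grad_inner_swap[OF assms(3), of f "\<lambda>z. ln (f z)"] by simp
  ultimately show ?thesis by (simp add: divide_inverse)
qed

lemma log_heat_equation:
  assumes su: "smooth_on (V \<times> I) u" and upos: "\<And>z. z \<in> V \<Longrightarrow> 0 < u (z, t)" and z: "z \<in> V" and t: "t \<in> I"
    and heat: "dt u (z, t) = coord_laplacian G (\<lambda>z. u (z, t)) z + lam * u (z, t) + A (z, t)"
  shows "dt (\<lambda>p. ln (u p)) (z, t) = coord_laplacian G (\<lambda>z. ln (u (z, t))) z
    + grad_inner G (\<lambda>z. ln (u (z, t))) (\<lambda>z. ln (u (z, t))) z + (lam + A (z, t) * inverse (u (z, t)))"
proof -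
  have "dt (\<lambda>p. ln (u p)) (z, t) = inverse (u (z, t)) * dt u (z, t)"
    by (rule dd_eqI, rule has_derivative_compose[OF smooth_on_has_derivative[OF open_VI su]
      DERIV_ln[OF upos[OF z], unfolded has_field_derivative_def]]) (use z t in auto)
  also have "\<dots> = coord_laplacian G (\<lambda>z. u (z, t)) z / u (z, t) + (lam + A (z, t) * inverse (u (z, t)))"
    unfolding heat using upos[OF z] by (simp add: field_simps)
  finally show ?thesis
    by (simp only: laplacian_ln_slice[OF smooth_slice[OF su t] upos z])
qed

text \<open>\<open>s\<close> is the time elapsed since \<epsilon>, so \<open>Qt\<close> says that
  the time derivative of (t - \<epsilon>) Q is nonnegative at the point. The spatial maximum gives
  \<nabla>Q = 0 and \<Delta>Q \<le> 0, which bounds \<open>dt Q\<close> from above; the bound is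
  inserted into \<open>Qt\<close>.\<close>

lemma li_yau_at_max:
  fixes u A :: "(real^'n) \<times> real \<Rightarrow> real" and a t :: real and y :: "real^'n"
  defines "w \<equiv> \<lambda>p. ln (u p)"
  defines "Q \<equiv> li_yau_Q G a w"
  defines "L \<equiv> coord_laplacian G (\<lambda>z. w (z, t)) y" and "P \<equiv> grad_inner G (\<lambda>z. w (z, t)) (\<lambda>z. w (z, t)) y"
  assumes su: "smooth_on (V \<times> I) u" and sA: "smooth_on (V \<times> I) A"
    and upos: "\<And>p. p \<in> V \<times> I \<Longrightarrow> 0 < u p" and Apos: "0 \<le> A (y, t)"
    and heat: "\<And>z. z \<in> V \<Longrightarrow> dt u (z, t) = coord_laplacian G (\<lambda>z. u (z, t)) z + lam * u (z, t) + A (z, t)"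
    and y: "y \<in> V" and t: "t \<in> I" and a: "1 < a" and s: "0 \<le> s"
    and Qmax: "\<And>z. z \<in> V \<Longrightarrow> Q (z, t) \<le> Q (y, t)" and Qpos: "0 < Q (y, t)"
    and Qt: "0 \<le> Q (y, t) + s * dt Q (y, t)"
    and ric: "\<And>\<xi>. - K * metric_inner G y \<xi> \<xi> \<le> ricci G y \<xi> \<xi>"
    and bu: "inverse (u (y, t)) \<le> bu"
    and bg: "grad_inner G (\<lambda>z. A (z, t)) (\<lambda>z. A (z, t)) y \<le> bg\<^sup>2"
    and bl: "\<bar>coord_laplacian G (\<lambda>z. A (z, t)) y\<bar> \<le> bl"
  shows "0 \<le> Q (y, t) + s * (- (2 / real CARD('n)) * L\<^sup>2 + 2 * K * P + bu * (P + bg\<^sup>2) + a * bu * bl)"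
proof -
  define W where "W = (\<lambda>z. w (z, t))"
  define At where "At = (\<lambda>z. A (z, t))"
  \<comment> \<open>1/u as exp (- w), so that the chain rule expresses its derivatives by those of
    w; \<open>B\<close> is then A/u.\<close>
  define v where "v = (\<lambda>z. exp (- W z))"
  define Lt where "Lt = coord_laplacian G W"
  define Pt where "Pt = grad_inner G W W"
  define B where "B = (\<lambda>z. At z * v z)"
  have sw: "smooth_on (V \<times> I) w"
    unfolding w_def by (rule smooth_on_ln[OF open_VI su upos])
  have sW: "smooth_on V W"
    unfolding W_def by (rule smooth_slice[OF sw t])
  have sAt: "smooth_on V At"
    unfolding At_def by (rule smooth_slice[OF sA t])
  have sut: "smooth_on V (\<lambda>z. u (z, t))"
    by (rule smooth_slice[OF su t])
  have ut: "0 < u (z, t)" if "z \<in> V" for z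
    using upos that t by blast
  have v: "v z = inverse (u (z, t))" if "z \<in> V" for z
    using ut[OF that] by (simp add: v_def W_def w_def exp_minus)
  have sv: "smooth_on V v"
    by (rule smooth_on_cong[THEN iffD2, OF v smooth_on_inverse[OF open_V sut]]) (use ut in force)+
  have sB: "smooth_on V B"
    unfolding B_def by (intro V_smooth_intros sAt sv)
  have sL: "smooth_on V Lt" and sP: "smooth_on V Pt"
    unfolding Lt_def Pt_def by (intro smooth_coord_laplacian smooth_grad_inner sW)+
  have L: "L = Lt y" and P: "P = Pt y"
    by (simp_all add: L_def P_def Lt_def Pt_def W_def)
  have Q: "Q (z, t) = - a * Lt z + - (a - 1) * Pt z" for z
    by (simp add: Q_def li_yau_Q_def Lt_def Pt_def W_def)

  have wt: "dt w (z, t) = Lt z + Pt z + (lam + B z)" if z: "z \<in> V" for z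
    using log_heat_equation[where u=u and A=A, OF su ut z t heat[OF z]] v[OF z]
    by (simp add: w_def Lt_def Pt_def W_def B_def At_def)
  have s1: "smooth_on V (\<lambda>z. Lt z + Pt z)" and s2: "smooth_on V (\<lambda>z. lam + B z)"
    by (intro V_smooth_intros sL sP sB)+
  \<comment> \<open>At fixed time \<open>lam\<close> is a constant, which Laplacian and gradient
    annihilate.\<close>
  have lap_wt: "coord_laplacian G (\<lambda>z. dt w (z, t)) y = coord_laplacian G Lt y + coord_laplacian G Pt y + coord_laplacian G B y"
    using coord_laplacian_cong[of "\<lambda>z. dt w (z, t)" "\<lambda>z. Lt z + Pt z + (lam + B z)", OF wt y]
      coord_laplacian_add[OF s1 s2 y] coord_laplacian_add[OF sL sP y]
      coord_laplacian_add[OF smooth_on_const[OF open_V] sB y, of lam] by (simp add: coord_laplacian_const)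
  have grad_wt: "grad_inner G (\<lambda>z. dt w (z, t)) W y = grad_inner G Lt W y + grad_inner G Pt W y + grad_inner G B W y"
    using grad_inner_cong[of "\<lambda>z. dt w (z, t)" "\<lambda>z. Lt z + Pt z + (lam + B z)" W W, OF wt refl y]
      grad_inner_add_left[OF s1 s2 y] grad_inner_add_left[OF sL sP y]
      grad_inner_add_left[OF smooth_on_const[OF open_V] sB y, of lam] by simp
  have dtQ: "dt Q (y, t) = - a * (coord_laplacian G Lt y + coord_laplacian G Pt y + coord_laplacian G B y)
      - 2 * (a - 1) * (grad_inner G Lt W y + grad_inner G Pt W y + grad_inner G B W y)"
  proof -
    define l where "l = (\<lambda>p. coord_laplacian G (\<lambda>z. w (z, snd p)) (fst p))"
    define q where "q = (\<lambda>p. grad_inner G (\<lambda>z. w (z, snd p)) (\<lambda>z. w (z, snd p)) (fst p))"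
    have sLP: "smooth_on (V \<times> I) l" "smooth_on (V \<times> I) q"
      unfolding l_def q_def by (intro smooth_coord_laplacian_slice smooth_grad_inner_slice sw)+
    have "dt Q (y, t) = dt (\<lambda>p. - a * l p) (y, t) + dt (\<lambda>p. - (a - 1) * q p) (y, t)"
    proof -
      have "Q = (\<lambda>p. - a * l p + - (a - 1) * q p)"
        by (simp add: fun_eq_iff Q_def li_yau_Q_def l_def q_def)
      then show ?thesis
        by (simp only:) (rule dd_add; intro diff_VI VI_intros sLP y t)
    qed
    also have "\<dots> = - a * dt l (y, t) + - (a - 1) * dt q (y, t)"
      using dt_static_mult[OF smooth_on_const[OF open_V] sLP(1) y t, of "- a"]
        dt_static_mult[OF smooth_on_const[OF open_V] sLP(2) y t, of "- (a - 1)"] by simp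
    also have "dt l (y, t) = coord_laplacian G (\<lambda>z. dt w (z, t)) y"
      unfolding l_def by (rule dt_coord_laplacian_slice[OF sw y t])
    also have "dt q (y, t) = 2 * grad_inner G (\<lambda>z. dt w (z, t)) W y"
      unfolding q_def W_def by (rule dt_grad_inner_slice[OF sw y t])
    finally show ?thesis
      unfolding lap_wt grad_wt by (simp add: algebra_simps)
  qed

  \<comment> \<open>The slice of \<open>Q\<close> at time \<open>t\<close>, to which the spatial
    maximum principle applies.\<close>
  define q where "q = (\<lambda>z. - a * Lt z + - (a - 1) * Pt z)"
  have sq: "smooth_on V q" "smooth_on V (\<lambda>z. - a * Lt z)" "smooth_on V (\<lambda>z. - (a - 1) * Pt z)"
    unfolding q_def by (intro V_smooth_intros sL sP)+
  have qmax: "q z \<le> q y" if "z \<in> V" for z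
    using Qmax[OF that] unfolding Q q_def .
  have "coord_laplacian G q y \<le> 0"
    by (rule coord_laplacian_local_max[OF y sq(1) qmax])
  moreover have "coord_laplacian G q y = - a * coord_laplacian G Lt y - (a - 1) * coord_laplacian G Pt y"
    unfolding q_def coord_laplacian_add[OF sq(2,3) y]
    using coord_laplacian_mult[OF smooth_on_const[OF open_V] sL y, of "- a"]
      coord_laplacian_mult[OF smooth_on_const[OF open_V] sP y, of "- (a - 1)"]
    by (simp add: coord_laplacian_const algebra_simps)
  ultimately have lap_q: "- a * coord_laplacian G Lt y - (a - 1) * coord_laplacian G Pt y \<le> 0" by simp
  have "grad_inner G q W y = 0"
    using pderiv_local_max[OF y sq(1) qmax] by (simp add: grad_inner_def)
  moreover have "grad_inner G q W y = - a * grad_inner G Lt W y - (a - 1) * grad_inner G Pt W y"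
    unfolding q_def grad_inner_add_left[OF sq(2,3) y]
    using grad_inner_mult_left[OF smooth_on_const[OF open_V] sL y, of "- a"]
      grad_inner_mult_left[OF smooth_on_const[OF open_V] sP y, of "- (a - 1)"] by (simp add: algebra_simps)
  ultimately have grad_q: "- a * grad_inner G Lt W y - (a - 1) * grad_inner G Pt W y = 0" by simp
  have bochner: "2 * grad_inner G Lt W y - coord_laplacian G Pt y \<le> - (2 / real CARD('n)) * (Lt y)\<^sup>2 + 2 * K * Pt y"
    using bochner_inequality[OF y sW ric] unfolding Lt_def Pt_def by simp

  let ?g = "grad_inner G At W y"
  have v_deriv: "((\<lambda>r. exp (- r)) has_real_derivative - exp (- r)) (at r)"
    "((\<lambda>r. - exp (- r)) has_real_derivative exp (- r)) (at r)" for r :: real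
    by (auto intro!: derivative_eq_intros)
  have vy: "0 < v y" "v y \<le> bu"
    using bu v[OF y] ut[OF y] by (simp_all add: v_def)
  have lap_v: "coord_laplacian G v y = - v y * Lt y + v y * Pt y"
    using coord_laplacian_chain[where \<phi>="\<lambda>r. exp (- r)" and \<phi>'="\<lambda>r. - exp (- r)", OF sW _ y v_deriv] smooth_on_minus[OF open_V sv]
    by (simp add: v_def Lt_def Pt_def)
  have grad_v: "grad_inner G v k y = - v y * grad_inner G W k y" for k
    unfolding v_def using grad_inner_chain_left[where \<phi>="\<lambda>r. exp (- r)", OF sW v_deriv(1) y] by simp
  have lap_B: "coord_laplacian G B y = At y * (v y * Pt y - v y * Lt y) + v y * coord_laplacian G At y - 2 * v y * ?g"
    unfolding B_def coord_laplacian_mult[OF sAt sv y] lap_v grad_inner_swap[OF y, of At v] grad_v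
      grad_inner_swap[OF y, of W At] by (simp add: algebra_simps)
  have grad_B: "grad_inner G B W y = - At y * v y * Pt y + v y * ?g"
    unfolding B_def grad_inner_mult_left[OF sAt sv y] grad_v by (simp add: Pt_def)
  \<comment> \<open>From |\<nabla>(A - w)|^2 \<ge> 0.\<close>
  have g: "2 * ?g \<le> bg\<^sup>2 + Pt y"
  proof -
    define d where "d = (\<lambda>z. At z + - 1 * W z)"
    have sd: "smooth_on V (\<lambda>z. - 1 * W z)"
      by (intro V_smooth_intros sW)
    have d: "grad_inner G d k y = grad_inner G At k y - grad_inner G W k y" for k
      unfolding d_def grad_inner_add_left[OF sAt sd y]
      using grad_inner_mult_left[OF smooth_on_const[OF open_V] sW y, of "- 1"] by simp
    have "0 \<le> grad_inner G d d y" by (rule grad_inner_nonneg[OF y])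
    also have "\<dots> = grad_inner G At At y + Pt y - 2 * ?g"
      unfolding d unfolding grad_inner_swap[OF y, of At d] grad_inner_swap[OF y, of W d] d
      by (simp add: Pt_def grad_inner_swap[OF y, of W At])
    finally show ?thesis using bg by (simp add: At_def)
  qed
  have aL: "a * Lt y = - Q (y, t) - (a - 1) * Pt y"
    by (simp add: Q algebra_simps)
  \<comment> \<open>The mixed gradient terms have coefficients 2 a and - 2 (a - 1), which leaves
    2.\<close>
  have split_B: "- a * coord_laplacian G B y - 2 * (a - 1) * grad_inner G B W y
      = At y * v y * (a * Lt y + (a - 2) * Pt y) - a * v y * coord_laplacian G At y + v y * (2 * ?g)"
    unfolding lap_B grad_B by (simp add: algebra_simps)
  have "a * Lt y + (a - 2) * Pt y = - (Q (y, t) + Pt y)"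
    unfolding aL by (simp add: algebra_simps)
  then have "At y * v y * (a * Lt y + (a - 2) * Pt y) \<le> 0"
    using Apos vy Qpos grad_inner_nonneg[OF y, of W] by (intro mult_nonneg_nonpos) (auto simp: At_def Pt_def)
  moreover have "- a * v y * coord_laplacian G At y \<le> a * bu * bl"
  proof -
    have "- coord_laplacian G At y \<le> bl" using bl by (simp add: At_def)
    moreover have "0 \<le> bl" using bl by linarith
    ultimately have "v y * (- coord_laplacian G At y) \<le> bu * bl"
      using vy mult_left_mono[of "- coord_laplacian G At y" bl "v y"] mult_right_mono[of "v y" bu bl] by linarith
    then have "a * (v y * (- coord_laplacian G At y)) \<le> a * (bu * bl)"
      using a by (intro mult_left_mono) auto
    then show ?thesis by (simp add: mult.assoc)
  qed
  moreover have "v y * (2 * ?g) \<le> bu * (Pt y + bg\<^sup>2)"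
  proof -
    have "v y * (2 * ?g) \<le> v y * (Pt y + bg\<^sup>2)"
      using g vy by (intro mult_left_mono) auto
    also have "\<dots> \<le> bu * (Pt y + bg\<^sup>2)"
      using vy grad_inner_nonneg[OF y, of W] by (intro mult_right_mono) (auto simp: Pt_def)
    finally show ?thesis .
  qed
  ultimately have terms_B: "- a * coord_laplacian G B y - 2 * (a - 1) * grad_inner G B W y \<le> bu * (Pt y + bg\<^sup>2) + a * bu * bl"
    unfolding split_B by linarith
  \<comment> \<open>Regrouped as \<Delta>Q + 2 <\<nabla>w, \<nabla>Q> plus one Bochner expression 2
    <\<nabla>w, \<nabla>\<Delta>w> - \<Delta>|\<nabla>w|^2 plus the terms with A/u. The first two
    are controlled by the maximum.\<close>
  have "dt Q (y, t) = (- a * coord_laplacian G Lt y - (a - 1) * coord_laplacian G Pt y) - coord_laplacian G Pt y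
      + 2 * (- a * grad_inner G Lt W y - (a - 1) * grad_inner G Pt W y) + 2 * grad_inner G Lt W y
      + (- a * coord_laplacian G B y - 2 * (a - 1) * grad_inner G B W y)"
    unfolding dtQ by (simp add: algebra_simps)
  then have "dt Q (y, t) \<le> - (2 / real CARD('n)) * (Lt y)\<^sup>2 + 2 * K * Pt y + bu * (Pt y + bg\<^sup>2) + a * bu * bl"
    unfolding grad_q using lap_q bochner terms_B by linarith
  then have "s * dt Q (y, t) \<le> s * (- (2 / real CARD('n)) * (Lt y)\<^sup>2 + 2 * K * Pt y + bu * (Pt y + bg\<^sup>2) + a * bu * bl)"
    using s by (rule mult_left_mono)
  then show ?thesis
    using Qt unfolding L P by linarith
qed

end

text \<open>The bound that the inequality at the maximum imposes on \<open>s * q\<close>, with \<open>n\<close> the dimension.\<close>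

definition li_yau_const :: "nat \<Rightarrow> real \<Rightarrow> real \<Rightarrow> real \<Rightarrow> real \<Rightarrow> real \<Rightarrow> real \<Rightarrow> real" where
  "li_yau_const n bu bg bl K a T =
    (let \<alpha> = 2 / (real n * a\<^sup>2);
         R = (2 * \<bar>K\<bar> + \<bar>bu\<bar>)\<^sup>2 / (4 * \<alpha> * (a - 1)\<^sup>2) + \<bar>bu\<bar> * bg\<^sup>2 + a * \<bar>bu\<bar> * \<bar>bl\<bar>
     in (1 + T\<^sup>2 * R) / \<alpha> + 1)"

text \<open>Squaring \<open>l\<close> leaves \<alpha> q^2 and \<alpha> (a - 1)^2 p^2, the cross term
  being nonnegative. The square in \<open>p\<close> absorbs the linear term (2 |K| + bu) p at the
  cost of the first summand of \<open>R\<close>.\<close>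

lemma li_yau_const_bound:
  assumes n: "0 < n" and a: "1 < a" and s: "0 \<le> s" "s \<le> T" and q: "0 < q" and p: "0 \<le> p"
    and b: "0 \<le> bu" "0 \<le> bl" and l: "a * l = - q - (a - 1) * p"
    and ineq: "0 \<le> q + s * (- (2 / real n) * l\<^sup>2 + 2 * K * p + bu * (p + bg\<^sup>2) + a * bu * bl)"
  shows "s * q \<le> li_yau_const n bu bg bl K a T"
proof -
  define \<alpha> where "\<alpha> = 2 / (real n * a\<^sup>2)"
  define c where "c = 2 * \<bar>K\<bar> + bu"
  define R where "R = c\<^sup>2 / (4 * \<alpha> * (a - 1)\<^sup>2) + bu * bg\<^sup>2 + a * bu * bl"
  have \<alpha>: "0 < \<alpha>" using n a by (simp add: \<alpha>_def)
  have R: "0 \<le> R" using \<alpha> a b by (simp add: R_def)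
  have C: "li_yau_const n bu bg bl K a T = (1 + T\<^sup>2 * R) / \<alpha> + 1"
    using b by (simp add: li_yau_const_def Let_def R_def c_def \<alpha>_def)
  have "q\<^sup>2 + (a - 1)\<^sup>2 * p\<^sup>2 \<le> (q + (a - 1) * p)\<^sup>2"
    using q p a by (simp add: power2_sum power_mult_distrib)
  also have "\<dots> = (a * l)\<^sup>2"
    unfolding l by (simp add: power2_eq_square algebra_simps)
  finally have "\<alpha> * (q\<^sup>2 + (a - 1)\<^sup>2 * p\<^sup>2) \<le> \<alpha> * (a * l)\<^sup>2"
    using \<alpha> by (intro mult_left_mono) auto
  also have "\<dots> = 2 / real n * l\<^sup>2"
    using a by (simp add: \<alpha>_def power_mult_distrib)
  finally have l2: "\<alpha> * q\<^sup>2 + \<alpha> * (a - 1)\<^sup>2 * p\<^sup>2 \<le> 2 / real n * l\<^sup>2"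
    by (simp add: distrib_left mult.assoc)
  have amgm: "c * p \<le> \<alpha> * (a - 1)\<^sup>2 * p\<^sup>2 + c\<^sup>2 / (4 * \<alpha> * (a - 1)\<^sup>2)"
  proof -
    define m where "m = \<alpha> * (a - 1)\<^sup>2"
    have m: "0 < m" using \<alpha> a by (simp add: m_def)
    have "0 \<le> (2 * m * p - c)\<^sup>2 / (4 * m)" using m by simp
    also have "\<dots> = m * p\<^sup>2 + c\<^sup>2 / (4 * m) - c * p"
      using m by (simp add: power2_eq_square field_simps)
    finally show ?thesis by (simp add: m_def mult.assoc)
  qed
  have "2 * K * p \<le> 2 * \<bar>K\<bar> * p"
    using p by (intro mult_right_mono) auto
  then have "- (2 / real n) * l\<^sup>2 + 2 * K * p + bu * (p + bg\<^sup>2) + a * bu * bl \<le> - \<alpha> * q\<^sup>2 + R"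
    using l2 amgm unfolding R_def c_def by (simp add: algebra_simps)
  then have "s * (- (2 / real n) * l\<^sup>2 + 2 * K * p + bu * (p + bg\<^sup>2) + a * bu * bl) \<le> s * (- \<alpha> * q\<^sup>2 + R)"
    using s by (intro mult_left_mono) auto
  then have "0 \<le> q + s * (- \<alpha> * q\<^sup>2 + R)"
    using ineq by linarith
  \<comment> \<open>The additional factor \<open>s\<close> makes the inequality quadratic in the
    product \<open>s * q\<close>.\<close>
  then have "0 \<le> s * (q + s * (- \<alpha> * q\<^sup>2 + R))"
    using s by simp
  then have main: "\<alpha> * (s * q)\<^sup>2 \<le> s * q + s\<^sup>2 * R"
    by (simp add: power2_eq_square algebra_simps)
  have sT: "s\<^sup>2 * R \<le> T\<^sup>2 * R"
    using s R by (intro mult_right_mono power_mono) auto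
  show ?thesis
  proof (rule ccontr)
    assume "\<not> ?thesis"
    then have big: "(1 + T\<^sup>2 * R) / \<alpha> + 1 < s * q" by (simp add: C)
    have "0 \<le> (1 + T\<^sup>2 * R) / \<alpha>" using \<alpha> R by simp
    then have one: "1 < s * q" using big by linarith
    have "1 + T\<^sup>2 * R < \<alpha> * (s * q)"
      using big \<alpha> by (simp add: field_simps)
    then have "(1 + T\<^sup>2 * R) * (s * q) < \<alpha> * (s * q) * (s * q)"
      using one by (intro mult_strict_right_mono) auto
    moreover have "T\<^sup>2 * R * 1 \<le> T\<^sup>2 * R * (s * q)"
      using one R by (intro mult_left_mono) auto
    ultimately have "s * q + T\<^sup>2 * R < \<alpha> * (s * q)\<^sup>2"
      by (simp add: power2_eq_square algebra_simps)
    then show False using main sT by linarith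
  qed
qed

section \<open>Charts of a closed manifold\<close>

locale closed_manifold =
  fixes M :: "('a::t2_space, 'n::finite) riemannian_manifold"
  assumes closed: "closed_riemannian_manifold M"
begin

lemma smooth_atlas: "smooth_atlas (points M) (atlas M)" and riemannian_metric: "riemannian_metric (atlas M) (metric M)"
  using closed by (simp_all add: closed_riemannian_manifold_def)

lemma chart:
  assumes "(U, \<phi>) \<in> atlas M"
  shows "openin (top_of_set (points M)) U" "open (\<phi> ` U)"
    "\<And>x. x \<in> U \<Longrightarrow> inv_into U \<phi> (\<phi> x) = x" "\<And>y. y \<in> \<phi> ` U \<Longrightarrow> \<phi> (inv_into U \<phi> y) = y"
    "continuous_on U \<phi>" "continuous_on (\<phi> ` U) (inv_into U \<phi>)"
proof -
  have "openin (top_of_set (points M)) U \<and> open (\<phi> ` U) \<and> homeomorphism U (\<phi> ` U) \<phi> (inv_into U \<phi>)"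
    by (rule smooth_atlas[unfolded smooth_atlas_def, THEN conjunct2, THEN conjunct1, THEN bspec, OF assms, unfolded prod.case])
  then show "openin (top_of_set (points M)) U" "open (\<phi> ` U)"
    "\<And>x. x \<in> U \<Longrightarrow> inv_into U \<phi> (\<phi> x) = x" "\<And>y. y \<in> \<phi> ` U \<Longrightarrow> \<phi> (inv_into U \<phi> y) = y"
    "continuous_on U \<phi>" "continuous_on (\<phi> ` U) (inv_into U \<phi>)"
    unfolding homeomorphism_def by auto
qed

lemma chart_sub: "(U, \<phi>) \<in> atlas M \<Longrightarrow> U \<subseteq> points M"
  by (rule openin_imp_subset[OF chart(1)])

lemma chart_at:
  assumes "x \<in> points M"
  shows "chart_at M x \<in> atlas M" "x \<in> fst (chart_at M x)"
proof -
  have "x \<in> (\<Union>(U, \<phi>)\<in>atlas M. U)"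
    using assms smooth_atlas[unfolded smooth_atlas_def, THEN conjunct1] by simp
  then obtain c where "c \<in> atlas M" "x \<in> (case c of (U, \<phi>) \<Rightarrow> U)"
    by (rule UN_E)
  then have "\<exists>c. c \<in> atlas M \<and> x \<in> fst c"
    by (intro exI[of _ c]) (simp add: case_prod_unfold)
  from someI_ex[OF this] show "chart_at M x \<in> atlas M" "x \<in> fst (chart_at M x)"
    unfolding chart_at_def by simp_all
qed

text \<open>The image of the overlap is the preimage, under the inverse chart map, of an ambient
  open set that cuts out the second chart domain.\<close>

lemma open_overlap:
  assumes "(U, \<phi>) \<in> atlas M" "(U', \<psi>) \<in> atlas M"
  shows "open (\<phi> ` (U \<inter> U'))"
proof -
  obtain O' where O': "open O'" "U' = points M \<inter> O'"
    using chart(1)[OF assms(2)] by (auto simp: openin_open)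
  have "\<phi> ` (U \<inter> U') = \<phi> ` U \<inter> inv_into U \<phi> -` O'"
    using chart(3)[OF assms(1)] chart_sub[OF assms(1)] O'(2) by auto
  then show ?thesis
    using continuous_open_preimage[OF chart(6)[OF assms(1)] chart(2)[OF assms(1)] O'(1)] by simp
qed

lemma metric_coords_chart:
  assumes "(U, \<phi>) \<in> atlas M" "V \<subseteq> \<phi> ` U" "open V"
  shows "metric_coords V (metric M (U, \<phi>))"
proof -
  note m = riemannian_metric[unfolded riemannian_metric_def, THEN conjunct1, THEN bspec, OF assms(1), unfolded prod.case]
  show ?thesis
  proof
    show "smooth_on V (\<lambda>y. metric M (U, \<phi>) y $ i $ j)" for i j
      using m[THEN conjunct1, rule_format] by (rule smooth_on_open_subset[OF _ assms(2,3)])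
    show "transpose (metric M (U, \<phi>) y) = metric M (U, \<phi>) y" if "y \<in> V" for y
      using m[THEN conjunct2] that assms(2) by blast
    show "0 < \<xi> \<bullet> (metric M (U, \<phi>) y *v \<xi>)" if "y \<in> V" "\<xi> \<noteq> 0" for y \<xi>
      using m[THEN conjunct2] that assms(2) unfolding metric_inner_def by blast
  qed (rule assms(3))
qed

text \<open>The source shrinks to the overlap, where the coordinate change is smooth and isometric;
  the target keeps its full chart image.\<close>

lemma chart_change_overlap:
  assumes c: "(U, \<phi>) \<in> atlas M" and c': "(U', \<psi>) \<in> atlas M"
  shows "chart_change (\<phi> ` (U \<inter> U')) (\<psi> ` U') (metric M (U, \<phi>)) (metric M (U', \<psi>)) (\<lambda>y. \<psi> (inv_into U \<phi> y))"
proof -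
  have sub: "\<phi> ` (U \<inter> U') \<subseteq> \<phi> ` U" by auto
  interpret A: metric_coords "\<phi> ` (U \<inter> U')" "metric M (U, \<phi>)"
    by (rule metric_coords_chart[OF c sub open_overlap[OF assms]])
  interpret B: metric_coords "\<psi> ` U'" "metric M (U', \<psi>)"
    by (rule metric_coords_chart[OF c' subset_refl chart(2)[OF c']])
  show ?thesis
  proof
    show "\<psi> (inv_into U \<phi> y) \<in> \<psi> ` U'" if "y \<in> \<phi> ` (U \<inter> U')" for y
      using that chart(3)[OF c] by auto
    show "smooth_on (\<phi> ` (U \<inter> U')) (\<lambda>y. \<psi> (inv_into U \<phi> y) $ i)" for i
      by (rule smooth_atlas[unfolded smooth_atlas_def, THEN conjunct2, THEN conjunct2, THEN bspec, OF c,
        unfolded prod.case, THEN bspec, OF c', unfolded prod.case, rule_format])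
    show "metric_inner (metric M (U, \<phi>)) y \<xi> \<eta> = metric_inner (metric M (U', \<psi>)) (\<psi> (inv_into U \<phi> y))
        (frechet_derivative (\<lambda>y. \<psi> (inv_into U \<phi> y)) (at y) \<xi>) (frechet_derivative (\<lambda>y. \<psi> (inv_into U \<phi> y)) (at y) \<eta>)"
      if "y \<in> \<phi> ` (U \<inter> U')" for y \<xi> \<eta>
      using that by (rule riemannian_metric[unfolded riemannian_metric_def Let_def, THEN conjunct2, THEN bspec, OF c,
        unfolded prod.case, THEN bspec, OF c', unfolded prod.case, rule_format])
  qed
qed

definition smooth_function :: "('a \<Rightarrow> real) \<Rightarrow> bool" where
  "smooth_function f \<longleftrightarrow> (\<forall>(U, \<phi>)\<in>atlas M. smooth_on (\<phi> ` U) (\<lambda>y. f (inv_into U \<phi> y)))"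

text \<open>The pull-back lemmas, applied between the given chart and the one picked by
  \<open>chart_at\<close>. A single chart can thus serve a whole neighbourhood. Squaring removes the
  root in \<open>grad_norm\<close>.\<close>

lemma chart_invariance:
  assumes c: "(U, \<phi>) \<in> atlas M" and x: "x \<in> U" and f: "smooth_function f"
  shows "laplacian M f x = coord_laplacian (metric M (U, \<phi>)) (\<lambda>y. f (inv_into U \<phi> y)) (\<phi> x)"
    and "(grad_norm M f x)\<^sup>2 = grad_inner (metric M (U, \<phi>)) (\<lambda>y. f (inv_into U \<phi> y)) (\<lambda>y. f (inv_into U \<phi> y)) (\<phi> x)"
proof -
  obtain U' \<psi> where ch: "chart_at M x = (U', \<psi>)" by (meson surj_pair)
  have xM: "x \<in> points M" using x chart_sub[OF c] by blast
  have c': "(U', \<psi>) \<in> atlas M" and x': "x \<in> U'"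
    using chart_at[OF xM] ch by auto
  let ?f = "\<lambda>y. f (inv_into U \<phi> y)" and ?f' = "\<lambda>y. f (inv_into U' \<psi> y)" and ?\<tau> = "\<lambda>y. \<psi> (inv_into U \<phi> y)"
  interpret chart_change "\<phi> ` (U \<inter> U')" "\<psi> ` U'" "metric M (U, \<phi>)" "metric M (U', \<psi>)" ?\<tau>
    by (rule chart_change_overlap[OF c c'])
  have y: "\<phi> x \<in> \<phi> ` (U \<inter> U')" using x x' by blast
  have fU: "smooth_on (\<phi> ` U) ?f" and f': "smooth_on (\<psi> ` U') ?f'"
    using f[unfolded smooth_function_def, THEN bspec, OF c] f[unfolded smooth_function_def, THEN bspec, OF c'] by simp_all
  have f: "smooth_on (\<phi> ` (U \<inter> U')) ?f"
    by (rule smooth_on_open_subset[OF fU _ open_overlap[OF c c']]) blast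
  have ff': "?f z = ?f' (?\<tau> z)" if "z \<in> \<phi> ` (U \<inter> U')" for z
    using that chart(3)[OF c] chart(3)[OF c'] by auto
  have \<tau>x: "?\<tau> (\<phi> x) = \<psi> x"
    using chart(3)[OF c x] by simp
  have "laplacian M f x = coord_laplacian (metric M (U', \<psi>)) ?f' (\<psi> x)"
    by (simp add: laplacian_def ch)
  then show "laplacian M f x = coord_laplacian (metric M (U, \<phi>)) ?f (\<phi> x)"
    using coord_laplacian_pullback[where f="?f" and f'="?f'", OF f f' ff' y] \<tau>x by simp
  have y': "\<psi> x \<in> \<psi> ` U'" using x' by blast
  have "(grad_norm M f x)\<^sup>2 = grad_inner (metric M (U', \<psi>)) ?f' ?f' (\<psi> x)"
    using B.grad_inner_nonneg[OF y', of ?f']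
    by (simp add: grad_norm_def ch Let_def B.grad_inner_eq_metric_inner[OF y'])
  then show "(grad_norm M f x)\<^sup>2 = grad_inner (metric M (U, \<phi>)) ?f ?f (\<phi> x)"
    using grad_inner_pullback[where f="?f" and f'="?f'", OF f f' ff' y] \<tau>x by simp
qed

lemma grad_norm_nonneg:
  assumes "x \<in> points M"
  shows "0 \<le> grad_norm M f x"
proof -
  obtain U \<phi> where ch: "chart_at M x = (U, \<phi>)" by (meson surj_pair)
  have c: "(U, \<phi>) \<in> atlas M" and x: "x \<in> U"
    using chart_at[OF assms] ch by auto
  interpret metric_coords "\<phi> ` U" "metric M (U, \<phi>)"
    by (rule metric_coords_chart[OF c subset_refl chart(2)[OF c]])
  have y: "\<phi> x \<in> \<phi> ` U" using x by blast
  show ?thesis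
    using grad_inner_nonneg[OF y, of "\<lambda>y. f (inv_into U \<phi> y)"]
    by (simp add: grad_norm_def ch Let_def grad_inner_eq_metric_inner[OF y])
qed

definition in_chart :: "'a set \<Rightarrow> ('a \<Rightarrow> real^'n) \<Rightarrow> ('a \<Rightarrow> real \<Rightarrow> real) \<Rightarrow> (real^'n) \<times> real \<Rightarrow> real" where
  "in_chart U \<phi> f = (\<lambda>(y, t). f (inv_into U \<phi> y) t)"

text \<open>Cutting off the face t = 0 yields an open set, on which the total derivatives are
  available.\<close>

lemma smooth_in_chart:
  assumes "smooth_spacetime M T f" "(U, \<phi>) \<in> atlas M"
  shows "smooth_on (\<phi> ` U \<times> {0<..<T}) (in_chart U \<phi> f)"
proof -
  have "smooth_on (\<phi> ` U \<times> {0..<T}) (in_chart U \<phi> f)"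
    using assms(1)[unfolded smooth_spacetime_def, THEN bspec, OF assms(2)] by (simp add: in_chart_def)
  then show ?thesis
    by (rule smooth_on_open_subset) (use chart(2)[OF assms(2)] in \<open>auto simp: open_Times\<close>)
qed

lemma smooth_function_slice:
  assumes "smooth_spacetime M T f" "t \<in> {0<..<T}"
  shows "smooth_function (\<lambda>x. f x t)"
  unfolding smooth_function_def
proof (intro ballI, unfold case_prod_unfold)
  fix c assume "c \<in> atlas M"
  then have "(fst c, snd c) \<in> atlas M" by simp
  from smooth_on_slice[OF chart(2)[OF this] open_greaterThanLessThan assms(2) smooth_in_chart[OF assms(1) this]]
  show "smooth_on (snd c ` fst c) (\<lambda>y. f (inv_into (fst c) (snd c) y) t)"
    by (simp add: in_chart_def)
qed

end

lemma has_real_derivative_slice: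
  fixes h :: "'b::euclidean_space \<times> real \<Rightarrow> real"
  assumes "h differentiable at (y, t)"
  shows "((\<lambda>s. h (y, s)) has_real_derivative dd (0, 1) h (y, t)) (at t)"
proof -
  have l: "linear (\<lambda>v. dd v h (y, t))"
    by (rule linear_frechet_derivative[OF assms])
  have "(\<lambda>r. dd (0, r) h (y, t)) = (*) (dd (0, 1) h (y, t))"
  proof
    fix r :: real
    have "dd (r *\<^sub>R (0, 1)) h (y, t) = r *\<^sub>R dd (0, 1) h (y, t)"
      by (rule linear_scale[OF l])
    then show "dd (0, r) h (y, t) = dd (0, 1) h (y, t) * r"
      by (simp add: mult.commute)
  qed
  then show ?thesis
    using has_derivative_slice(2)[OF assms[unfolded frechet_derivative_works]]
    by (simp only: has_field_derivative_def)
qed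

text \<open>At an interior time the derivative within \<open>{0..<T}\<close> is two-sided, hence a
  directional derivative on space-time.\<close>

lemma time_deriv_eq_dd:
  fixes h :: "(real^'n::finite) \<times> real \<Rightarrow> real"
  assumes "h differentiable at (y, t)" "t \<in> {0<..<T}" "\<And>s. s \<in> {0..<T} \<Longrightarrow> f x s = h (y, s)"
  shows "time_deriv T f x t = dd (0, 1) h (y, t)"
proof -
  have "((\<lambda>s. h (y, s)) has_vector_derivative dd (0, 1) h (y, t)) (at t)"
    using has_real_derivative_slice[OF assms(1)] by (simp only: has_real_derivative_iff_has_vector_derivative)
  then have "(f x has_vector_derivative dd (0, 1) h (y, t)) (at t)"
    by (rule has_vector_derivative_transform_within_open[of _ _ _ "{0<..<T}"]) (use assms in auto)
  moreover have "at t within {0..<T} = at t"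
    by (rule at_within_interior) (use assms(2) in auto)
  ultimately show ?thesis
    unfolding time_deriv_def by (simp add: vector_derivative_at)
qed

section \<open>The estimate\<close>

locale heat_solution = closed_manifold M
  for M :: "('a::t2_space, 'n::finite) riemannian_manifold" +
  fixes K a T :: real and A u :: "'a \<Rightarrow> real \<Rightarrow> real" and lam :: "real \<Rightarrow> real" and bu bg bl :: real
  assumes ric: "ricci_bounded_below M (- K)" and a: "1 < a"
    and smooth_A: "smooth_spacetime M T A" and A_nonneg: "\<And>x t. x \<in> points M \<Longrightarrow> t \<in> {0..<T} \<Longrightarrow> 0 \<le> A x t"
    and smooth_u: "smooth_spacetime M T u" and u_pos: "\<And>x t. x \<in> points M \<Longrightarrow> t \<in> {0..<T} \<Longrightarrow> 0 < u x t"
    and heat: "\<And>x t. x \<in> points M \<Longrightarrow> t \<in> {0..<T} \<Longrightarrow>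
      time_deriv T u x t - laplacian M (\<lambda>y. u y t) x = lam t * u x t + A x t"
    and bu: "\<And>x t. x \<in> points M \<Longrightarrow> t \<in> {0..<T} \<Longrightarrow> inverse (u x t) \<le> bu"
    and bg: "\<And>x t. x \<in> points M \<Longrightarrow> t \<in> {0..<T} \<Longrightarrow> grad_norm M (\<lambda>y. A y t) x \<le> bg"
    and bl: "\<And>x t. x \<in> points M \<Longrightarrow> t \<in> {0..<T} \<Longrightarrow> \<bar>laplacian M (\<lambda>y. A y t) x\<bar> \<le> bl"
begin

definition w :: "'a \<Rightarrow> real \<Rightarrow> real" where
  "w x t = ln (u x t)"

definition Q :: "'a \<Rightarrow> real \<Rightarrow> real" where
  "Q x t = (grad_norm M (\<lambda>y. w y t) x)\<^sup>2 - a * time_deriv T w x t + a * (lam t + inverse (u x t) * A x t)"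

text \<open>
  The expression of \<open>Q\<close> in a chart, where the heat equation has been used to eliminate
  the time derivative, and with it \<open>lam\<close>.
\<close>

definition chart_Q :: "'a set \<Rightarrow> ('a \<Rightarrow> real^'n) \<Rightarrow> (real^'n) \<times> real \<Rightarrow> real" where
  "chart_Q U \<phi> = li_yau_Q (metric M (U, \<phi>)) a (\<lambda>p. ln (in_chart U \<phi> u p))"

lemma spacetime_coords_chart:
  "(U, \<phi>) \<in> atlas M \<Longrightarrow> spacetime_coords (\<phi> ` U) (metric M (U, \<phi>)) {0<..<T}"
  by (simp add: spacetime_coords_def spacetime_coords_axioms_def metric_coords_chart chart(2))

context
  fixes U \<phi>
  assumes c: "(U, \<phi>) \<in> atlas M"
begin

interpretation spacetime_coords "\<phi> ` U" "metric M (U, \<phi>)" "{0<..<T}"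
  by (rule spacetime_coords_chart[OF c])

lemma in_chart_pos:
  assumes "p \<in> \<phi> ` U \<times> {0<..<T}"
  shows "0 < in_chart U \<phi> u p"
proof -
  obtain x t where p: "p = (\<phi> x, t)" "x \<in> U" "t \<in> {0<..<T}"
    using assms by auto
  then show ?thesis
    using u_pos[of x t] chart(3)[OF c p(2)] chart_sub[OF c] by (auto simp: in_chart_def)
qed

lemma heat_chart:
  assumes "z \<in> \<phi> ` U" "t \<in> {0<..<T}"
  shows "dt (in_chart U \<phi> u) (z, t) = coord_laplacian (metric M (U, \<phi>)) (\<lambda>z. in_chart U \<phi> u (z, t)) z
    + lam t * in_chart U \<phi> u (z, t) + in_chart U \<phi> A (z, t)"
proof -
  obtain x where x: "x \<in> U" "z = \<phi> x" using assms(1) by blast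
  have inv: "inv_into U \<phi> z = x" using chart(3)[OF c x(1)] x(2) by simp
  have "time_deriv T u x t = dt (in_chart U \<phi> u) (z, t)"
    by (rule time_deriv_eq_dd[OF diff_VI[OF smooth_in_chart[OF smooth_u c] assms] assms(2)]) (simp add: in_chart_def inv)
  moreover have "laplacian M (\<lambda>y. u y t) x = coord_laplacian (metric M (U, \<phi>)) (\<lambda>z. in_chart U \<phi> u (z, t)) z"
    using chart_invariance(1)[OF c x(1) smooth_function_slice[OF smooth_u assms(2)]] x(2) by (simp add: in_chart_def)
  ultimately show ?thesis
    using heat[of x t] x(1) chart_sub[OF c] assms(2) by (auto simp: in_chart_def inv)
qed

lemma smooth_spacetime_w: "smooth_on (\<phi> ` U \<times> {0<..<T}) (\<lambda>p. ln (in_chart U \<phi> u p))"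
  by (rule smooth_on_ln[OF open_VI smooth_in_chart[OF smooth_u c] in_chart_pos])

lemma smooth_chart_Q: "smooth_on (\<phi> ` U \<times> {0<..<T}) (chart_Q U \<phi>)"
  unfolding chart_Q_def li_yau_Q_def[abs_def]
  by (intro VI_intros smooth_coord_laplacian_slice[where h="\<lambda>p. ln (in_chart U \<phi> u p)"]
    smooth_grad_inner_slice[where h="\<lambda>p. ln (in_chart U \<phi> u p)"] smooth_spacetime_w)

end

lemma smooth_function_w:
  assumes "t \<in> {0<..<T}"
  shows "smooth_function (\<lambda>x. w x t)"
  unfolding smooth_function_def
proof (intro ballI, unfold case_prod_unfold)
  fix c assume "c \<in> atlas M"
  then have "(fst c, snd c) \<in> atlas M" by simp
  from smooth_on_slice[OF chart(2)[OF this] open_greaterThanLessThan assms smooth_spacetime_w[OF this]]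
  show "smooth_on (snd c ` fst c) (\<lambda>y. w (inv_into (fst c) (snd c) y) t)"
    by (simp add: in_chart_def w_def)
qed

text \<open>The logarithmic heat equation cancels \<open>lam\<close>, an arbitrary function of time.
  The right-hand side is smooth on space-time, so continuity and differentiability of
  \<open>Q\<close> are read off from it.\<close>

lemma Q_eq_chart_Q:
  assumes c: "(U, \<phi>) \<in> atlas M" and x: "x \<in> U" and t: "t \<in> {0<..<T}"
  shows "Q x t = chart_Q U \<phi> (\<phi> x, t)"
proof -
  interpret spacetime_coords "\<phi> ` U" "metric M (U, \<phi>)" "{0<..<T}"
    by (rule spacetime_coords_chart[OF c])
  have y: "\<phi> x \<in> \<phi> ` U" using x by blast
  have inv: "inv_into U \<phi> (\<phi> x) = x" by (rule chart(3)[OF c x])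
  let ?w = "\<lambda>z. ln (in_chart U \<phi> u (z, t))"
  have dw: "time_deriv T w x t = dt (\<lambda>p. ln (in_chart U \<phi> u p)) (\<phi> x, t)"
    by (rule time_deriv_eq_dd[OF diff_VI[OF smooth_spacetime_w[OF c] y t] t]) (simp add: in_chart_def w_def inv)
  have pos: "0 < in_chart U \<phi> u (z, t)" if "z \<in> \<phi> ` U" for z
    using in_chart_pos[OF c] that t by blast
  have "dt (\<lambda>p. ln (in_chart U \<phi> u p)) (\<phi> x, t) = coord_laplacian (metric M (U, \<phi>)) ?w (\<phi> x) + grad_inner (metric M (U, \<phi>)) ?w ?w (\<phi> x)
      + (lam t + A x t * inverse (u x t))"
    using log_heat_equation[where u="in_chart U \<phi> u" and A="in_chart U \<phi> A" and lam="lam t", OF smooth_in_chart[OF smooth_u c] pos y t heat_chart[OF c y t]]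
    by (simp add: in_chart_def inv)
  moreover note dw
  moreover have "(grad_norm M (\<lambda>y. w y t) x)\<^sup>2 = grad_inner (metric M (U, \<phi>)) ?w ?w (\<phi> x)"
    using chart_invariance(2)[OF c x smooth_function_w[OF t]] by (simp add: in_chart_def w_def)
  ultimately show ?thesis
    by (simp add: Q_def chart_Q_def li_yau_Q_def algebra_simps)
qed

section \<open>Maximum over space-time and removal of the shift\<close>

lemma continuous_on_Q:
  assumes "J \<subseteq> {0<..<T}"
  shows "continuous_on (points M \<times> J) (\<lambda>(x, t). Q x t)"
  unfolding continuous_on_eq_continuous_within
proof safe
  fix x t assume x: "x \<in> points M" and t: "t \<in> J"
  obtain U \<phi> where ch: "chart_at M x = (U, \<phi>)" by (meson surj_pair)
  have c: "(U, \<phi>) \<in> atlas M" and xU: "x \<in> U"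
    using chart_at[OF x] ch by auto
  obtain S where S: "open S" "U = points M \<inter> S"
    using chart(1)[OF c] by (auto simp: openin_open)
  have "continuous_on (U \<times> J) (\<lambda>p. chart_Q U \<phi> (\<phi> (fst p), snd p))"
    by (rule continuous_on_compose2[OF smooth_on_continuous[OF smooth_chart_Q[OF c]]])
      (use assms in \<open>auto intro!: continuous_intros continuous_on_compose2[OF chart(5)[OF c]]\<close>)
  then have "continuous_on (U \<times> J) (\<lambda>(x, t). Q x t)"
    by (rule continuous_on_cong[THEN iffD1, rotated -1, OF _ refl]) (use Q_eq_chart_Q[OF c] assms in auto)
  then have "continuous (at (x, t) within U \<times> J) (\<lambda>(x, t). Q x t)"
    using xU t by (simp add: continuous_on_eq_continuous_within)
  \<comment> \<open>Continuity is local and \<open>U\<close> is relatively open, so the chart domain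
    may replace the manifold.\<close>
  moreover have "at (x, t) within points M \<times> J = at (x, t) within U \<times> J"
    by (rule at_within_nhd[of _ "S \<times> UNIV"]) (use xU S in \<open>auto simp: open_Times\<close>)
  ultimately show "continuous (at (x, t) within points M \<times> J) (\<lambda>(x, t). Q x t)" by simp
qed

text \<open>\<open>t\<close> is the right end of the interval of comparison, so only earlier times
  have to compete with the maximum point; this suffices for the sign of the time derivative.\<close>

lemma shifted_bound_at_max:
  assumes x: "x \<in> points M" and t: "t \<in> {0<..<T}" and e: "0 < e" "e < t" and pos: "0 < Q x t"
    and max: "\<And>x' t'. x' \<in> points M \<Longrightarrow> t' \<in> {e..t} \<Longrightarrow> (t' - e) * Q x' t' \<le> (t - e) * Q x t"
  shows "(t - e) * Q x t \<le> li_yau_const CARD('n) bu bg bl K a T"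
proof -
  obtain U \<phi> where ch: "chart_at M x = (U, \<phi>)" by (meson surj_pair)
  have c: "(U, \<phi>) \<in> atlas M" and xU: "x \<in> U"
    using chart_at[OF x] ch by auto
  interpret spacetime_coords "\<phi> ` U" "metric M (U, \<phi>)" "{0<..<T}"
    by (rule spacetime_coords_chart[OF c])
  define y where "y = \<phi> x"
  have y: "y \<in> \<phi> ` U" using xU by (simp add: y_def)
  have inv: "inv_into U \<phi> y = x" unfolding y_def by (rule chart(3)[OF c xU])
  have Qy: "chart_Q U \<phi> (y, t') = Q x t'" if "t' \<in> {0<..<T}" for t'
    using Q_eq_chart_Q[OF c xU that] by (simp add: y_def)
  let ?L = "coord_laplacian (metric M (U, \<phi>)) (\<lambda>z. ln (in_chart U \<phi> u (z, t))) y"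
  let ?P = "grad_inner (metric M (U, \<phi>)) (\<lambda>z. ln (in_chart U \<phi> u (z, t))) (\<lambda>z. ln (in_chart U \<phi> u (z, t))) y"
  have tT: "t \<in> {0..<T}" using t by simp
  have space_max: "chart_Q U \<phi> (z, t) \<le> chart_Q U \<phi> (y, t)" if "z \<in> \<phi> ` U" for z
  proof -
    obtain x' where x': "x' \<in> U" "z = \<phi> x'" using \<open>z \<in> \<phi> ` U\<close> by blast
    then have "(t - e) * Q x' t \<le> (t - e) * Q x t"
      using max[of x' t] chart_sub[OF c] e by auto
    then show ?thesis
      using Q_eq_chart_Q[OF c x'(1) t] x'(2) Qy[OF t] e by simp
  qed
  \<comment> \<open>A negative derivative of (s - e) Q at \<open>t\<close> would make the function
    larger shortly before \<open>t\<close>.\<close>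
  have time_max: "0 \<le> chart_Q U \<phi> (y, t) + (t - e) * dt (chart_Q U \<phi>) (y, t)" (is "0 \<le> ?D")
  proof (rule ccontr)
    assume "\<not> 0 \<le> ?D"
    have d: "chart_Q U \<phi> differentiable at (y, t)"
      by (rule diff_VI[OF smooth_chart_Q[OF c] y t])
    have "((\<lambda>s. chart_Q U \<phi> (y, s)) has_real_derivative dt (chart_Q U \<phi>) (y, t)) (at t)"
      by (rule has_real_derivative_slice[OF d])
    then have "((\<lambda>s. (s - e) * chart_Q U \<phi> (y, s)) has_real_derivative ?D) (at t)"
      by (auto intro!: derivative_eq_intros)
    then obtain r where r: "0 < r" "\<And>h. 0 < h \<Longrightarrow> h < r \<Longrightarrow> (t - e) * chart_Q U \<phi> (y, t) < (t - h - e) * chart_Q U \<phi> (y, t - h)"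
      using DERIV_neg_dec_left[of _ ?D t] \<open>\<not> 0 \<le> ?D\<close> by auto
    \<comment> \<open>Small enough for the strict decrease and for t - h > e.\<close>
    define h where "h = min r (t - e) / 2"
    have h: "0 < h" "h < r" "h < t - e" using r e by (auto simp: h_def)
    then have "(t - h - e) * Q x (t - h) \<le> (t - e) * Q x t"
      using max[of x "t - h"] x e by auto
    then show False
      using r(2)[OF h(1,2)] Qy[OF t] Qy[of "t - h"] h e t by auto
  qed
  have ric_y: "- K * metric_inner (metric M (U, \<phi>)) y \<xi> \<xi> \<le> ricci (metric M (U, \<phi>)) y \<xi> \<xi>" for \<xi>
    by (rule ric[unfolded ricci_bounded_below_def, THEN bspec, OF c, unfolded prod.case, THEN bspec, OF y, THEN spec])
  have grad_A: "grad_inner (metric M (U, \<phi>)) (\<lambda>z. in_chart U \<phi> A (z, t)) (\<lambda>z. in_chart U \<phi> A (z, t)) y \<le> bg\<^sup>2"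
    using chart_invariance(2)[OF c xU smooth_function_slice[OF smooth_A t]] power_mono[OF bg[OF x tT] grad_norm_nonneg[OF x], of 2]
    by (simp add: in_chart_def y_def)
  have lap_A: "\<bar>coord_laplacian (metric M (U, \<phi>)) (\<lambda>z. in_chart U \<phi> A (z, t)) y\<bar> \<le> bl"
    using chart_invariance(1)[OF c xU smooth_function_slice[OF smooth_A t]] bl[OF x tT] by (simp add: in_chart_def y_def)
  have Q_split: "chart_Q U \<phi> (y, t) = - a * ?L + - (a - 1) * ?P"
    by (simp add: chart_Q_def li_yau_Q_def)
  have "0 \<le> chart_Q U \<phi> (y, t) + (t - e) * (- (2 / real CARD('n)) * ?L\<^sup>2 + 2 * K * ?P + bu * (?P + bg\<^sup>2) + a * bu * bl)"
  proof (rule li_yau_at_max[where u="in_chart U \<phi> u" and A="in_chart U \<phi> A" and a=a and y=y and t=t and s="t - e"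
        and lam="lam t" and K=K, folded chart_Q_def])
    show "0 \<le> in_chart U \<phi> A (y, t)" "inverse (in_chart U \<phi> u (y, t)) \<le> bu"
      using A_nonneg[OF x tT] bu[OF x tT] by (simp_all add: in_chart_def inv)
    show "0 < chart_Q U \<phi> (y, t)" "0 \<le> t - e"
      using pos e Qy[OF t] by simp_all
  qed (fact smooth_in_chart[OF smooth_u c] smooth_in_chart[OF smooth_A c] in_chart_pos[OF c] heat_chart[OF c _ t] y t a
      space_max time_max ric_y grad_A lap_A)+
  then have "0 \<le> Q x t + (t - e) * (- (2 / real CARD('n)) * ?L\<^sup>2 + 2 * K * ?P + bu * (?P + bg\<^sup>2) + a * bu * bl)"
    by (simp only: Qy[OF t])
  moreover have "0 \<le> bu"
    using bu[OF x tT] u_pos[OF x tT] by (meson inverse_positive_iff_positive less_imp_le order_trans)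
  moreover have "0 \<le> bl"
    using bl[OF x tT] by linarith
  moreover have "0 \<le> ?P"
    by (rule grad_inner_nonneg[OF y])
  moreover have "a * ?L = - Q x t - (a - 1) * ?P"
    using Q_split Qy[OF t] by (simp add: algebra_simps)
  ultimately show ?thesis
    using e t a pos by (intro li_yau_const_bound) auto
qed

text \<open>The absolute values in \<open>li_yau_const\<close> make this hold for all bounds. It
  settles t = 0 and a maximum that is not positive.\<close>

lemma const_nonneg:
  assumes "1 < a'"
  shows "0 \<le> li_yau_const n b b' b'' K' a' T'"
  using assms unfolding li_yau_const_def Let_def by simp

text \<open>Compactness provides a maximum point. The weight vanishes on the initial face, so a
  positive maximum lies at a time after \<open>e\<close> and has Q > 0 there.\<close>

lemma shifted_bound:
  assumes x: "x \<in> points M" and t: "t \<in> {0<..<T}" and e: "0 < e" "e < t"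
  shows "(t - e) * Q x t \<le> li_yau_const CARD('n) bu bg bl K a T"
proof -
  have J: "{e..t} \<subseteq> {0<..<T}" using e t by auto
  have "continuous_on (points M \<times> {e..t}) (\<lambda>p. (snd p - e) * (case p of (x, t) \<Rightarrow> Q x t))"
    by (intro continuous_intros continuous_on_Q[OF J])
  moreover have "compact (points M \<times> {e..t})"
    using closed unfolding closed_riemannian_manifold_def by (intro compact_Times) auto
  ultimately obtain p where p: "p \<in> points M \<times> {e..t}"
    "\<And>p'. p' \<in> points M \<times> {e..t} \<Longrightarrow> (snd p' - e) * (case p' of (x, t) \<Rightarrow> Q x t) \<le> (snd p - e) * (case p of (x, t) \<Rightarrow> Q x t)"
    using continuous_attains_sup[of "points M \<times> {e..t}" "\<lambda>p. (snd p - e) * (case p of (x, t) \<Rightarrow> Q x t)"] x e by force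
  obtain x0 t0 where p0: "p = (x0, t0)" by (meson surj_pair)
  have max: "(t' - e) * Q x' t' \<le> (t0 - e) * Q x0 t0" if "x' \<in> points M" "t' \<in> {e..t}" for x' t'
    using p(2)[of "(x', t')"] that p0 by simp
  have x0: "x0 \<in> points M" "t0 \<in> {e..t}" using p(1) p0 by auto
  have le: "(t - e) * Q x t \<le> (t0 - e) * Q x0 t0"
    using max[OF x, of t] e by simp
  show ?thesis
  proof (cases "0 < (t0 - e) * Q x0 t0")
    case True
    then have "e < t0" "0 < Q x0 t0"
      using x0 by (auto simp: zero_less_mult_iff)
    \<comment> \<open>A maximum over \<open>{e..t}\<close> is one over \<open>{e..t0}\<close> as
      well, whose right end is \<open>t0\<close>.\<close>
    then have "(t0 - e) * Q x0 t0 \<le> li_yau_const CARD('n) bu bg bl K a T"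
      using max x0 t e by (intro shifted_bound_at_max) auto
    then show ?thesis using le by linarith
  next
    case False
    then show ?thesis using le const_nonneg[OF a, of "CARD('n)" bu bg bl K T] by linarith
  qed
qed

lemma bound:
  assumes x: "x \<in> points M" and t: "t \<in> {0..<T}"
  shows "t * Q x t \<le> li_yau_const CARD('n) bu bg bl K a T" (is "_ \<le> ?C")
proof (cases "t = 0")
  \<comment> \<open>The weight \<open>t\<close> makes the product 0, whatever the one-sided time
    derivative is.\<close>
  case True
  then show ?thesis using const_nonneg[OF a] by simp
next
  case False
  then have t: "t \<in> {0<..<T}" using t by auto
  show ?thesis
  proof (rule ccontr)
    assume *: "\<not> ?thesis"
    have C: "0 \<le> ?C" by (rule const_nonneg[OF a])
    then have "0 < t * Q x t" using * by linarith
    then have Q: "0 < Q x t" using t by (simp add: zero_less_mult_iff)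
    \<comment> \<open>The shift for which (t - e) Q is the midpoint of t Q and the constant; it
      would still exceed the constant.\<close>
    define e where "e = (t * Q x t - ?C) / (2 * Q x t)"
    have eq: "e * Q x t = (t * Q x t - ?C) / 2" using Q by (simp add: e_def)
    have "0 < e" using * Q by (simp add: e_def)
    moreover have "e < t" using Q C \<open>0 < t * Q x t\<close> by (simp add: e_def pos_divide_less_eq)
    ultimately have "t * Q x t - (t * Q x t - ?C) / 2 \<le> ?C"
      using shifted_bound[OF x t, of e] by (simp only: left_diff_distrib eq)
    then show False using * by argo
  qed
qed

end

theorem theorem7:
  fixes M :: "('a::t2_space, 'n::finite) riemannian_manifold"
  assumes "closed_riemannian_manifold M"
  shows "\<exists>C :: real \<Rightarrow> real \<Rightarrow> real \<Rightarrow> real \<Rightarrow> real \<Rightarrow> real \<Rightarrow> real \<Rightarrow> real.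
    \<forall>(K::real) (a::real) (T::real) (A :: 'a \<Rightarrow> real \<Rightarrow> real) (lam :: real \<Rightarrow> real)
      (u :: 'a \<Rightarrow> real \<Rightarrow> real) (b\<^sub>0::real) (b\<^sub>1::real) (b\<^sub>2::real) (b\<^sub>3::real).
      ricci_bounded_below M (- K) \<longrightarrow>
      T > 0 \<longrightarrow> a > 1 \<longrightarrow>
      smooth_spacetime M T A \<longrightarrow>
      (\<forall>x\<in>points M. \<forall>t\<in>{0..<T}. A x t \<ge> 0) \<longrightarrow>
      smooth_spacetime M T u \<longrightarrow>
      (\<forall>x\<in>points M. \<forall>t\<in>{0..<T}. u x t > 0) \<longrightarrow>
      (\<forall>x\<in>points M. \<forall>t\<in>{0..<T}.
         time_deriv T u x t - laplacian M (\<lambda>y. u y t) x = lam t * u x t + A x t) \<longrightarrow>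
      (\<forall>x\<in>points M. \<forall>t\<in>{0..<T}.
         inverse (u x t) \<le> b\<^sub>0 \<and> \<bar>A x t\<bar> \<le> b\<^sub>1 \<and>
         grad_norm M (\<lambda>y. A y t) x \<le> b\<^sub>2 \<and> \<bar>laplacian M (\<lambda>y. A y t) x\<bar> \<le> b\<^sub>3) \<longrightarrow>
      (let w = (\<lambda>x t. ln (u x t));
           F = (\<lambda>x t. t * ((grad_norm M (\<lambda>y. w y t) x)\<^sup>2 - a * time_deriv T w x t
                          + a * (lam t + inverse (u x t) * A x t)))
       in (SUP (x, t)\<in>points M \<times> {0..<T}. ereal (F x t)) \<le> ereal (C b\<^sub>0 b\<^sub>1 b\<^sub>2 b\<^sub>3 K a T))"
proof (rule exI[of _ "\<lambda>b\<^sub>0 b\<^sub>1. li_yau_const CARD('n) b\<^sub>0"], intro allI impI)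
  \<comment> \<open>The witness is a closed formula, hence fixed before all data on
    \<open>M\<close>; the manifold enters through its dimension \<open>CARD('n)\<close>.\<close>
  fix K a T :: real and A :: "'a \<Rightarrow> real \<Rightarrow> real" and lam :: "real \<Rightarrow> real" and u :: "'a \<Rightarrow> real \<Rightarrow> real"
    and b\<^sub>0 b\<^sub>1 b\<^sub>2 b\<^sub>3 :: real
  assume *: "ricci_bounded_below M (- K)" "a > 1" "smooth_spacetime M T A"
      "\<forall>x\<in>points M. \<forall>t\<in>{0..<T}. A x t \<ge> 0" "smooth_spacetime M T u"
      "\<forall>x\<in>points M. \<forall>t\<in>{0..<T}. u x t > 0"
      "\<forall>x\<in>points M. \<forall>t\<in>{0..<T}.
         time_deriv T u x t - laplacian M (\<lambda>y. u y t) x = lam t * u x t + A x t"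
      "\<forall>x\<in>points M. \<forall>t\<in>{0..<T}.
         inverse (u x t) \<le> b\<^sub>0 \<and> \<bar>A x t\<bar> \<le> b\<^sub>1 \<and>
         grad_norm M (\<lambda>y. A y t) x \<le> b\<^sub>2 \<and> \<bar>laplacian M (\<lambda>y. A y t) x\<bar> \<le> b\<^sub>3"
  interpret heat_solution M K a T A u lam b\<^sub>0 b\<^sub>2 b\<^sub>3
    by unfold_locales (use assms * in auto)
  have "ereal (t * ((grad_norm M (\<lambda>y. ln (u y t)) x)\<^sup>2 - a * time_deriv T (\<lambda>x t. ln (u x t)) x t
      + a * (lam t + inverse (u x t) * A x t))) \<le> ereal (li_yau_const CARD('n) b\<^sub>0 b\<^sub>2 b\<^sub>3 K a T)"
    if "x \<in> points M" "t \<in> {0..<T}" for x t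
    using bound[OF that] by (simp add: Q_def w_def[abs_def])
  then show "let w = (\<lambda>x t. ln (u x t));
           F = (\<lambda>x t. t * ((grad_norm M (\<lambda>y. w y t) x)\<^sup>2 - a * time_deriv T w x t
                          + a * (lam t + inverse (u x t) * A x t)))
       in (SUP (x, t)\<in>points M \<times> {0..<T}. ereal (F x t)) \<le> ereal (li_yau_const CARD('n) b\<^sub>0 b\<^sub>2 b\<^sub>3 K a T)"
    \<comment> \<open>The supremum is taken in \<open>ereal\<close>, a complete lattice, so
      pointwise bounds suffice.\<close>
    unfolding Let_def by (intro SUP_least) auto
qed

end
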